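(* For each $n\in\{2,3,4\}$, the set $\mathcal{T}^1(\mathbb{T}^n)$ of $C^1$ diffeomorphisms of the torus $\mathbb{T}^n=\mathbb{R}^n/\mathbb{Z}^n$ with trivial centralizer has nonempty interior in $\mathrm{Diff}^1(\mathbb{T}^n)$ with respect to the $C^1$ topology.
   Context: For a compact smooth manifold $M$, $\mathrm{Diff}^1(M)$ is the group of $C^1$ diffeomorphisms of $M$ with the $C^1$ topology. The centralizer of $f\in\mathrm{Diff}^1(M)$ is $Z(f)=\{g\in\mathrm{Diff}^1(M): fg=gf\}$. One says $f$ has trivial centralizer if $Z(f)=\langle f\rangle=\{f^k:k\in\mathbb{Z}\}$. $\mathcal{T}^1(M)\subset\mathrm{Diff}^1(M)$ denotes the subset of diffeomorphisms with trivial centralizer. *)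

theory Defs
  imports "HOL-Analysis.Analysis"
begin

section \<open>The torus\<close>

definition Z_equiv :: "real ^ 'n \<Rightarrow> real ^ 'n \<Rightarrow> bool" where
  "Z_equiv x y \<longleftrightarrow> (\<forall>i. x $ i - y $ i \<in> \<int>)"

lemma Z_equiv_equivp: "equivp (Z_equiv :: real ^ 'n \<Rightarrow> real ^ 'n \<Rightarrow> bool)"
proof (rule equivpI)
  show "reflp (Z_equiv :: real ^ 'n \<Rightarrow> real ^ 'n \<Rightarrow> bool)"
    by (simp add: reflp_def Z_equiv_def)
  show "symp (Z_equiv :: real ^ 'n \<Rightarrow> real ^ 'n \<Rightarrow> bool)"
    unfolding symp_def Z_equiv_def by (metis Ints_minus minus_diff_eq)
  show "transp (Z_equiv :: real ^ 'n \<Rightarrow> real ^ 'n \<Rightarrow> bool)"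
    unfolding transp_def Z_equiv_def
  proof (intro allI impI)
    fix x y z :: "real ^ 'n" and i
    assume "\<forall>i. x $ i - y $ i \<in> \<int>" "\<forall>i. y $ i - z $ i \<in> \<int>"
    then have "(x $ i - y $ i) + (y $ i - z $ i) \<in> \<int>" by (intro Ints_add) simp_all
    then show "x $ i - z $ i \<in> \<int>" by simp
  qed
qed

quotient_type (overloaded) 'n torus = "real ^ 'n" / Z_equiv
  morphisms torus_rep torus_proj
  by (rule Z_equiv_equivp)

lemma torus_proj_eq_iff: "torus_proj x = torus_proj y \<longleftrightarrow> Z_equiv x y"
  by (rule torus.abs_eq_iff)

lemma torus_proj_surj: "\<exists>x. torus_proj x = p"
  by (metis Quotient3_abs_rep Quotient3_torus)

lemma torus_fibre_closed: "closed (torus_proj -` {p})"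
proof -
  obtain b where b: "p = torus_proj b"
    using torus_proj_surj by metis
  have "closed {x :: real ^ 'a. \<forall>i. x $ i - b $ i \<in> \<int>}"
  proof (intro closed_Collect_all)
    fix i
    have "closed ((\<lambda>x :: real ^ 'a. x $ i - b $ i) -` \<int>)"
      by (intro closed_vimage closed_Ints continuous_intros)
    then show "closed {x :: real ^ 'a. x $ i - b $ i \<in> \<int>}"
      by (simp add: vimage_def)
  qed
  moreover have "torus_proj -` {p} = {x. \<forall>i. x $ i - b $ i \<in> \<int>}"
    by (auto simp: b torus_proj_eq_iff Z_equiv_def)
  ultimately show ?thesis by simp
qed

lemma torus_proj_translate:
  assumes "torus_proj x = torus_proj y"
  shows "torus_proj (z + (x - y)) = torus_proj z"
  using assms by (simp add: torus_proj_eq_iff Z_equiv_def)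

text \<open>The flat metric; \<open>open_torus_iff\<close> below shows that it induces the quotient topology.\<close>

instantiation torus :: (finite) metric_space
begin

definition dist_torus :: "'a torus \<Rightarrow> 'a torus \<Rightarrow> real" where
  "dist_torus p q = setdist (torus_proj -` {p}) (torus_proj -` {q})"

definition uniformity_torus :: "('a torus \<times> 'a torus) filter" where
  "uniformity_torus = (INF e\<in>{0<..}. principal {(p, q). dist p q < e})"

definition open_torus :: "'a torus set \<Rightarrow> bool" where
  "open_torus U \<longleftrightarrow> (\<forall>x\<in>U. eventually (\<lambda>(x', y). x' = x \<longrightarrow> y \<in> U) uniformity)"

lemma dist_torus_proj_le: "dist (torus_proj x) (torus_proj y) \<le> dist x y"
  unfolding dist_torus_def by (rule setdist_le_dist) auto

lemma dist_torus_attained: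
  assumes "torus_proj x = p"
  shows "\<exists>y. torus_proj y = q \<and> dist x y = dist p q"
proof -
  let ?Q = "torus_proj -` {q}"
  have ne: "?Q \<noteq> {}" using torus_proj_surj[of q] by auto
  obtain y where y: "y \<in> ?Q" "infdist x ?Q = dist x y"
    using infdist_attains_inf[OF torus_fibre_closed ne] by metis
  have "dist x y \<le> dist p q"
    unfolding dist_torus_def
  proof (rule le_setdistI)
    show "torus_proj -` {p} \<noteq> {}" "?Q \<noteq> {}"
      using ne assms by auto
    fix a b assume a: "a \<in> torus_proj -` {p}" and b: "b \<in> ?Q"
    have "b + (x - a) \<in> ?Q"
      using a b assms torus_proj_translate[of x a b] by simp
    then have "infdist x ?Q \<le> dist x (b + (x - a))" by (rule infdist_le)
    also have "\<dots> = dist a b" by (simp add: dist_norm)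
    finally show "dist x y \<le> dist a b" using y by simp
  qed
  moreover have "dist p q \<le> dist x y"
    using dist_torus_proj_le[of x y] y assms by simp
  ultimately show ?thesis using y by force
qed

instance
proof
  fix p q r :: "'a torus"
  show "uniformity = (INF e\<in>{0<..}. principal {(p :: 'a torus, q). dist p q < e})"
    by (rule uniformity_torus_def)
  show "open U \<longleftrightarrow> (\<forall>x\<in>U. \<forall>\<^sub>F (x', y) in uniformity. x' = x \<longrightarrow> y \<in> U)" for U :: "'a torus set"
    by (rule open_torus_def)
  obtain x where x: "torus_proj x = p" using torus_proj_surj by metis
  obtain y where y: "torus_proj y = q" "dist x y = dist p q"
    using dist_torus_attained[OF x] by metis
  show "dist p q = 0 \<longleftrightarrow> p = q"
  proof
    show "p = q" if "dist p q = 0" using that x y by simp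
    have "dist p p \<le> 0" using dist_torus_proj_le[of x x] x by simp
    moreover have "0 \<le> dist p p" unfolding dist_torus_def by (rule setdist_pos_le)
    ultimately show "dist p q = 0" if "p = q" using that by simp
  qed
  obtain w where w: "torus_proj w = r" "dist x w = dist p r"
    using dist_torus_attained[OF x] by metis
  obtain v where v: "torus_proj v = q" "dist w v = dist r q"
    using dist_torus_attained[OF w(1)] by metis
  have "dist p q \<le> dist x v" using dist_torus_proj_le[of x v] x v by simp
  also have "\<dots> \<le> dist x w + dist w v" by (rule dist_triangle)
  finally show "dist p q \<le> dist p r + dist q r"
    using w v by (simp add: dist_torus_def setdist_sym)
qed

end

lemma continuous_on_torus_proj: "continuous_on S torus_proj"
  unfolding continuous_on_iff by (meson dist_torus_proj_le le_less_trans)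

lemma open_torus_iff: "open U \<longleftrightarrow> open (torus_proj -` U)"
proof
  assume "open U"
  then show "open (torus_proj -` U)"
    using continuous_on_torus_proj[of UNIV] by (intro open_vimage)
next
  assume *: "open (torus_proj -` U)"
  show "open U"
    unfolding open_dist
  proof
    fix p assume "p \<in> U"
    obtain x where x: "torus_proj x = p" using torus_proj_surj by metis
    then obtain e where e: "e > 0" "\<And>y. dist y x < e \<Longrightarrow> y \<in> torus_proj -` U"
      using * \<open>p \<in> U\<close> unfolding open_dist by auto
    have "q \<in> U" if "dist q p < e" for q
      using dist_torus_attained[OF x, of q] e(2) that by (metis dist_commute vimage_eq)
    with e(1) show "\<exists>e>0. \<forall>q. dist q p < e \<longrightarrow> q \<in> U" by blast
  qed
qed

lemma torus_proj_eq_near: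
  fixes x y :: "real ^ 'n"
  assumes "torus_proj x = torus_proj y" "dist x y < 1"
  shows "x = y"
proof -
  have "x $ i = y $ i" for i
  proof -
    have "\<bar>x $ i - y $ i\<bar> < 1"
      using assms(2) component_le_norm_cart[of "x - y" i] by (simp add: dist_norm)
    moreover have "x $ i - y $ i \<in> \<int>"
      using assms(1) by (simp add: torus_proj_eq_iff Z_equiv_def)
    ultimately show ?thesis
      using Ints_nonzero_abs_less1[of "x $ i - y $ i"] by simp
  qed
  then show ?thesis by (simp add: vec_eq_iff)
qed

section \<open>Continuously differentiable maps\<close>

text \<open>
  The charts of the torus are the local inverses of \<^term>\<open>torus_proj\<close>, so a representative of a
  map \<open>f\<close> in charts near a point is a local lift \<open>F\<close> of \<open>f\<close>.  The coordinate vector fields of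
  \<open>\<real>\<^sup>n\<close> descend to the torus and identify every tangent space with \<open>\<real>\<^sup>n\<close>; in this
  trivialisation the tangent map of \<open>f\<close> at \<open>p\<close> is the derivative of any such \<open>F\<close>.
\<close>

definition has_torus_derivative ::
    "('n::finite torus \<Rightarrow> 'n torus) \<Rightarrow> ((real ^ 'n) \<Rightarrow>\<^sub>L (real ^ 'n)) \<Rightarrow> 'n torus \<Rightarrow> bool" where
  "has_torus_derivative f A p \<longleftrightarrow>
     (\<exists>x F. torus_proj x = p \<and>
            (\<forall>\<^sub>F y in nhds x. torus_proj (F y) = f (torus_proj y)) \<and>
            (F has_derivative blinfun_apply A) (at x))"

definition torus_deriv ::
    "('n::finite torus \<Rightarrow> 'n torus) \<Rightarrow> 'n torus \<Rightarrow> ((real ^ 'n) \<Rightarrow>\<^sub>L (real ^ 'n))" where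
  "torus_deriv f p = (THE A. has_torus_derivative f A p)"

lemma has_torus_derivative_at_lift:
  assumes "has_torus_derivative f A p" "torus_proj x = p"
  shows "\<exists>F. (\<forall>\<^sub>F y in nhds x. torus_proj (F y) = f (torus_proj y)) \<and>
             (F has_derivative blinfun_apply A) (at x)"
proof -
  obtain x' G where G: "torus_proj x' = p" "(G has_derivative blinfun_apply A) (at x')"
      "\<forall>\<^sub>F y in nhds x'. torus_proj (G y) = f (torus_proj y)"
    using assms(1) unfolding has_torus_derivative_def by blast
  define k where "k = x' - x"
  have proj_k: "torus_proj (y + k) = torus_proj y" for y
    unfolding k_def using torus_proj_translate assms(2) G(1) by metis
  have x': "x' = x + k" by (simp add: k_def)
  have "((\<lambda>y. y + k) has_derivative (\<lambda>h. h)) (at x)"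
    by (auto intro!: derivative_eq_intros)
  then have "((\<lambda>y. G (y + k)) has_derivative blinfun_apply A) (at x)"
    using has_derivative_compose[of "\<lambda>y. y + k" "\<lambda>h. h" x UNIV G "blinfun_apply A"]
      G(2) x' by simp
  moreover have "((\<lambda>y. y + k) \<longlongrightarrow> x') (nhds x)"
    unfolding x' by (intro tendsto_intros filterlim_ident)
  then have "\<forall>\<^sub>F y in nhds x. torus_proj (G (y + k)) = f (torus_proj (y + k))"
    using G(3) by (rule filterlim_iff[THEN iffD1, rule_format])
  then have "\<forall>\<^sub>F y in nhds x. torus_proj (G (y + k)) = f (torus_proj y)"
    by (simp add: proj_k)
  ultimately show ?thesis
    by (intro exI[of _ "\<lambda>y. G (y + k)"] conjI)
qed

lemma has_torus_derivative_unique: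
  assumes "has_torus_derivative f A p" "has_torus_derivative f B p"
  shows "A = B"
proof -
  obtain x F where F: "torus_proj x = p" "(F has_derivative blinfun_apply A) (at x)"
      "\<forall>\<^sub>F y in nhds x. torus_proj (F y) = f (torus_proj y)"
    using assms(1) unfolding has_torus_derivative_def by blast
  obtain H where Hder: "(H has_derivative blinfun_apply B) (at x)"
      and H: "\<forall>\<^sub>F y in nhds x. torus_proj (H y) = f (torus_proj y)"
    using has_torus_derivative_at_lift[OF assms(2) F(1)] by blast
  have HF: "\<forall>\<^sub>F y in nhds x. torus_proj (H y) = torus_proj (F y)"
    using H F(3) by eventually_elim simp
  define c where "c = H x - F x"
  have c: "torus_proj (H x) = torus_proj (F x)"
    using HF by (rule eventually_nhds_x_imp_x)
  have "isCont (\<lambda>y. H y - F y) x"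
    using Hder F(2) by (intro continuous_intros has_derivative_continuous)
  then have "((\<lambda>y. H y - F y) \<longlongrightarrow> c) (nhds x)"
    by (simp add: c_def isCont_def tendsto_nhds_iff)
  then have "\<forall>\<^sub>F y in nhds x. dist (H y - F y) c < 1"
    by (rule tendstoD) simp
  then have "\<forall>\<^sub>F y in nhds x. H y = F y + c"
    using HF
  proof eventually_elim
    case (elim y)
    have "torus_proj (F y + c) = torus_proj (H y)"
      using torus_proj_translate[OF c, of "F y"] elim by (simp add: c_def)
    moreover have "dist (H y) (F y + c) < 1"
      using elim(1) by (simp add: dist_norm algebra_simps)
    ultimately show ?case using torus_proj_eq_near by metis
  qed
  then have ev: "\<forall>\<^sub>F y in at x. F y + c = H y"
    unfolding eventually_at_filter by eventually_elim simp
  have "((\<lambda>y. F y + c) has_derivative blinfun_apply A) (at x)"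
    using F(2) by (auto intro!: derivative_eq_intros)
  then have "(H has_derivative blinfun_apply A) (at x)"
    by (rule has_derivative_transform_eventually[OF _ ev]) (simp_all add: c_def)
  with Hder have "blinfun_apply A = blinfun_apply B"
    using has_derivative_unique by blast
  then show ?thesis by (simp add: blinfun_apply_inject)
qed

lemma torus_deriv_eq: "has_torus_derivative f A p \<Longrightarrow> torus_deriv f p = A"
  unfolding torus_deriv_def using has_torus_derivative_unique by blast

definition torus_C1 :: "('n::finite torus \<Rightarrow> 'n torus) \<Rightarrow> bool" where
  "torus_C1 f \<longleftrightarrow>
     (\<forall>p. \<exists>A. has_torus_derivative f A p) \<and> continuous_on UNIV (torus_deriv f)"

definition Diff1 :: "('n::finite torus \<Rightarrow> 'n torus) set" where
  "Diff1 = {f. bij f \<and> torus_C1 f \<and> torus_C1 (inv f)}"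

lemma has_torus_derivative_id: "has_torus_derivative id id_blinfun p"
proof -
  obtain x where "torus_proj x = p" using torus_proj_surj by metis
  then show ?thesis
    unfolding has_torus_derivative_def
    by (intro exI[of _ x] exI[of _ "\<lambda>y. y"]) (auto intro!: derivative_eq_intros)
qed

lemma has_torus_derivative_comp:
  assumes "has_torus_derivative f A p" "has_torus_derivative g B (f p)"
  shows "has_torus_derivative (g \<circ> f) (B o\<^sub>L A) p"
proof -
  obtain x F where F: "torus_proj x = p" "(F has_derivative blinfun_apply A) (at x)"
      "\<forall>\<^sub>F y in nhds x. torus_proj (F y) = f (torus_proj y)"
    using assms(1) unfolding has_torus_derivative_def by blast
  have "torus_proj (F x) = f p"
    using eventually_nhds_x_imp_x[OF F(3)] F(1) by simp
  then obtain G where G: "(G has_derivative blinfun_apply B) (at (F x))"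
      "\<forall>\<^sub>F y in nhds (F x). torus_proj (G y) = g (torus_proj y)"
    using has_torus_derivative_at_lift[OF assms(2)] by blast
  have "(F \<longlongrightarrow> F x) (nhds x)"
    using has_derivative_continuous[OF F(2)]
    by (simp add: isCont_def tendsto_nhds_iff)
  then have "\<forall>\<^sub>F y in nhds x. torus_proj (G (F y)) = g (torus_proj (F y))"
    using G(2) by (rule filterlim_iff[THEN iffD1, rule_format])
  then have "\<forall>\<^sub>F y in nhds x. torus_proj (G (F y)) = (g \<circ> f) (torus_proj y)"
    using F(3) by eventually_elim simp
  moreover have "((\<lambda>y. G (F y)) has_derivative blinfun_apply (B o\<^sub>L A)) (at x)"
    using has_derivative_compose[OF F(2) G(1)] by (simp add: blinfun_compose.rep_eq o_def)
  ultimately show ?thesis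
    unfolding has_torus_derivative_def using F(1)
    by (intro exI[of _ x] exI[of _ "\<lambda>y. G (F y)"] conjI)
qed

lemma has_torus_derivative_imp_isCont:
  assumes "has_torus_derivative f A p"
  shows "isCont f p"
  unfolding continuous_at_eps_delta
proof (intro allI impI)
  fix e :: real assume "e > 0"
  obtain x F where F: "torus_proj x = p" "(F has_derivative blinfun_apply A) (at x)"
      "\<forall>\<^sub>F y in nhds x. torus_proj (F y) = f (torus_proj y)"
    using assms unfolding has_torus_derivative_def by blast
  have "(F \<longlongrightarrow> F x) (nhds x)"
    using has_derivative_continuous[OF F(2)]
    by (simp add: isCont_def tendsto_nhds_iff)
  then have "\<forall>\<^sub>F y in nhds x. dist (F y) (F x) < e" using \<open>e > 0\<close> by (rule tendstoD)
  then have "\<forall>\<^sub>F y in nhds x. dist (f (torus_proj y)) (f p) < e"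
    using F(3)
  proof eventually_elim
    case (elim y)
    then show ?case
      using dist_torus_proj_le[of "F y" "F x"] eventually_nhds_x_imp_x[OF F(3)] F(1) by simp
  qed
  then obtain d where d: "d > 0" "\<And>y. dist y x < d \<Longrightarrow> dist (f (torus_proj y)) (f p) < e"
    unfolding eventually_nhds_metric by blast
  have "dist (f q) (f p) < e" if "dist q p < d" for q
    using dist_torus_attained[OF F(1), of q] d(2) that by (metis dist_commute)
  with d(1) show "\<exists>d>0. \<forall>q. dist q p < d \<longrightarrow> dist (f q) (f p) < e" by blast
qed

lemma has_torus_derivative_torus_deriv:
  assumes "torus_C1 f"
  shows "has_torus_derivative f (torus_deriv f p) p"
proof -
  obtain A where A: "has_torus_derivative f A p"
    using assms unfolding torus_C1_def by blast
  then show ?thesis using torus_deriv_eq[OF A] by simp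
qed

lemma torus_C1_imp_continuous_on: "torus_C1 f \<Longrightarrow> continuous_on UNIV f"
  by (rule continuous_at_imp_continuous_on)
     (simp add: has_torus_derivative_imp_isCont[OF has_torus_derivative_torus_deriv])

lemma torus_C1_id: "torus_C1 id"
proof -
  have "torus_deriv id = (\<lambda>p :: 'a torus. id_blinfun)"
    by (rule ext, rule torus_deriv_eq, rule has_torus_derivative_id)
  then show ?thesis
    unfolding torus_C1_def using has_torus_derivative_id by auto
qed

lemma torus_C1_comp:
  assumes f: "torus_C1 f" and g: "torus_C1 g"
  shows "torus_C1 (g \<circ> f)"
proof -
  have df: "has_torus_derivative f (torus_deriv f p) p"
    and dg: "has_torus_derivative g (torus_deriv g p) p" for p
    using has_torus_derivative_torus_deriv f g by blast+
  have D: "has_torus_derivative (g \<circ> f) (torus_deriv g (f p) o\<^sub>L torus_deriv f p) p" for p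
    using has_torus_derivative_comp df dg by blast
  have cf: "continuous_on UNIV (torus_deriv f)" and cg: "continuous_on UNIV (torus_deriv g)"
    using f g unfolding torus_C1_def by simp_all
  have "continuous_on UNIV (\<lambda>p. torus_deriv g (f p))"
    by (rule continuous_on_compose2[OF cg torus_C1_imp_continuous_on[OF f]]) simp
  then have "continuous_on UNIV (\<lambda>p. torus_deriv g (f p) o\<^sub>L torus_deriv f p)"
    using cf by (rule bounded_bilinear.continuous_on[OF bounded_bilinear_blinfun_compose])
  moreover have "torus_deriv (g \<circ> f) = (\<lambda>p. torus_deriv g (f p) o\<^sub>L torus_deriv f p)"
    by (rule ext, rule torus_deriv_eq, rule D)
  ultimately show ?thesis
    unfolding torus_C1_def using D by auto
qed

lemma Diff1_id: "id \<in> Diff1"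
  by (simp add: Diff1_def torus_C1_id)

lemma Diff1_comp: "f \<in> Diff1 \<Longrightarrow> g \<in> Diff1 \<Longrightarrow> g \<circ> f \<in> Diff1"
  by (simp add: Diff1_def torus_C1_comp bij_comp o_inv_distrib)

lemma Diff1_inv: "f \<in> Diff1 \<Longrightarrow> inv f \<in> Diff1"
  by (simp add: Diff1_def bij_imp_bij_inv inv_inv_eq)

section \<open>The \<open>C\<^sup>1\<close> topology\<close>

text \<open>
  Uniform convergence of maps and of their derivatives.  As the torus is compact, this is the
  topology of \<open>C\<^sup>1\<close> convergence in charts.
\<close>

definition C1_topology :: "('n::finite torus \<Rightarrow> 'n torus) topology" where
  "C1_topology = topology (\<lambda>U. U \<subseteq> Diff1 \<and>
     (\<forall>f\<in>U. \<exists>\<epsilon>>0. \<forall>g\<in>Diff1.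
        (\<forall>p. dist (g p) (f p) < \<epsilon> \<and> dist (torus_deriv g p) (torus_deriv f p) < \<epsilon>)
        \<longrightarrow> g \<in> U))"

lemma openin_C1_topology:
  "openin C1_topology U \<longleftrightarrow> U \<subseteq> Diff1 \<and>
     (\<forall>f\<in>U. \<exists>\<epsilon>>0. \<forall>g\<in>Diff1.
        (\<forall>p. dist (g p) (f p) < \<epsilon> \<and> dist (torus_deriv g p) (torus_deriv f p) < \<epsilon>)
        \<longrightarrow> g \<in> U)"
proof -
  let ?N = "\<lambda>\<epsilon> f g. \<forall>p. dist (g p) (f p) < \<epsilon> \<and> dist (torus_deriv g p) (torus_deriv f p) < \<epsilon>"
  let ?P = "\<lambda>U :: ('a torus \<Rightarrow> 'a torus) set.
     U \<subseteq> Diff1 \<and> (\<forall>f\<in>U. \<exists>\<epsilon>>0. \<forall>g\<in>Diff1. ?N \<epsilon> f g \<longrightarrow> g \<in> U)"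
  have "istopology ?P"
    unfolding istopology_def
  proof (intro conjI allI impI)
    fix S T assume S: "?P S" and T: "?P T"
    show "S \<inter> T \<subseteq> Diff1" using S by blast
    show "\<forall>f\<in>S \<inter> T. \<exists>\<epsilon>>0. \<forall>g\<in>Diff1. ?N \<epsilon> f g \<longrightarrow> g \<in> S \<inter> T"
    proof
      fix f assume f: "f \<in> S \<inter> T"
      obtain a where a: "a > 0" "\<forall>g\<in>Diff1. ?N a f g \<longrightarrow> g \<in> S" using S f by blast
      obtain b where b: "b > 0" "\<forall>g\<in>Diff1. ?N b f g \<longrightarrow> g \<in> T" using T f by blast
      show "\<exists>\<epsilon>>0. \<forall>g\<in>Diff1. ?N \<epsilon> f g \<longrightarrow> g \<in> S \<inter> T"
        using a b by (intro exI[of _ "min a b"]) simp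
    qed
  next
    fix K assume K: "\<forall>U\<in>K. ?P U"
    show "\<Union>K \<subseteq> Diff1" using K by blast
    show "\<forall>f\<in>\<Union>K. \<exists>\<epsilon>>0. \<forall>g\<in>Diff1. ?N \<epsilon> f g \<longrightarrow> g \<in> \<Union>K"
      using K by (meson UnionE UnionI)
  qed
  then show ?thesis
    unfolding C1_topology_def by (simp add: topology_inverse')
qed

lemma topspace_C1_topology: "topspace C1_topology = Diff1"
proof (rule antisym)
  show "topspace C1_topology \<subseteq> Diff1"
    using openin_topspace[of C1_topology] unfolding openin_C1_topology by blast
  have "openin C1_topology Diff1"
    unfolding openin_C1_topology using zero_less_one by blast
  then show "Diff1 \<subseteq> topspace C1_topology" by (rule openin_subset)
qed

section \<open>Centralizers\<close>

definition int_iterate :: "('a \<Rightarrow> 'a) \<Rightarrow> int \<Rightarrow> 'a \<Rightarrow> 'a" where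
  "int_iterate f k = (if k \<ge> 0 then f ^^ nat k else inv f ^^ nat (- k))"

definition centralizer :: "('n::finite torus \<Rightarrow> 'n torus) \<Rightarrow> ('n torus \<Rightarrow> 'n torus) set" where
  "centralizer f = {g \<in> Diff1. f \<circ> g = g \<circ> f}"

definition trivial_centralizer :: "('n::finite torus \<Rightarrow> 'n torus) set" where
  "trivial_centralizer = {f \<in> Diff1. centralizer f = range (int_iterate f)}"

end

theory Submission
  imports Defs
begin

text \<open>
  Take a hyperbolic unit \<open>\<alpha>\<close> in an order \<open>\<int>[\<alpha>]\<close> whose unit group has rank one (real quadratic, complex
  cubic, or totally complex quartic) and let \<open>A\<close> be multiplication by \<open>\<alpha>\<close> on \<open>\<int>[\<alpha>] = \<int>\<^sup>n\<close>.  Compose the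
  toral automorphism \<open>A\<close> with a small shear that fixes all fixed points of \<open>A\<close> but gives them derivatives
  with pairwise distinct traces; this persists in a \<open>C\<^sup>1\<close> neighbourhood.  Let \<open>f\<close> be in it, with lift \<open>F\<close>,
  and let \<open>g\<close> commute with \<open>f\<close>, with lift \<open>G\<close> acting on \<open>\<int>\<^sup>n\<close> as multiplication by a unit \<open>\<mu>\<close>.

  The coordinates of \<open>\<real>\<^sup>n\<close> along the unstable and stable spaces of \<open>A\<close> are complex-valued functionals \<open>lu\<close>,
  \<open>ls\<close> (evaluation at \<open>\<alpha>\<close> and at a conjugate \<open>\<beta>\<close>).  They are at bounded distance from functions \<open>Hu\<close>, \<open>Hs\<close>
  with \<open>Hu (F x) = \<alpha> * Hu x\<close> and \<open>Hs (F x) = \<beta> * Hs x\<close>, which separate points because \<open>F\<close> is expansive.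
  Uniqueness of solutions of such equations makes \<open>G\<close> affine in these coordinates.  As the traces force
  \<open>g\<close> to fix every fixed point of \<open>f\<close>, one gets \<open>\<mu> - 1 = (\<alpha> - 1) * q\<close> with \<open>q \<in> \<int>[\<alpha>]\<close>.  Composing \<open>g\<close>
  with a power of \<open>f\<close> brings the absolute value of \<open>\<mu>\<close> close to 1; then the norm of \<open>\<mu> - 1\<close> is smaller
  than that of \<open>\<alpha> - 1\<close>, so \<open>q = 0\<close>, \<open>\<mu> = 1\<close>, \<open>G\<close> is an integral translation, and \<open>g\<close> is the identity.
\<close>

section \<open>Semiconjugacies\<close>

text \<open>With \<open>q = inverse \<alpha>\<close>, the series \<open>R\<close> of defects of
  \<open>l\<close> along the orbit, weighted by \<open>q ^ Suc k\<close>, converges geometrically.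
  Shifting its index shows that \<open>l + R\<close> absorbs the defect.\<close>

lemma telescoping_semiconjugacy_exists:
  fixes F :: "'a \<Rightarrow> 'a" and l :: "'a \<Rightarrow> complex"
  assumes "norm \<alpha> > 1" and r: "\<And>x. norm (l (F x) - \<alpha> * l x) \<le> C"
  obtains H D where "\<And>x. H (F x) = \<alpha> * H x" "\<And>x. norm (H x - l x) \<le> D"
proof -
  define q where "q = inverse \<alpha>"
  have q: "norm q < 1" and "\<alpha> \<noteq> 0" 
    using assms(1) by (auto simp: q_def norm_inverse inverse_less_1_iff)
  then have q\<alpha>: "q * \<alpha> = 1" by (simp add: q_def)
  define r where "r x = l (F x) - \<alpha> * l x" for x
  define R where "R x = (\<Sum>k. q ^ Suc k * r ((F ^^ k) x))" for x
  have g: "summable (\<lambda>k. norm q ^ Suc k * C)"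
    using q by (intro summable_mult2 summable_Suc_iff[THEN iffD2] summable_geometric) auto
  have b: "norm (q ^ Suc k * r ((F ^^ k) x)) \<le> norm q ^ Suc k * C" for k x
    unfolding norm_mult norm_power using assms(2) by (intro mult_left_mono) (auto simp: r_def)
  have s: "summable (\<lambda>k. q ^ Suc k * r ((F ^^ k) x))" for x
    using g b by (rule summable_comparison_test')
  have "norm (R x) \<le> (\<Sum>k. norm q ^ Suc k * C)" for x
    unfolding R_def using b g by (rule norm_suminf_le)
  moreover have "l (F x) + R (F x) = \<alpha> * (l x + R x)" for x
  proof -
    have "q * R (F x) = (\<Sum>k. q ^ Suc (Suc k) * r ((F ^^ Suc k) x))"
      unfolding R_def using suminf_mult[OF s, of q "F x"]
      by (simp add: funpow_swap1 mult.assoc)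
    then have "R x = q * r x + q * R (F x)"
      unfolding R_def using suminf_split_head[OF s, of x] by simp
    then have "\<alpha> * R x = r x + R (F x)"
      using q\<alpha> by (simp add: algebra_simps) (metis (no_types) mult.assoc mult.commute mult_1)
    then show ?thesis by (simp add: r_def algebra_simps)
  qed
  ultimately show ?thesis
    by (intro that[of "\<lambda>x. l x + R x"]) auto
qed

text \<open>The uniqueness tool: a nonzero value would grow like the powers of
  \<open>norm \<alpha>\<close> along its forward orbit.\<close>

lemma bounded_scaling_solution_zero:
  fixes F :: "'a \<Rightarrow> 'a" and d :: "'a \<Rightarrow> complex"
  assumes "norm \<alpha> > 1" and d: "\<And>x. d (F x) = \<alpha> * d x" and b: "\<And>x. norm (d x) \<le> C"
  shows "d x = 0"
proof (rule ccontr)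
  assume nz: "d x \<noteq> 0"
  have it: "d ((F ^^ n) x) = \<alpha> ^ n * d x" for n
    by (induction n) (auto simp: d)
  obtain n where "C / norm (d x) < norm \<alpha> ^ n"
    using real_arch_pow[OF assms(1)] by blast
  then have "C < norm (d ((F ^^ n) x))"
    using nz by (simp add: it norm_mult norm_power field_simps)
  then show False using b[of "(F ^^ n) x"] by simp
qed

section \<open>Lifts of torus maps\<close>

definition integral_vec :: "real ^ 'n \<Rightarrow> bool" where
  "integral_vec x \<longleftrightarrow> (\<forall>i. x $ i \<in> \<int>)"

lemma torus_proj_eq_integral: "torus_proj x = torus_proj y \<longleftrightarrow> integral_vec (x - y)"
  by (simp add: torus_proj_eq_iff Z_equiv_def integral_vec_def)

lemma integral_vec_0 [simp]: "integral_vec 0"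
  and integral_vec_add [simp]: "integral_vec x \<Longrightarrow> integral_vec y \<Longrightarrow> integral_vec (x + y)"
  and integral_vec_diff [simp]: "integral_vec x \<Longrightarrow> integral_vec y \<Longrightarrow> integral_vec (x - y)"
  and integral_vec_minus_iff [simp]: "integral_vec (- x) \<longleftrightarrow> integral_vec x"
  and integral_vec_axis [simp]: "integral_vec (axis i 1)"
  by (auto simp: integral_vec_def axis_def minus_in_Ints_iff)

lemma torus_proj_add_integral: "integral_vec m \<Longrightarrow> torus_proj (x + m) = torus_proj x"
  by (simp add: torus_proj_eq_integral)

lemma torus_proj_rep [simp]: "torus_proj (torus_rep p) = p"
  by (metis Quotient3_abs_rep Quotient3_torus)

lemma integral_vec_norm_ge_1:
  assumes "integral_vec x" "x \<noteq> 0"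
  shows "norm x \<ge> 1"
  using torus_proj_eq_near[of x 0] assms by (force simp: torus_proj_eq_integral not_less[symmetric])

text \<open>Space is connected and lattice vectors are discrete. This is why two lifts of one map
  differ by a constant.\<close>

lemma integral_continuous_constant:
  fixes d :: "real ^ 'n::finite \<Rightarrow> real ^ 'n"
  assumes "continuous_on UNIV d" "\<And>x. integral_vec (d x)"
  shows "d x = d y"
proof -
  have *: "(\<lambda>x. d x $ i) constant_on UNIV" for i
  proof (rule continuous_discrete_range_constant[OF connected_UNIV])
    show "continuous_on UNIV (\<lambda>x. d x $ i)"
      using assms(1) by (intro continuous_intros)
    fix x :: "real ^ 'n"
    have "1 \<le> norm (d y $ i - d x $ i)" if "d y $ i \<noteq> d x $ i" for y
      using Ints_nonzero_abs_ge1[of "d y $ i - d x $ i"] assms(2) that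
      by (simp add: integral_vec_def)
    then show "\<exists>e>0. \<forall>y. y \<in> UNIV \<and> d y $ i \<noteq> d x $ i \<longrightarrow> e \<le> norm (d y $ i - d x $ i)"
      by (intro exI[of _ 1]) auto
  qed
  have "d x $ i = d y $ i" for i
    using *[of i] by (auto simp: constant_on_def)
  then show ?thesis by (simp add: vec_eq_iff)
qed

definition torus_lift :: "('n::finite torus \<Rightarrow> 'n torus) \<Rightarrow> (real ^ 'n \<Rightarrow> real ^ 'n) \<Rightarrow> bool" where
  "torus_lift g G \<longleftrightarrow> continuous_on UNIV G \<and> (\<forall>x. torus_proj (G x) = g (torus_proj x))"

lemma torus_liftD: "torus_lift g G \<Longrightarrow> torus_proj (G x) = g (torus_proj x)"
  by (simp add: torus_lift_def)

lemma torus_lift_compose: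
  assumes "torus_lift f F" "torus_lift g G"
  shows "torus_lift (g \<circ> f) (G \<circ> F)"
  using assms continuous_on_compose2[of UNIV G UNIV F] by (auto simp: torus_lift_def o_def)

lemma torus_lift_unique:
  assumes "torus_lift g G" "torus_lift g G'"
  obtains k where "integral_vec k" "\<And>x. G x = G' x + k"
proof (rule that[of "G 0 - G' 0"])
  have i: "integral_vec (G x - G' x)" for x
    using assms by (simp add: torus_lift_def flip: torus_proj_eq_integral)
  then show "integral_vec (G 0 - G' 0)" .
  have "continuous_on UNIV (\<lambda>x. G x - G' x)"
    using assms by (auto simp: torus_lift_def intro: continuous_intros)
  from integral_continuous_constant[OF this i]
  show "G x = G' x + (G 0 - G' 0)" for x
    by (metis add.commute diff_add_cancel)
qed

text \<open>\<open>torus_rep\<close> is a discontinuous choice of representative, but the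
  exponential kills its integer ambiguity, so continuity can be checked upstairs through the
  quotient topology.\<close>

lemma torus_exp_continuous:
  fixes i :: "'n::finite"
  shows "continuous_on UNIV (\<lambda>p :: 'n torus. exp (2 * pi * \<i> * complex_of_real (torus_rep p $ i)))"
    (is "continuous_on _ ?e")
proof -
  have e: "?e (torus_proj x) = exp (2 * pi * \<i> * complex_of_real (x $ i))" for x :: "real ^ 'n"
  proof -
    have "torus_rep (torus_proj x) $ i - x $ i \<in> \<int>"
      using torus_proj_eq_integral[of "torus_rep (torus_proj x)" x] by (simp add: integral_vec_def)
    then obtain k where k: "torus_rep (torus_proj x) $ i = x $ i + of_int k"
      by (auto elim!: Ints_cases simp: algebra_simps)
    show ?thesis
      unfolding k exp_eq by (intro exI[of _ k]) (simp add: algebra_simps)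
  qed
  have "continuous_on UNIV (\<lambda>x :: real ^ 'n. ?e (torus_proj x))"
    unfolding e by (intro continuous_intros)
  then have *: "open ((\<lambda>x. ?e (torus_proj x)) -` B)" if "open B" for B
    using that by (intro open_vimage)
  show ?thesis
    unfolding continuous_on_open_vimage[OF open_UNIV] open_torus_iff
    using * by (simp add: vimage_def)
qed

text \<open>Each coordinate of \<open>g\<close>, read as a circle-valued map on a contractible
  space, has a continuous logarithm; its imaginary part over \<open>2 * pi\<close> is a coordinate
  of the lift.\<close>

lemma torus_lift_exists:
  fixes g :: "'n::finite torus \<Rightarrow> 'n torus"
  assumes "continuous_on UNIV g"
  obtains G where "torus_lift g G"
proof -
  let ?e = "\<lambda>i (p :: 'n torus). exp (2 * pi * \<i> * complex_of_real (torus_rep p $ i))"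
  have "\<exists>h. continuous_on UNIV h \<and> (\<forall>x :: real ^ 'n. ?e i (g (torus_proj x)) = exp (h x))" for i
  proof -
    have "continuous_on UNIV (\<lambda>x. ?e i (g (torus_proj x)))"
      by (rule continuous_on_compose2[OF torus_exp_continuous
            continuous_on_compose2[OF assms continuous_on_torus_proj]]) auto
    from continuous_logarithm_on_contractible[OF this convex_imp_contractible[OF convex_UNIV]]
    show ?thesis by auto
  qed
  then obtain h :: "'n \<Rightarrow> real ^ 'n \<Rightarrow> complex" where h: "\<And>i. continuous_on UNIV (h i)"
      "\<And>i x. ?e i (g (torus_proj x)) = exp (h i x)" by metis
  define G :: "real ^ 'n \<Rightarrow> real ^ 'n" where "G x = (\<chi> i. Im (h i x) / (2 * pi))" for x
  have "torus_proj (G x) = g (torus_proj x)" for x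
  proof -
    have "(G x - torus_rep (g (torus_proj x))) $ i \<in> \<int>" for i
    proof -
      obtain n where "h i x = 2 * pi * \<i> * complex_of_real (torus_rep (g (torus_proj x)) $ i)
          + (of_int (2 * n) * pi) * \<i>"
        using h(2)[of x i] unfolding exp_eq by (metis add.commute exp_eq)
      then have "Im (h i x) = 2 * pi * (torus_rep (g (torus_proj x)) $ i + of_int n)"
        by (simp add: algebra_simps)
      then show ?thesis by (simp add: G_def)
    qed
    then have "torus_proj (G x) = torus_proj (torus_rep (g (torus_proj x)))"
      unfolding torus_proj_eq_integral integral_vec_def by blast
    then show ?thesis by simp
  qed
  moreover have "continuous_on UNIV G"
    unfolding G_def by (intro continuous_intros continuous_on_vec_lambda h(1)) auto
  ultimately show ?thesis using that by (auto simp: torus_lift_def)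
qed

text \<open>Translating the argument by \<open>m\<close> gives another lift of \<open>g\<close>, so
  the difference is a constant integral vector, which is evaluated at 0.\<close>

lemma torus_lift_add_integral:
  assumes "torus_lift g G" "integral_vec m"
  shows "G (x + m) = G x + (G m - G 0)" "integral_vec (G m - G 0)"
proof -
  have "torus_lift g (\<lambda>x. G (x + m))"
    using assms continuous_on_compose2[of UNIV G UNIV "\<lambda>x. x + m"]
    by (auto simp: torus_lift_def torus_proj_add_integral continuous_intros)
  then obtain k where k: "integral_vec k" "\<And>x. G (x + m) = G x + k"
    using torus_lift_unique assms(1) by blast
  from k(2)[of 0] have "k = G m - G 0" by simp
  with k show "G (x + m) = G x + (G m - G 0)" "integral_vec (G m - G 0)" by auto
qed

lemma periodic_continuous_bounded:
  fixes d :: "real ^ 'n::finite \<Rightarrow> 'b::real_normed_vector"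
  assumes "\<And>x m. integral_vec m \<Longrightarrow> d (x + m) = d x"
    and "continuous_on UNIV d"
  obtains C where "\<And>x. norm (d x) \<le> C"
proof -
  let ?Q = "cbox 0 (1 :: real ^ 'n)"
  have "compact (d ` ?Q)"
    by (intro compact_continuous_image continuous_on_subset[OF assms(2)]) auto
  then obtain C where C: "\<And>x. x \<in> ?Q \<Longrightarrow> norm (d x) \<le> C"
    using compact_imp_bounded bounded_iff by (metis imageI)
  have "norm (d x) \<le> C" for x
  proof -
    \<comment> \<open>Subtracting integer parts moves \<open>x\<close> into the unit cube, a compact
      fundamental domain.\<close>
    define m :: "real ^ 'n" where "m = (\<chi> i. - of_int \<lfloor>x $ i\<rfloor>)"
    have "integral_vec m" by (simp add: m_def integral_vec_def minus_in_Ints_iff)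
    moreover have "x + m \<in> ?Q"
      by (auto simp: m_def mem_box_cart algebra_simps one_vec_def) linarith+
    ultimately show ?thesis using C assms(1) by metis
  qed
  then show ?thesis using that by blast
qed

text \<open>The telescoping solution is equivariant because its equivariance defect is bounded and
  gets multiplied by \<gamma> when \<open>x\<close> moves by \<open>T\<close> and \<open>m\<close>
  by \<open>A\<close>.\<close>

lemma integral_equivariant_semiconjugacy:
  fixes l :: "real ^ 'n::finite \<Rightarrow> complex"
  assumes "norm \<gamma> > 1" "linear l"
    and lA: "\<And>x. l (A x) = \<gamma> * l x" and iA: "\<And>x. integral_vec x \<Longrightarrow> integral_vec (A x)"
    and T: "\<And>x m. integral_vec m \<Longrightarrow> T (x + m) = T x + A m"
    and b: "\<And>x. norm (l (T x) - \<gamma> * l x) \<le> C"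
  obtains H D where "\<And>x. H (T x) = \<gamma> * H x" "\<And>x. norm (H x - l x) \<le> D"
    "\<And>x m. integral_vec m \<Longrightarrow> H (x + m) = H x + l m"
proof -
  interpret l: linear l by fact
  obtain H D where H: "\<And>x. H (T x) = \<gamma> * H x" and D: "\<And>x. norm (H x - l x) \<le> D"
    using telescoping_semiconjugacy_exists[of \<gamma> l T C, OF assms(1) b] by blast
  have "H (x + m) = H x + l m" if m: "integral_vec m" for x m
  proof -
    \<comment> \<open>Off the lattice the defect is set to 0 and \<open>m\<close> stays put, so that
      the scaling law and the bound hold on all pairs.\<close>
    define d where "d = (\<lambda>(x, m). if integral_vec m then H (x + m) - H x - l m else 0)"
    have "d (x, m) = 0"
    proof (rule bounded_scaling_solution_zero[where F = "\<lambda>(x, m). (T x, if integral_vec m then A m else m)"])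
      show "norm \<gamma> > 1" by fact
      show "d (case y of (x, m) \<Rightarrow> (T x, if integral_vec m then A m else m)) = \<gamma> * d y" for y
        by (auto simp: d_def iA lA H right_diff_distrib split: prod.splits simp flip: T)
      show "norm (d y) \<le> 2 * D" for y
      proof (cases y)
        case (Pair x m)
        have "norm ((H (x + m) - l (x + m)) - (H x - l x)) \<le> D + D"
          by (rule order_trans[OF norm_triangle_ineq4 add_mono[OF D D]])
        moreover have "0 \<le> D" using order_trans[OF norm_ge_zero D] .
        ultimately show ?thesis by (simp add: Pair d_def l.add algebra_simps)
      qed
    qed
    then show ?thesis using m by (simp add: d_def algebra_simps)
  qed
  then show ?thesis by (rule that[OF H D])
qed

text \<open>\<open>G\<close> commutes with \<open>T\<close> up to the translation \<open>k\<close>,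
  so the bounded function \<open>H (G x) - \<mu> * H x\<close> scales by \<gamma> up to the constant
  \<open>l k\<close>, which forces it to be constant.\<close>

lemma commuting_lift_affine:
  fixes l :: "real ^ 'n::finite \<Rightarrow> complex"
  assumes "norm \<gamma> > 1" "linear l"
    and HT: "\<And>x. H (T x) = \<gamma> * H x" and D: "\<And>x. norm (H x - l x) \<le> D"
    and Hm: "\<And>x m. integral_vec m \<Longrightarrow> H (x + m) = H x + l m"
    and G: "continuous_on UNIV G" "\<And>x m. integral_vec m \<Longrightarrow> G (x + m) = G x + B m"
    and lB: "\<And>m. integral_vec m \<Longrightarrow> l (B m) = \<mu> * l m"
    and comm: "\<And>x. T (G x) = G (T x) + k" and k: "integral_vec k"
  obtains c where "\<And>x. H (G x) = \<mu> * H x + c"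
proof -
  interpret l: linear l by fact
  interpret bl: bounded_linear l using assms(2) by (rule linear_conv_bounded_linear[THEN iffD1])
  have "continuous_on UNIV (\<lambda>x. l (G x) - \<mu> * l x)"
    by (intro continuous_intros bl.continuous_on G)
  moreover have "l (G (x + m)) - \<mu> * l (x + m) = l (G x) - \<mu> * l x" if "integral_vec m" for x m
    using that by (simp add: G(2) l.add lB distrib_left)
  ultimately obtain E where E: "\<And>x. norm (l (G x) - \<mu> * l x) \<le> E"
    using periodic_continuous_bounded[of "\<lambda>x. l (G x) - \<mu> * l x"] by metis
  \<comment> \<open>The fixed point of the affine recursion; subtracting it makes the scaling
    equation homogeneous.\<close>
  define c where "c = l k / (\<gamma> - 1)"
  have \<gamma>1: "\<gamma> \<noteq> 1" using assms(1) by auto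
  then have c: "\<gamma> * c = l k + c" by (simp add: c_def field_simps)
  have "H (G x) - \<mu> * H x - c = 0" for x
  proof (rule bounded_scaling_solution_zero[where F = T and d = "\<lambda>x. H (G x) - \<mu> * H x - c"])
    show "norm \<gamma> > 1" by fact
    show "H (G (T x)) - \<mu> * H (T x) - c = \<gamma> * (H (G x) - \<mu> * H x - c)" for x
    proof -
      have "\<gamma> * H (G x) = H (G (T x)) + l k"
        using Hm[OF k, of "G (T x)"] by (simp add: comm flip: HT)
      then show ?thesis using c by (simp add: HT algebra_simps)
    qed
    show "norm (H (G x) - \<mu> * H x - c) \<le> D + norm \<mu> * D + E + norm c" for x
    proof -
      have "H (G x) - \<mu> * H x - c
          = (H (G x) - l (G x)) - \<mu> * (H x - l x) + (l (G x) - \<mu> * l x) - c"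
        by (simp add: algebra_simps)
      also have "norm \<dots> \<le> norm (H (G x) - l (G x)) + norm (\<mu> * (H x - l x))
          + norm (l (G x) - \<mu> * l x) + norm c"
        using norm_triangle_ineq4[of "H (G x) - l (G x) - \<mu> * (H x - l x) + (l (G x) - \<mu> * l x)" c]
          norm_triangle_ineq[of "H (G x) - l (G x) - \<mu> * (H x - l x)" "l (G x) - \<mu> * l x"]
          norm_triangle_ineq4[of "H (G x) - l (G x)" "\<mu> * (H x - l x)"] by linarith
      also have "\<dots> \<le> D + norm \<mu> * D + E + norm c"
        unfolding norm_mult by (intro add_mono mult_left_mono D E) auto
      finally show ?thesis .
    qed
  qed
  then have "H (G x) = \<mu> * H x + c" for x
    by (metis add.commute diff_diff_eq eq_iff_diff_eq_0)
  then show ?thesis by (rule that)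
qed

section \<open>Traces of derivatives as conjugacy invariants\<close>

definition blinfun_trace :: "(real ^ 'n) \<Rightarrow>\<^sub>L (real ^ 'n::finite) \<Rightarrow> real" where
  "blinfun_trace L = trace (matrix (blinfun_apply L))"

lemma blinfun_trace_commute:
  fixes L M :: "(real ^ 'n::finite) \<Rightarrow>\<^sub>L (real ^ 'n)"
  shows "blinfun_trace (L o\<^sub>L M) = blinfun_trace (M o\<^sub>L L)"
proof -
  have *: "linear (blinfun_apply X)" for X :: "(real ^ 'n) \<Rightarrow>\<^sub>L (real ^ 'n)"
    by (simp add: blinfun.bounded_linear_right bounded_linear.linear)
  show ?thesis
    unfolding blinfun_trace_def blinfun_compose.rep_eq
    using trace_mul_sym[of "matrix (blinfun_apply L)" "matrix (blinfun_apply M)"]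
    by (simp only: matrix_compose[OF *[of L] *[of M]] matrix_compose[OF *[of M] *[of L]])
qed

lemma blinfun_trace_alt: "blinfun_trace L = (\<Sum>i\<in>UNIV. L (axis i 1) $ i)"
  by (simp add: blinfun_trace_def trace_def matrix_def)

lemma torus_deriv_comp:
  assumes "torus_C1 f" "torus_C1 g"
  shows "torus_deriv (g \<circ> f) p = torus_deriv g (f p) o\<^sub>L torus_deriv f p"
  by (intro torus_deriv_eq has_torus_derivative_comp has_torus_derivative_torus_deriv assms)

text \<open>Differentiating \<open>f \<circ> g = g \<circ> f\<close> at the fixed point shows that
  the derivatives of \<open>f\<close> at \<open>p\<close> and at \<open>g p\<close> are conjugate by
  the derivative of \<open>g\<close>.\<close>

lemma torus_deriv_trace_conjugate:
  fixes f g :: "'n::finite torus \<Rightarrow> 'n torus"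
  assumes f: "torus_C1 f" and g: "g \<in> Diff1" and comm: "f \<circ> g = g \<circ> f" and "f p = p"
  shows "blinfun_trace (torus_deriv f (g p)) = blinfun_trace (torus_deriv f p)"
proof -
  have C1: "torus_C1 g" "torus_C1 (inv g)" and b: "bij g"
    using g by (auto simp: Diff1_def)
  define L where "L = torus_deriv g p"
  define L' where "L' = torus_deriv (inv g) (g p)"
  have i: "inv g \<circ> g = id" "g \<circ> inv g = id"
    using b by (simp_all add: bij_is_inj bij_is_surj surj_iff[symmetric])
  have L'L: "L' o\<^sub>L L = id_blinfun"
    using torus_deriv_comp[OF C1, of p] torus_deriv_eq[OF has_torus_derivative_id, of p]
    unfolding i L_def L'_def by simp
  have LL': "L o\<^sub>L L' = id_blinfun"
    using torus_deriv_comp[OF C1(2,1), of "g p"] torus_deriv_eq[OF has_torus_derivative_id, of "g p"]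
      bij_is_inj[OF b] unfolding i L_def L'_def by simp
  have fL: "torus_deriv f (g p) o\<^sub>L L = L o\<^sub>L torus_deriv f p"
    using torus_deriv_comp[OF C1(1) f, of p] torus_deriv_comp[OF f C1(1), of p] comm assms(4)
    unfolding L_def by simp
  have assoc: "(X o\<^sub>L Y) o\<^sub>L Z = X o\<^sub>L (Y o\<^sub>L Z)" and id: "X o\<^sub>L id_blinfun = X"
    for X Y Z :: "(real ^ 'n) \<Rightarrow>\<^sub>L (real ^ 'n)"
    by (auto intro: blinfun_eqI)
  have "torus_deriv f (g p) = L o\<^sub>L (torus_deriv f p o\<^sub>L L')"
    unfolding assoc[of L, symmetric] fL[symmetric] by (simp add: assoc LL' id)
  moreover have "(torus_deriv f p o\<^sub>L L') o\<^sub>L L = torus_deriv f p"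
    by (simp add: assoc L'L id)
  ultimately show ?thesis
    using blinfun_trace_commute[of L "torus_deriv f p o\<^sub>L L'"] by simp
qed

section \<open>Rank one toral automorphisms\<close>

text \<open>
  The hypothesis \<open>cyclic\<close> is the induction rule expressing that \<open>e\<close> generates the lattice as a module
  over \<open>\<int>[A]\<close>.  In \<open>norm_form_Ints\<close>, the exponents \<open>a\<close> and \<open>b\<close> are the numbers of conjugates of absolute
  value \<open>norm \<alpha>\<close> and \<open>norm \<beta>\<close>, so that the product is the absolute value of the field norm; \<open>gap\<close> says that
  \<open>\<mu> - 1\<close> has smaller norm than \<open>\<alpha> - 1\<close> for every unit \<open>\<mu>\<close> that is reduced modulo powers of \<open>\<alpha>\<close>.
\<close>

locale rank_one_automorphism =
  fixes A Ai :: "real ^ 'n::finite \<Rightarrow> real ^ 'n" and lu ls :: "real ^ 'n \<Rightarrow> complex"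
    and \<alpha> \<beta> :: complex and a b :: nat and e :: "real ^ 'n"
  assumes linear_A: "linear A" and linear_Ai: "linear Ai"
    and A_Ai [simp]: "A (Ai x) = x" and Ai_A [simp]: "Ai (A x) = x"
    and integral_A: "integral_vec x \<Longrightarrow> integral_vec (A x)"
    and integral_Ai: "integral_vec x \<Longrightarrow> integral_vec (Ai x)"
    and linear_lu: "linear lu" and linear_ls: "linear ls"
    and lu_A: "lu (A x) = \<alpha> * lu x" and ls_A: "ls (A x) = \<beta> * ls x"
    and lu_ls_inj: "lu x = 0 \<Longrightarrow> ls x = 0 \<Longrightarrow> x = 0"
    and norm_\<alpha>: "norm \<alpha> > 1" and norm_\<beta>: "norm \<beta> < 1"
    and integral_e: "integral_vec e" and lu_e: "lu e = 1" and ls_e: "ls e = 1"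
    and cyclic: "P e \<Longrightarrow>
      (\<And>x y. integral_vec x \<Longrightarrow> integral_vec y \<Longrightarrow> P x \<Longrightarrow> P y \<Longrightarrow> P (x - y)) \<Longrightarrow>
      (\<And>x. integral_vec x \<Longrightarrow> P x \<Longrightarrow> P (A x)) \<Longrightarrow> integral_vec x \<Longrightarrow> P x"
    and norm_form_Ints: "integral_vec x \<Longrightarrow> norm (lu x) ^ a * norm (ls x) ^ b \<in> \<int>"
    and gap: "0 < s \<Longrightarrow> 0 < t \<Longrightarrow> s ^ a * t ^ b = 1 \<Longrightarrow> s ^ 2 \<le> norm \<alpha> \<Longrightarrow> 1 \<le> s ^ 2 * norm \<alpha> \<Longrightarrow>
      (1 + s) ^ a * (1 + t) ^ b < norm (\<alpha> - 1) ^ a * norm (\<beta> - 1) ^ b"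
begin

sublocale A: linear A by (rule linear_A)
sublocale Ai: linear Ai by (rule linear_Ai)
sublocale lu: linear lu by (rule linear_lu)
sublocale ls: linear ls by (rule linear_ls)

lemma \<beta>_nonzero: "\<beta> \<noteq> 0"
  using ls_A[of "Ai e"] ls_e by auto

lemma lu_Ai: "lu (Ai x) = inverse \<alpha> * lu x" and ls_Ai: "ls (Ai x) = inverse \<beta> * ls x"
  using lu_A[of "Ai x"] ls_A[of "Ai x"] \<beta>_nonzero norm_\<alpha> by (auto simp: field_simps)

text \<open>The pair of \<open>lu\<close> and \<open>ls\<close> is an injective linear map on a
  finite-dimensional space, hence bounded below as well as above.\<close>

lemma norm_equivalence:
  obtains K where "K \<ge> 1" "\<And>x. norm x \<le> K * max (norm (lu x)) (norm (ls x))"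
    "\<And>x. norm (lu x) \<le> K * norm x" "\<And>x. norm (ls x) \<le> K * norm x"
proof -
  have "bounded_linear lu" "bounded_linear ls"
    using linear_lu linear_ls by (auto simp: linear_conv_bounded_linear)
  then obtain K1 K2 where K1: "\<And>x. norm (lu x) \<le> norm x * K1" and K2: "\<And>x. norm (ls x) \<le> norm x * K2"
    by (meson bounded_linear.bounded)
  have lin: "linear (\<lambda>x. (lu x, ls x))"
    by (rule linearI) (auto simp: lu.add ls.add lu.scale ls.scale)
  moreover have "inj (\<lambda>x. (lu x, ls x))"
    using linear_injective_0[OF lin] lu_ls_inj by (auto simp: zero_prod_def)
  ultimately obtain B where B: "B > 0" "\<And>x. B * norm x \<le> norm (lu x, ls x)"
    using linear_inj_bounded_below_pos by blast
  define K where "K = max 1 (max (max K1 K2) (2 / B))"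
  have "norm (lu x, ls x) \<le> 2 * max (norm (lu x)) (norm (ls x))" for x
    using norm_Pair_le[of "lu x" "ls x"] by linarith
  then have n: "norm x \<le> (2 / B) * max (norm (lu x)) (norm (ls x))" for x
    using B order_trans[OF B(2)[of x]] by (simp add: field_simps)
  show ?thesis
  proof (rule that[of K])
    show "K \<ge> 1" by (simp add: K_def)
    have "(2 / B) * max (norm (lu x)) (norm (ls x)) \<le> K * max (norm (lu x)) (norm (ls x))" for x
      by (intro mult_right_mono) (auto simp: K_def le_max_iff_disj)
    with n show "norm x \<le> K * max (norm (lu x)) (norm (ls x))" for x
      by (rule order_trans)
    fix x :: "real ^ 'n"
    have "norm x * K1 \<le> norm x * K" "norm x * K2 \<le> norm x * K"
      by (intro mult_left_mono; simp add: K_def)+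
    with K1[of x] K2[of x] show "norm (lu x) \<le> K * norm x" "norm (ls x) \<le> K * norm x"
      unfolding mult.commute[of K] by linarith+
  qed
qed

text \<open>An integral vector on the stable (unstable) space would contract to 0 under iteration,
  which is impossible as integral vectors are discrete.\<close>

lemma integral_lu_ls_nonzero:
  assumes x: "integral_vec x" "x \<noteq> 0"
  shows "lu x \<noteq> 0" "ls x \<noteq> 0"
proof -
  obtain K where K: "K \<ge> 1" "\<And>x. norm x \<le> K * max (norm (lu x)) (norm (ls x))"
    by (rule norm_equivalence) blast
  have ge: "1 \<le> K * max (norm (lu y)) (norm (ls y))" if "integral_vec y" "y \<noteq> 0" for y
    using integral_vec_norm_ge_1[OF that] K(2) by (rule order_trans)
  have small: "\<exists>n. c ^ n * d < 1 / K" if c: "0 \<le> c" "c < 1" for c d :: real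
  proof -
    have "(\<lambda>n. c ^ n * d) \<longlonglongrightarrow> 0"
      using LIMSEQ_power_zero[of c] c by (auto intro!: tendsto_mult_left_zero)
    from order_tendstoD(2)[OF this, of "1 / K"] K(1) show ?thesis
      by (auto simp: eventually_sequentially)
  qed
  have A0: "A y = 0 \<longleftrightarrow> y = 0" and Ai0: "Ai y = 0 \<longleftrightarrow> y = 0" for y
    using Ai_A[of y] A_Ai[of y] A.zero Ai.zero by fastforce+
  show "lu x \<noteq> 0"
  proof
    assume 0: "lu x = 0"
    have it: "integral_vec ((A ^^ n) x) \<and> (A ^^ n) x \<noteq> 0 \<and> lu ((A ^^ n) x) = 0
        \<and> ls ((A ^^ n) x) = \<beta> ^ n * ls x" for n
      by (induction n) (auto simp: x 0 integral_A A0 lu_A ls_A)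
    obtain n where "norm \<beta> ^ n * norm (ls x) < 1 / K"
      using small[OF norm_ge_zero norm_\<beta>] by blast
    then have "K * norm (\<beta> ^ n * ls x) < 1"
      using K(1) by (simp add: norm_mult norm_power field_simps)
    then show False using ge[of "(A ^^ n) x"] it[of n] by simp
  qed
  show "ls x \<noteq> 0"
  proof
    assume 0: "ls x = 0"
    have it: "integral_vec ((Ai ^^ n) x) \<and> (Ai ^^ n) x \<noteq> 0 \<and> ls ((Ai ^^ n) x) = 0
        \<and> lu ((Ai ^^ n) x) = inverse \<alpha> ^ n * lu x" for n
      by (induction n) (auto simp: x 0 integral_Ai Ai0 lu_Ai ls_Ai)
    have "norm (inverse \<alpha>) < 1" using norm_\<alpha> by (simp add: norm_inverse inverse_less_1_iff)
    then obtain n where "norm (inverse \<alpha>) ^ n * norm (lu x) < 1 / K"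
      using small[OF norm_ge_zero] by blast
    then have "K * norm (inverse \<alpha> ^ n * lu x) < 1"
      using K(1) unfolding norm_mult norm_power
      by (simp add: mult.commute pos_less_divide_eq)
    then show False using ge[of "(Ai ^^ n) x"] it[of n] by simp
  qed
qed

lemma norm_form_ge_1:
  assumes x: "integral_vec x" "x \<noteq> 0"
  shows "norm (lu x) ^ a * norm (ls x) ^ b \<ge> 1"
  using integral_lu_ls_nonzero[OF x] norm_form_Ints[OF x(1)]
    Ints_nonzero_abs_ge1[of "norm (lu x) ^ a * norm (ls x) ^ b"] by (auto simp: abs_mult)

text \<open>As \<open>e\<close> generates the lattice under \<open>A\<close>, an endomorphism
  commuting with \<open>A\<close> is determined by its value at \<open>e\<close> and acts as
  multiplication by the corresponding ring element.\<close>

lemma commuting_eigenvalue: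
  assumes add: "\<And>x y. integral_vec x \<Longrightarrow> integral_vec y \<Longrightarrow> B (x - y) = B x - B y"
    and comm: "\<And>x. integral_vec x \<Longrightarrow> B (A x) = A (B x)" and x: "integral_vec x"
  shows "lu (B x) = lu (B e) * lu x" "ls (B x) = ls (B e) * ls x"
proof -
  have "lu (B x) = lu (B e) * lu x \<and> ls (B x) = ls (B e) * ls x"
    by (rule cyclic[of "\<lambda>x. lu (B x) = lu (B e) * lu x \<and> ls (B x) = ls (B e) * ls x", OF _ _ _ x])
      (auto simp: lu_e ls_e add comm lu.diff ls.diff lu_A ls_A right_diff_distrib)
  then show "lu (B x) = lu (B e) * lu x" "ls (B x) = ls (B e) * ls x" by auto
qed

text \<open>A nonzero \<open>q\<close> has norm form at least 1, so by multiplicativity the norm of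
  \<mu> - 1, with \<mu> the ring element \<open>p\<close>, would be at least that of \<alpha> - 1.
  The triangle inequality and \<open>gap\<close> say that it is smaller.\<close>

lemma unit_congruent_1_trivial:
  assumes p: "integral_vec p" "norm (lu p) ^ a * norm (ls p) ^ b = 1"
    and q: "integral_vec q" "lu p - 1 = (\<alpha> - 1) * lu q" "ls p - 1 = (\<beta> - 1) * ls q"
    and s: "norm (lu p) ^ 2 \<le> norm \<alpha>" "1 \<le> norm (lu p) ^ 2 * norm \<alpha>"
  shows "q = 0"
proof (rule ccontr)
  assume "q \<noteq> 0"
  let ?s = "norm (lu p)" and ?t = "norm (ls p)"
  have "p \<noteq> 0" using s by auto
  then have pos: "?s > 0" "?t > 0" using integral_lu_ls_nonzero[OF p(1)] by auto
  have "norm (\<alpha> - 1) ^ a * norm (\<beta> - 1) ^ b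
      \<le> (norm (\<alpha> - 1) ^ a * norm (\<beta> - 1) ^ b) * (norm (lu q) ^ a * norm (ls q) ^ b)"
    using mult_left_mono[OF norm_form_ge_1[OF q(1) \<open>q \<noteq> 0\<close>], of "norm (\<alpha> - 1) ^ a * norm (\<beta> - 1) ^ b"]
    by simp
  also have "\<dots> = norm (lu p - 1) ^ a * norm (ls p - 1) ^ b"
    by (simp add: q norm_mult power_mult_distrib)
  also have "\<dots> \<le> (1 + ?s) ^ a * (1 + ?t) ^ b"
    by (intro mult_mono power_mono) (use norm_triangle_ineq4[of "lu p" 1] norm_triangle_ineq4[of "ls p" 1] in auto)
  also have "\<dots> < norm (\<alpha> - 1) ^ a * norm (\<beta> - 1) ^ b"
    using pos p(2) s by (rule gap)
  finally show False by simp
qed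

end

section \<open>Perturbations of rank one automorphisms\<close>

text \<open>The constant \<eta> bounds the Lipschitz constant of \<open>F - A\<close> in the maximum
  of the two coordinates and is small against the spectral gaps. Solutions of
  \<open>F x = x + k\<close> with integral \<open>k\<close> project to the fixed points of
  \<open>f\<close>, and the trace of the derivative tells these apart.\<close>

locale anosov_perturbation = rank_one_automorphism +
  fixes f :: "'a::finite torus \<Rightarrow> 'a torus" and F :: "real ^ 'a \<Rightarrow> real ^ 'a" and C \<eta> :: real
  assumes f_Diff1: "f \<in> Diff1" and lift_F: "torus_lift f F"
    and F_add: "integral_vec m \<Longrightarrow> F (x + m) = F x + A m"
    and F_bounded: "norm (F x - A x) \<le> C"
    and \<eta>_\<alpha>: "norm \<alpha> - \<eta> > 1" and \<eta>_\<beta>: "norm \<beta> + \<eta> < 1"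
    and lip_lu: "norm (lu (F x - F y - A (x - y))) \<le> \<eta> * max (norm (lu (x - y))) (norm (ls (x - y)))"
    and lip_ls: "norm (ls (F x - F y - A (x - y))) \<le> \<eta> * max (norm (lu (x - y))) (norm (ls (x - y)))"
    and fixed_exists: "integral_vec k \<Longrightarrow> \<exists>x. F x = x + k"
    and fixed_separated: "integral_vec k \<Longrightarrow> integral_vec l \<Longrightarrow> F x = x + k \<Longrightarrow> F y = y + l \<Longrightarrow>
      blinfun_trace (torus_deriv f (torus_proj x)) = blinfun_trace (torus_deriv f (torus_proj y)) \<Longrightarrow>
      integral_vec (x - y)"
begin

lemma bij_f: "bij f" and C1_f: "torus_C1 f"
  using f_Diff1 by (auto simp: Diff1_def)

text \<open>Bijectivity of \<open>f\<close> leaves only an integral ambiguity, on which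
  \<open>F\<close> acts through the invertible \<open>A\<close>.\<close>

lemma bij_F: "bij F"
proof (rule bijI)
  show "inj F"
  proof (rule injI)
    fix x y assume *: "F x = F y"
    then have "torus_proj x = torus_proj y"
      using bij_f torus_liftD[OF lift_F] by (metis bij_pointE)
    then have "integral_vec (x - y)" by (simp add: torus_proj_eq_integral)
    from F_add[OF this, of y] * have "A (x - y) = 0" by simp
    then show "x = y" by (metis A.zero Ai_A right_minus_eq)
  qed
  show "surj F"
    unfolding surj_def
  proof
    fix y
    obtain p where "f p = torus_proj y" using bij_f by (metis bij_pointE)
    moreover obtain x where "torus_proj x = p" using torus_proj_surj by blast
    ultimately have m: "integral_vec (y - F x)"
      using torus_liftD[OF lift_F, of x] by (simp flip: torus_proj_eq_integral)
    have "F (x + Ai (y - F x)) = y" using F_add[OF integral_Ai[OF m]] by simp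
    then show "\<exists>x. y = F x" by metis
  qed
qed

abbreviation "F' \<equiv> inv F"

lemma F_F' [simp]: "F (F' x) = x" and F'_F [simp]: "F' (F x) = x"
  using bij_F by (simp_all add: bij_is_inj bij_is_surj surj_f_inv_f)

lemma F'_add: "integral_vec m \<Longrightarrow> F' (x + m) = F' x + Ai m"
  using F_add[OF integral_Ai, of m "F' x"] by (metis A_Ai F'_F F_F')

text \<open>Continuity comes from comparison with some lift \<open>G\<close> of
  \<open>inv f\<close>: as \<open>G \<circ> F\<close> lifts the identity it is a translation, so
  \<open>G\<close> and \<open>F'\<close> differ by a constant.\<close>

lemma lift_F': "torus_lift (inv f) F'"
proof -
  have "continuous_on UNIV (inv f)"
    using f_Diff1 by (auto simp: Diff1_def torus_C1_imp_continuous_on)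
  then obtain G where G: "torus_lift (inv f) G" by (rule torus_lift_exists)
  have "torus_lift id (G \<circ> F)"
    using torus_lift_compose[OF lift_F G] bij_f by (simp add: bij_is_inj)
  moreover have "torus_lift id id" by (simp add: torus_lift_def)
  ultimately obtain k where k: "\<And>x. (G \<circ> F) x = id x + k"
    using torus_lift_unique by metis
  have "F' x = G x - k" for x
    using k[of "F' x"] by simp
  then have "continuous_on UNIV F'"
    using G by (auto simp: torus_lift_def continuous_intros)
  moreover have "torus_proj (F' x) = inv f (torus_proj x)" for x
    using torus_liftD[OF lift_F, of "F' x"] bij_f by (metis F_F' bij_inv_eq_iff)
  ultimately show ?thesis by (simp add: torus_lift_def)
qed

text \<open>A cone argument. Pairs with \<open>s \<le> u\<close> remain such under \<open>F\<close>
  while \<open>u\<close> grows by the factor \<rho>; the other pairs remain such under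
  \<open>F'\<close> while \<open>s\<close> grows by 1 / \<sigma>. Boundedness then leaves only the
  zero difference.\<close>

lemma expansive:
  assumes bu: "\<And>n. norm (lu ((F ^^ n) x - (F ^^ n) y)) \<le> D"
    and bs: "\<And>n. norm (ls ((F' ^^ n) x - (F' ^^ n) y)) \<le> D"
  shows "x = y"
proof -
  define u where "u x y = norm (lu (x - y))" for x y
  define s where "s x y = norm (ls (x - y))" for x y
  define \<rho> where "\<rho> = norm \<alpha> - \<eta>"
  define \<sigma> where "\<sigma> = norm \<beta> + \<eta>"
  have \<rho>: "\<rho> > 1" and \<sigma>: "\<sigma> < 1" using \<eta>_\<alpha> \<eta>_\<beta> by (simp_all add: \<rho>_def \<sigma>_def)
  have nn: "u x y \<ge> 0" "s x y \<ge> 0" for x y by (simp_all add: u_def s_def)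
  have U: "norm \<alpha> * u x y - \<eta> * max (u x y) (s x y) \<le> u (F x) (F y)" for x y
  proof -
    have "lu (F x - F y - A (x - y)) = lu (F x - F y) - \<alpha> * lu (x - y)"
      by (metis lu.diff lu_A)
    then have "norm (\<alpha> * lu (x - y)) - norm (lu (F x - F y)) \<le> norm (lu (F x - F y - A (x - y)))"
      by (metis norm_minus_commute norm_triangle_ineq2)
    then show ?thesis using lip_lu[of x y] by (simp add: u_def s_def norm_mult)
  qed
  have S: "s (F x) (F y) \<le> norm \<beta> * s x y + \<eta> * max (u x y) (s x y)" for x y
  proof -
    have "ls (F x - F y - A (x - y)) = ls (F x - F y) - \<beta> * ls (x - y)"
      by (metis ls.diff ls_A)
    then have "norm (ls (F x - F y)) - norm (\<beta> * ls (x - y)) \<le> norm (ls (F x - F y - A (x - y)))"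
      by (metis norm_triangle_ineq2)
    then show ?thesis using lip_ls[of x y] by (simp add: u_def s_def norm_mult)
  qed
  \<comment> \<open>In the unstable cone the maximum is \<open>u\<close>, and \<sigma> < 1 < \<rho>
    keeps \<open>s\<close> below \<open>u\<close>.\<close>
  have fwd: "s (F x) (F y) \<le> u (F x) (F y) \<and> \<rho> * u x y \<le> u (F x) (F y)" if "s x y \<le> u x y" for x y
  proof -
    have m: "max (u x y) (s x y) = u x y" using that by simp
    have 1: "\<rho> * u x y \<le> u (F x) (F y)" using U[of x y] by (simp add: m \<rho>_def algebra_simps)
    have "norm \<beta> * s x y \<le> norm \<beta> * u x y" using that by (intro mult_left_mono) auto
    then have "s (F x) (F y) \<le> \<sigma> * u x y" using S[of x y] by (simp add: m \<sigma>_def algebra_simps)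
    also have "\<dots> \<le> \<rho> * u x y" using \<rho> \<sigma> nn by (intro mult_right_mono) auto
    finally show ?thesis using 1 by simp
  qed
  \<comment> \<open>The contrapositive of \<open>fwd\<close> makes the complementary cone invariant
    under \<open>F'\<close>.\<close>
  have bwd: "u x y < s x y \<and> s (F x) (F y) \<le> \<sigma> * s x y" if "u (F x) (F y) < s (F x) (F y)" for x y
  proof -
    have "u x y < s x y" using fwd[of x y] that by linarith
    moreover then have "max (u x y) (s x y) = s x y" by simp
    ultimately show ?thesis using S[of x y] by (simp add: \<sigma>_def algebra_simps)
  qed
  have "u x y = 0 \<and> s x y = 0"
  proof (cases "s x y \<le> u x y")
    case True
    have it: "s ((F ^^ n) x) ((F ^^ n) y) \<le> u ((F ^^ n) x) ((F ^^ n) y)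
        \<and> \<rho> ^ n * u x y \<le> u ((F ^^ n) x) ((F ^^ n) y)" for n
    proof (induction n)
      case (Suc n)
      have "\<rho> * (\<rho> ^ n * u x y) \<le> \<rho> * u ((F ^^ n) x) ((F ^^ n) y)"
        using Suc \<rho> by (intro mult_left_mono) auto
      with fwd[OF conjunct1[OF Suc]] show ?case by simp
    qed (use True in simp)
    have "u x y = 0"
    proof (rule ccontr)
      assume "u x y \<noteq> 0"
      then have pos: "u x y > 0" using nn(1)[of x y] by simp
      obtain n where "D / u x y < \<rho> ^ n" using real_arch_pow[OF \<rho>] by blast
      then have "D < \<rho> ^ n * u x y" using pos by (simp add: field_simps)
      also have "\<dots> \<le> D" using it[of n] bu[of n] by (simp add: u_def)
      finally show False by simp
    qed
    with True show ?thesis using nn(2)[of x y] by simp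
  next
    case False
    then have gt: "u x y < s x y" by simp
    \<comment> \<open>Read off from 0 < \<open>s x y\<close> \<le>
      \<open>\<sigma> * s (F' x) (F' y)\<close>.\<close>
    have \<sigma>0: "\<sigma> \<ge> 0"
    proof -
      have "\<sigma> * s (F' x) (F' y) \<ge> s x y \<and> s (F' x) (F' y) > u (F' x) (F' y)"
        using bwd[of "F' x" "F' y"] gt by simp
      then show ?thesis using gt nn[of x y] nn[of "F' x" "F' y"]
        by (smt (verit) mult_nonneg_nonpos2 mult_minus_left)
    qed
    have it: "u ((F' ^^ n) x) ((F' ^^ n) y) < s ((F' ^^ n) x) ((F' ^^ n) y)
        \<and> s x y \<le> \<sigma> ^ n * s ((F' ^^ n) x) ((F' ^^ n) y)" for n
    proof (induction n)
      case (Suc n)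
      let ?x = "(F' ^^ n) x" and ?y = "(F' ^^ n) y"
      have *: "u (F' ?x) (F' ?y) < s (F' ?x) (F' ?y)" "s ?x ?y \<le> \<sigma> * s (F' ?x) (F' ?y)"
        using bwd[of "F' ?x" "F' ?y"] Suc by simp_all
      have "\<sigma> ^ n * s ?x ?y \<le> \<sigma> ^ n * (\<sigma> * s (F' ?x) (F' ?y))"
        using * \<sigma>0 by (intro mult_left_mono) auto
      with Suc * show ?case by (simp add: mult.assoc mult.left_commute)
    qed (use gt in simp)
    have "s x y \<le> \<sigma> ^ n * D" for n
    proof -
      have "\<sigma> ^ n * s ((F' ^^ n) x) ((F' ^^ n) y) \<le> \<sigma> ^ n * D"
        using bs[of n] \<sigma>0 by (intro mult_left_mono) (auto simp: s_def)
      then show ?thesis using it[of n] by simp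
    qed
    moreover have "(\<lambda>n. \<sigma> ^ n * D) \<longlonglongrightarrow> 0"
      using LIMSEQ_power_zero[of \<sigma>] \<sigma> \<sigma>0 by (auto intro!: tendsto_mult_left_zero)
    ultimately have "s x y \<le> 0"
      by (intro LIMSEQ_le_const[of "\<lambda>n. \<sigma> ^ n * D"]) auto
    with gt nn(1)[of x y] show ?thesis by simp
  qed
  then show ?thesis using lu_ls_inj[of "x - y"] by (simp add: u_def s_def)
qed

end

text \<open>On integral vectors this is the action on the fundamental group.\<close>

definition lift_action :: "(real ^ 'n \<Rightarrow> real ^ 'n) \<Rightarrow> real ^ 'n \<Rightarrow> real ^ 'n" where
  "lift_action G m = G m - G 0"

lemma lift_action_integral: "torus_lift g G \<Longrightarrow> integral_vec m \<Longrightarrow> integral_vec (lift_action G m)"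
  and lift_action_add: "torus_lift g G \<Longrightarrow> integral_vec m \<Longrightarrow> G (x + m) = G x + lift_action G m"
  unfolding lift_action_def by (rule torus_lift_add_integral; assumption)+

lemma lift_action_diff:
  assumes "torus_lift g G" "integral_vec x" "integral_vec y"
  shows "lift_action G (x - y) = lift_action G x - lift_action G y"
  using lift_action_add[OF assms(1) integral_vec_diff[OF assms(2,3)], of y]
  by (simp add: lift_action_def)

lemma lift_action_comp:
  assumes "torus_lift f F" "torus_lift g G" "integral_vec m"
  shows "lift_action (G \<circ> F) m = lift_action G (lift_action F m)"
  using lift_action_add[OF assms(2) lift_action_integral[OF assms(1,3)], of "F 0"]
  by (simp add: lift_action_def)

lemma lift_action_unique:
  assumes "torus_lift g G" "torus_lift g G'"
  shows "lift_action G m = lift_action G' m"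
proof -
  obtain k where "\<And>x. G x = G' x + k" using torus_lift_unique[OF assms] by blast
  then show ?thesis by (simp add: lift_action_def)
qed

lemma lift_action_id: "torus_lift id G \<Longrightarrow> lift_action G m = m"
  using lift_action_unique[of id G id m] by (simp add: torus_lift_def lift_action_def)

lemma Diff1_funpow: "h \<in> Diff1 \<Longrightarrow> h ^^ i \<in> Diff1"
proof (induction i)
  case 0
  then show ?case using Diff1_id by (simp add: id_def)
next
  case (Suc i)
  from Diff1_comp[OF Suc.IH[OF Suc.prems] Suc.prems] show ?case by (simp only: funpow.simps)
qed

lemma comp_funpow_commute:
  assumes "f \<circ> h = h \<circ> f"
  shows "f \<circ> h ^^ i = h ^^ i \<circ> f"
proof (induction i)
  case (Suc i)
  have "f \<circ> h ^^ Suc i = (f \<circ> h) \<circ> h ^^ i" by (simp only: funpow.simps comp_assoc)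
  also have "\<dots> = h \<circ> (f \<circ> h ^^ i)" by (simp only: assms comp_assoc)
  also have "\<dots> = h ^^ Suc i \<circ> f" by (simp only: Suc funpow.simps comp_assoc)
  finally show ?case .
qed simp

section \<open>Linearising coordinates and maps commuting with \<open>f\<close>\<close>

context anosov_perturbation
begin

lemma lift_action_F: "integral_vec m \<Longrightarrow> lift_action F m = A m"
  using F_add[of m 0] by (simp add: lift_action_def)

lemma lift_action_F': "integral_vec m \<Longrightarrow> lift_action F' m = Ai m"
  using F'_add[of m 0] by (simp add: lift_action_def)

text \<open>Both compositions of \<open>F\<close> and \<open>G\<close> lift the same map, and the
  action on the lattice does not depend on the lift.\<close>

lemma lift_action_commute:
  assumes "f \<circ> g = g \<circ> f" "torus_lift g G" "integral_vec m"
  shows "lift_action G (A m) = A (lift_action G m)"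
proof -
  have "lift_action (G \<circ> F) m = lift_action (F \<circ> G) m"
    using lift_action_unique torus_lift_compose[OF lift_F assms(2)]
      torus_lift_compose[OF assms(2) lift_F] assms(1) by metis
  then show ?thesis
    using assms(2,3) by (simp add: lift_action_comp[OF lift_F] lift_action_comp[OF _ lift_F]
        lift_action_F lift_action_integral)
qed

text \<open>The stable coordinate is handled through \<open>F'\<close>, for which
  \<open>inverse \<beta>\<close> is expanding. Joint injectivity is expansivity: equal
  \<open>Hu\<close> keeps the unstable coordinates of the forward orbits close, equal
  \<open>Hs\<close> the stable ones of the backward orbits.\<close>

lemma semiconjugacies:
  obtains Hu Hs D where
    "\<And>x. Hu (F x) = \<alpha> * Hu x" "\<And>x. norm (Hu x - lu x) \<le> D"
    "\<And>x m. integral_vec m \<Longrightarrow> Hu (x + m) = Hu x + lu m"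
    "\<And>x. Hs (F' x) = inverse \<beta> * Hs x" "\<And>x. norm (Hs x - ls x) \<le> D"
    "\<And>x m. integral_vec m \<Longrightarrow> Hs (x + m) = Hs x + ls m"
    "\<And>x y. Hu x = Hu y \<Longrightarrow> Hs x = Hs y \<Longrightarrow> x = y"
proof -
  obtain K where K: "K \<ge> 1" "\<And>x. norm (lu x) \<le> K * norm x" "\<And>x. norm (ls x) \<le> K * norm x"
    by (rule norm_equivalence) blast
  have KC: "K * norm (F x - A x) \<le> K * C" for x
    using K(1) F_bounded by (intro mult_left_mono) auto
  have bu: "norm (lu (F x) - \<alpha> * lu x) \<le> K * C" for x
    using order_trans[OF K(2) KC[of x]] by (simp add: lu.diff lu_A)
  have "norm (ls (F' x) - inverse \<beta> * ls x) \<le> norm (inverse \<beta>) * (K * C)" for x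
  proof -
    \<comment> \<open>The defect for \<open>F'\<close> at \<open>x\<close> is a multiple of the
      defect for \<open>F\<close> at \<open>F' x\<close>.\<close>
    have "ls (F' x) - inverse \<beta> * ls x = - inverse \<beta> * ls (F (F' x) - A (F' x))"
      using \<beta>_nonzero by (simp add: ls.diff ls_A field_simps)
    then have "norm (ls (F' x) - inverse \<beta> * ls x) = norm (inverse \<beta>) * norm (ls (F (F' x) - A (F' x)))"
      by (simp add: norm_mult)
    also have "\<dots> \<le> norm (inverse \<beta>) * (K * C)"
      using order_trans[OF K(3) KC[of "F' x"]] by (intro mult_left_mono) auto
    finally show ?thesis .
  qed
  note bs = this
  have i\<beta>: "norm (inverse \<beta>) > 1"
    using norm_\<beta> \<beta>_nonzero by (simp add: norm_inverse one_less_inverse_iff)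
  obtain Hu Du where Hu: "\<And>x. Hu (F x) = \<alpha> * Hu x" "\<And>x. norm (Hu x - lu x) \<le> Du"
      "\<And>x m. integral_vec m \<Longrightarrow> Hu (x + m) = Hu x + lu m"
    using integral_equivariant_semiconjugacy[of \<alpha> lu A F "K * C", OF norm_\<alpha> linear_lu lu_A
        integral_A F_add bu] by blast
  obtain Hs Ds where Hs: "\<And>x. Hs (F' x) = inverse \<beta> * Hs x" "\<And>x. norm (Hs x - ls x) \<le> Ds"
      "\<And>x m. integral_vec m \<Longrightarrow> Hs (x + m) = Hs x + ls m"
    using integral_equivariant_semiconjugacy[of "inverse \<beta>" ls Ai F' "norm (inverse \<beta>) * (K * C)",
        OF i\<beta> linear_ls ls_Ai integral_Ai F'_add bs] by blast
  define D where "D = max Du Ds"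
  have D: "norm (Hu x - lu x) \<le> D" "norm (Hs x - ls x) \<le> D" for x
    using Hu(2)[of x] Hs(2)[of x] by (auto simp: D_def)
  have inj: "x = y" if eq: "Hu x = Hu y" "Hs x = Hs y" for x y
  proof (rule expansive)
    fix n
    have "Hu ((F ^^ n) z) = \<alpha> ^ n * Hu z" for z
      by (induction n) (auto simp: Hu(1))
    then have "lu ((F ^^ n) x - (F ^^ n) y)
        = (Hu ((F ^^ n) y) - lu ((F ^^ n) y)) - (Hu ((F ^^ n) x) - lu ((F ^^ n) x))"
      using eq by (simp add: lu.diff)
    also have "norm \<dots> \<le> D + D"
      by (rule order_trans[OF norm_triangle_ineq4 add_mono[OF D(1) D(1)]])
    finally show "norm (lu ((F ^^ n) x - (F ^^ n) y)) \<le> D + D" .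
    have "Hs ((F' ^^ n) z) = inverse \<beta> ^ n * Hs z" for z
      by (induction n) (auto simp: Hs(1))
    then have "ls ((F' ^^ n) x - (F' ^^ n) y)
        = (Hs ((F' ^^ n) y) - ls ((F' ^^ n) y)) - (Hs ((F' ^^ n) x) - ls ((F' ^^ n) x))"
      using eq by (simp add: ls.diff)
    also have "norm \<dots> \<le> D + D"
      by (rule order_trans[OF norm_triangle_ineq4 add_mono[OF D(2) D(2)]])
    finally show "norm (ls ((F' ^^ n) x - (F' ^^ n) y)) \<le> D + D" .
  qed
  show ?thesis by (rule that[OF Hu(1) D(1) Hu(3) Hs(1) D(2) Hs(3) inj])
qed

text \<open>\<open>g\<close> sends a fixed point of \<open>f\<close> to a fixed point with the same
  trace of the derivative, and these traces separate fixed points.\<close>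

lemma commuting_lift_fixes_fixed_points:
  assumes g: "g \<in> Diff1" "f \<circ> g = g \<circ> f" "torus_lift g G"
    and x: "F x = x + k" "integral_vec k"
  obtains m where "integral_vec m" "G x = x + m"
proof -
  let ?p = "torus_proj x"
  have fp: "f ?p = ?p"
    using torus_liftD[OF lift_F, of x] x by (simp add: torus_proj_add_integral)
  have "f (g ?p) = g ?p" using g(2) fp by (metis comp_apply)
  then have "torus_proj (F (G x)) = torus_proj (G x)"
    by (simp add: torus_liftD[OF lift_F] torus_liftD[OF g(3)])
  then have i: "integral_vec (F (G x) - G x)" by (simp add: torus_proj_eq_integral)
  have "integral_vec (G x - x)"
    by (rule fixed_separated[OF i x(2) _ x(1)])
      (auto simp: torus_liftD[OF g(3)] torus_deriv_trace_conjugate[OF C1_f g(1,2) fp])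
  then show ?thesis by (rule that) simp
qed

text \<open>The eigenvalues of the action of \<open>inv g\<close> are inverse to those of
  \<open>g\<close>, so the two norm forms, each at least 1, have product 1.\<close>

lemma unit_norm_form:
  assumes g: "g \<in> Diff1" "f \<circ> g = g \<circ> f" "torus_lift g G"
  shows "norm (lu (lift_action G e)) ^ a * norm (ls (lift_action G e)) ^ b = 1"
proof -
  have bg: "bij g" using g(1) by (auto simp: Diff1_def)
  have g': "inv g \<in> Diff1" using g(1) by (rule Diff1_inv)
  have comm: "f \<circ> inv g = inv g \<circ> f"
  proof
    fix p
    have "f (inv g p) = inv g (g (f (inv g p)))" using bg by (simp add: bij_is_inj)
    also have "g (f (inv g p)) = f (g (inv g p))" using g(2) by (metis comp_apply)
    also have "\<dots> = f p" using bg by (simp add: bij_is_surj surj_f_inv_f)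
    finally show "(f \<circ> inv g) p = (inv g \<circ> f) p" by simp
  qed
  obtain G' where G': "torus_lift (inv g) G'"
    using torus_lift_exists torus_C1_imp_continuous_on g' by (metis (no_types, lifting) Diff1_def mem_Collect_eq)
  let ?B = "lift_action G" and ?B' = "lift_action G'"
  have i: "integral_vec (?B e)" "integral_vec (?B' e)"
    using lift_action_integral g(3) G' integral_e by blast+
  have "torus_lift id (G' \<circ> G)"
    using torus_lift_compose[OF g(3) G'] bg by (simp add: bij_is_inj)
  then have id: "?B' (?B e) = e"
    using lift_action_comp[OF g(3) G' integral_e] lift_action_id by metis
  have "lu (?B' e) * lu (?B e) = 1 \<and> ls (?B' e) * ls (?B e) = 1"
    using commuting_eigenvalue[OF lift_action_diff[OF G'] lift_action_commute[OF comm G'] i(1)]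
    by (simp add: id lu_e ls_e)
  then have prod1: "norm (lu (?B' e)) * norm (lu (?B e)) = 1" "norm (ls (?B' e)) * norm (ls (?B e)) = 1"
    by (simp_all flip: norm_mult)
  let ?N = "\<lambda>x. norm (lu x) ^ a * norm (ls x) ^ b"
  have "?N (?B' e) * ?N (?B e)
      = (norm (lu (?B' e)) * norm (lu (?B e))) ^ a * (norm (ls (?B' e)) * norm (ls (?B e))) ^ b"
    by (simp add: power_mult_distrib)
  then have N: "?N (?B' e) * ?N (?B e) = 1" by (simp add: prod1)
  have nz: "?B e \<noteq> 0" "?B' e \<noteq> 0" using prod1 by auto
  have "?N (?B e) \<ge> 1" "?N (?B' e) \<ge> 1"
    using norm_form_ge_1 i nz by blast+
  moreover have "?N (?B e) \<le> ?N (?B' e) * ?N (?B e)"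
    using mult_right_mono[OF \<open>?N (?B' e) \<ge> 1\<close>, of "?N (?B e)"] by simp
  ultimately show ?thesis using N by simp
qed

text \<open>The lift is affine in the coordinates \<open>Hu\<close> and \<open>Hs\<close>. Two fixed
  points of \<open>f\<close> fix its constants and exhibit \<mu> - 1 as a lattice multiple of
  \<alpha> - 1, which forces \<mu> = 1 by the norm estimate.\<close>

lemma commuting_small_eigenvalue_id:
  assumes g: "g \<in> Diff1" "f \<circ> g = g \<circ> f" "torus_lift g G"
    and s: "norm (lu (lift_action G e)) ^ 2 \<le> norm \<alpha>" "1 \<le> norm (lu (lift_action G e)) ^ 2 * norm \<alpha>"
  shows "g = id"
proof -
  let ?B = "lift_action G"
  define \<mu>u where "\<mu>u = lu (?B e)"
  define \<mu>s where "\<mu>s = ls (?B e)"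
  have lB: "lu (?B m) = \<mu>u * lu m" "ls (?B m) = \<mu>s * ls m" if "integral_vec m" for m
    using commuting_eigenvalue[OF lift_action_diff[OF g(3)] lift_action_commute[OF g(2,3)] that]
    by (auto simp: \<mu>u_def \<mu>s_def)
  have contG: "continuous_on UNIV G" using g(3) by (simp add: torus_lift_def)
  have Gadd: "G (x + m) = G x + ?B m" if "integral_vec m" for x m
    by (rule lift_action_add[OF g(3) that])
  obtain k where k: "integral_vec k" "\<And>x. F (G x) = G (F x) + k"
    using torus_lift_unique[OF torus_lift_compose[OF g(3) lift_F]] torus_lift_compose[OF lift_F g(3)] g(2)
    by (metis comp_apply)
  have k': "F' (G x) = G (F' x) + - Ai k" for x
  proof -
    have "F' (G x + k) = G (F' x)" using k(2)[of "F' x"] by (metis F'_F F_F')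
    then show ?thesis by (simp add: F'_add[OF k(1)] eq_diff_eq)
  qed
  obtain Hu Hs D where
    Hu: "\<And>x. Hu (F x) = \<alpha> * Hu x" "\<And>x. norm (Hu x - lu x) \<le> D"
      "\<And>x m. integral_vec m \<Longrightarrow> Hu (x + m) = Hu x + lu m"
    and Hs: "\<And>x. Hs (F' x) = inverse \<beta> * Hs x" "\<And>x. norm (Hs x - ls x) \<le> D"
      "\<And>x m. integral_vec m \<Longrightarrow> Hs (x + m) = Hs x + ls m"
    and inj: "\<And>x y. Hu x = Hu y \<Longrightarrow> Hs x = Hs y \<Longrightarrow> x = y"
    by (rule semiconjugacies) blast
  obtain cu where cu: "\<And>x. Hu (G x) = \<mu>u * Hu x + cu"
    using commuting_lift_affine[of \<alpha> lu Hu F D G ?B \<mu>u k, OF norm_\<alpha> linear_lu Hu contG Gadd lB(1) k(2,1)] by blast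
  have "integral_vec (- Ai k)" using integral_Ai[OF k(1)] by simp
  moreover have "norm (inverse \<beta>) > 1"
    using norm_\<beta> \<beta>_nonzero by (simp add: norm_inverse one_less_inverse_iff)
  ultimately obtain cs where cs: "\<And>x. Hs (G x) = \<mu>s * Hs x + cs"
    using commuting_lift_affine[of "inverse \<beta>" ls Hs F' D G ?B \<mu>s "- Ai k", OF _ linear_ls Hs contG Gadd lB(2) k'] by blast
  have HsF: "Hs (F x) = \<beta> * Hs x" for x
    using Hs(1)[of "F x"] \<beta>_nonzero by (simp add: field_simps)
  have ne1: "\<alpha> \<noteq> 1" "\<beta> \<noteq> 1" using norm_\<alpha> norm_\<beta> by auto
  \<comment> \<open>At a fixed point of the lift itself both coordinates vanish, so its displacement
    \<open>m0\<close> under \<open>G\<close> gives the constants \<open>cu\<close> and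
    \<open>cs\<close>.\<close>
  obtain x0 where x0: "F x0 = x0 + 0" using fixed_exists[OF integral_vec_0] by blast
  obtain m0 where m0: "integral_vec m0" "G x0 = x0 + m0"
    using commuting_lift_fixes_fixed_points[OF g x0 integral_vec_0] by blast
  have "Hu x0 = 0" "Hs x0 = 0"
    using Hu(1)[of x0] HsF[of x0] x0 ne1 by auto
  then have c: "cu = lu m0" "cs = ls m0"
    using cu[of x0] cs[of x0] Hu(3)[OF m0(1), of x0] Hs(3)[OF m0(1), of x0] m0 by simp_all
  \<comment> \<open>Since \<open>e\<close> has both coordinates equal to 1, the coordinates of
    \<open>x1\<close> are the inverses of \<alpha> - 1 and \<beta> - 1.\<close>
  obtain x1 where x1: "F x1 = x1 + e" using fixed_exists[OF integral_e] by blast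
  obtain m1 where m1: "integral_vec m1" "G x1 = x1 + m1"
    using commuting_lift_fixes_fixed_points[OF g x1 integral_e] by blast
  have H1: "(\<alpha> - 1) * Hu x1 = 1" "(\<beta> - 1) * Hs x1 = 1"
    using Hu(1)[of x1] HsF[of x1] Hu(3)[OF integral_e, of x1] Hs(3)[OF integral_e, of x1]
    by (simp_all add: x1 lu_e ls_e algebra_simps)
  define q where "q = m1 - m0"
  have "(\<mu>u - 1) * Hu x1 = lu q" "(\<mu>s - 1) * Hs x1 = ls q"
    using cu[of x1] cs[of x1] Hu(3)[OF m1(1), of x1] Hs(3)[OF m1(1), of x1] m1
    by (simp_all add: q_def lu.diff ls.diff c algebra_simps)
  then have "(\<mu>u - 1) * ((\<alpha> - 1) * Hu x1) = (\<alpha> - 1) * lu q"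
    "(\<mu>s - 1) * ((\<beta> - 1) * Hs x1) = (\<beta> - 1) * ls q"
    by (metis mult.left_commute)+
  then have q: "\<mu>u - 1 = (\<alpha> - 1) * lu q" "\<mu>s - 1 = (\<beta> - 1) * ls q"
    by (simp_all add: H1)
  have "q = 0"
    using unit_congruent_1_trivial[OF lift_action_integral[OF g(3) integral_e] unit_norm_form[OF g]
        _ q[unfolded \<mu>u_def \<mu>s_def] s] m0(1) m1(1) by (simp add: q_def)
  with q have \<mu>: "\<mu>u = 1" "\<mu>s = 1" by (simp_all add: lu.zero ls.zero)
  have "G x = x + m0" for x
    by (rule inj) (simp_all add: cu cs \<mu> c Hu(3)[OF m0(1)] Hs(3)[OF m0(1)])
  then have "g (torus_proj x) = torus_proj x" for x
    using torus_liftD[OF g(3), of x] torus_proj_add_integral[OF m0(1), of x] by simp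
  then show ?thesis
    by (metis eq_id_iff torus_proj_surj)
qed

lemma lift_action_funpow:
  assumes "torus_lift h H'" "\<And>m. integral_vec m \<Longrightarrow> lu (lift_action H' m) = c * lu m"
  shows "torus_lift (h ^^ j) (H' ^^ j) \<and>
    (integral_vec m \<longrightarrow> lu (lift_action (H' ^^ j) m) = c ^ j * lu m)"
proof (induction j)
  case 0
  show ?case by (simp add: torus_lift_def lift_action_def)
next
  case (Suc j)
  then have l: "torus_lift (h ^^ j) (H' ^^ j)" by blast
  have "torus_lift (h ^^ Suc j) (H' ^^ Suc j)"
    using torus_lift_compose[OF l assms(1)] by simp
  moreover have "lu (lift_action (H' ^^ Suc j) m) = c ^ Suc j * lu m" if m: "integral_vec m"
    using lift_action_comp[OF l assms(1) m] assms(2)[OF lift_action_integral[OF l m]] Suc m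
    by simp
  ultimately show ?case by blast
qed

lemma commuting_imp_iterate:
  assumes g: "g \<in> Diff1" "f \<circ> g = g \<circ> f"
  shows "g \<in> range (int_iterate f)"
proof -
  obtain G where G: "torus_lift g G"
    using torus_lift_exists torus_C1_imp_continuous_on g(1)
    by (metis (no_types, lifting) Diff1_def mem_Collect_eq)
  let ?\<mu> = "lu (lift_action G e)"
  define L where "L = ln (norm \<alpha>)"
  have L: "L > 0" using ln_gt_zero[OF norm_\<alpha>] by (simp add: L_def)
  \<comment> \<open>If it vanished, so would the image of \<open>e\<close>;
    \<open>unit_norm_form\<close> would then leave only \<open>a = b = 0\<close>, where
    \<open>gap\<close> at s = t = 1 reads 1 < 1.\<close>
  have "?\<mu> \<noteq> 0"
  proof
    assume 0: "?\<mu> = 0"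
    then have "lift_action G e = 0"
      using integral_lu_ls_nonzero(1)[OF lift_action_integral[OF G integral_e]] by blast
    then show False using unit_norm_form[OF g G] 0 gap[of 1 1] norm_\<alpha> by (auto simp: ls.zero power_0_left split: if_splits)
  qed
  \<comment> \<open>The nearest integer: multiplying by the \<open>j\<close>-th power of \<alpha>
    brings the logarithm of the absolute value of the eigenvalue to within \<open>L / 2\<close> of
    0.\<close>
  define j where "j = round (- ln (norm ?\<mu>) / L)"
  define r where "r = ln (norm ?\<mu>) + of_int j * L"
  have "\<bar>of_int j + ln (norm ?\<mu>) / L\<bar> \<le> 1 / 2"
    using of_int_round_abs_le[of "- ln (norm ?\<mu>) / L"] by (simp add: j_def)
  then have "\<bar>of_int j + ln (norm ?\<mu>) / L\<bar> * L \<le> 1 / 2 * L"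
    using L by (intro mult_right_mono) auto
  moreover have "\<bar>of_int j + ln (norm ?\<mu>) / L\<bar> * L = \<bar>(of_int j + ln (norm ?\<mu>) / L) * L\<bar>"
    using L by (simp add: abs_mult)
  moreover have "(of_int j + ln (norm ?\<mu>) / L) * L = r"
    using L by (simp add: r_def field_simps)
  ultimately have r: "\<bar>r\<bar> \<le> L / 2" by simp
  \<comment> \<open>Used with \<open>h = f\<close> and \<open>c = \<alpha>\<close> if
    \<open>j \<ge> 0\<close>, and with their inverses otherwise; \<open>i\<close> is the absolute
    value of \<open>j\<close>.\<close>
  have key: "h ^^ i \<circ> g = id"
    if h: "h \<in> Diff1" "f \<circ> h = h \<circ> f" "torus_lift h H'"
      and c: "\<And>m. integral_vec m \<Longrightarrow> lu (lift_action H' m) = c * lu m" "ln (norm c) * of_nat i = of_int j * L"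
        "c \<noteq> 0" for h H' c i
  proof -
    have hi: "h ^^ i \<in> Diff1" using h(1) by (rule Diff1_funpow)
    have hf: "f \<circ> h ^^ i = h ^^ i \<circ> f"
      using h(2) by (rule comp_funpow_commute)
    note Hi = lift_action_funpow[OF h(3) c(1)]
    have lift: "torus_lift (h ^^ i \<circ> g) ((H' ^^ i) \<circ> G)"
      using Hi by (intro torus_lift_compose[OF G]) blast
    have val: "lu (lift_action ((H' ^^ i) \<circ> G) e) = c ^ i * ?\<mu>"
      using lift_action_comp[OF G _ integral_e] Hi lift_action_integral[OF G integral_e] by metis
    have "ln (norm (c ^ i * ?\<mu>)) = r"
      using c(2,3) \<open>?\<mu> \<noteq> 0\<close>
      by (simp add: norm_mult norm_power ln_mult ln_realpow r_def mult.commute)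
    then have nr: "norm (c ^ i * ?\<mu>) = exp r"
      using c(3) \<open>?\<mu> \<noteq> 0\<close> by (metis exp_ln mult_eq_0_iff power_not_zero zero_less_norm_iff)
    have "norm \<alpha> > 0" using norm_\<alpha> by linarith
    then have na: "norm \<alpha> = exp L" by (simp add: L_def)
    show ?thesis
    proof (rule commuting_small_eigenvalue_id[OF _ _ lift])
      show "h ^^ i \<circ> g \<in> Diff1" using Diff1_comp[OF g(1) hi] .
      show "f \<circ> (h ^^ i \<circ> g) = h ^^ i \<circ> g \<circ> f"
        by (metis comp_assoc g(2) hf)
      show "norm (lu (lift_action ((H' ^^ i) \<circ> G) e)) ^ 2 \<le> norm \<alpha>"
        "1 \<le> norm (lu (lift_action ((H' ^^ i) \<circ> G) e)) ^ 2 * norm \<alpha>"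
        unfolding val nr na using r by (simp_all flip: exp_of_nat_mult exp_add)
    qed
  qed
  show ?thesis
  proof (cases "j \<ge> 0")
    case True
    have "f ^^ nat j \<circ> g = id"
      by (rule key[OF f_Diff1 refl lift_F, of \<alpha>])
        (use True norm_\<alpha> in \<open>auto simp: lift_action_F lu_A L_def mult.commute\<close>)
    moreover have "bij (f ^^ nat j)" by (simp add: bij_f bij_fn)
    ultimately have "g = inv (f ^^ nat j)"
      by (metis bij_is_inj comp_id fun.map_comp inv_o_cancel id_comp)
    also have "\<dots> = inv f ^^ nat j" using bij_f by (rule inv_fn)
    finally have "g = int_iterate f (- j)"
      using True by (auto simp: int_iterate_def)
    then show ?thesis by blast
  next
    case False
    have fi: "f \<circ> inv f = inv f \<circ> f"
      using bij_f by (metis bij_is_inj bij_is_surj inv_o_cancel surj_iff)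
    have "inv f ^^ nat (- j) \<circ> g = id"
    proof (rule key[OF Diff1_inv[OF f_Diff1] fi lift_F', of "inverse \<alpha>"])
      show "ln (norm (inverse \<alpha>)) * of_nat (nat (- j)) = of_int j * L"
        using False norm_\<alpha> by (simp add: L_def norm_inverse ln_inverse)
    qed (use norm_\<alpha> in \<open>auto simp: lift_action_F' lu_Ai\<close>)
    then have "inv (f ^^ nat (- j)) \<circ> g = id" by (simp add: inv_fn[OF bij_f])
    moreover have "bij (f ^^ nat (- j))" by (simp add: bij_f bij_fn)
    ultimately have "g = f ^^ nat (- j)"
      by (metis bij_is_surj comp_assoc comp_id id_comp surj_iff)
    then have "g = int_iterate f (- j)"
      using False by (auto simp: int_iterate_def)
    then show ?thesis by blast
  qed
qed

lemma int_iterate_in_centralizer: "int_iterate f k \<in> centralizer f"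
proof -
  have *: "h ^^ n \<in> centralizer f" if h: "h \<in> Diff1" "f \<circ> h = h \<circ> f" for h n
    unfolding centralizer_def using Diff1_funpow[OF h(1)] comp_funpow_commute[OF h(2)] by blast
  have "f \<circ> inv f = inv f \<circ> f"
    using bij_f by (metis bij_is_inj bij_is_surj inv_o_cancel surj_iff)
  then show ?thesis
    using *[OF f_Diff1] *[OF Diff1_inv[OF f_Diff1]] by (simp add: int_iterate_def)
qed

theorem f_trivial_centralizer: "f \<in> trivial_centralizer"
  using f_Diff1 int_iterate_in_centralizer commuting_imp_iterate
  by (auto simp: trivial_centralizer_def centralizer_def)

end

section \<open>Separating fixed points by a shear\<close>

lemma real_lipschitz_of_deriv:
  fixes h h' :: "real \<Rightarrow> real"
  assumes "\<And>t. (h has_real_derivative h' t) (at t)" "\<And>t. \<bar>h' t\<bar> \<le> M"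
  shows "\<bar>h s - h t\<bar> \<le> M * \<bar>s - t\<bar>"
  using field_differentiable_bound[of UNIV h h' M s t] assms by auto

text \<open>The phase \<open>\<pi> / (2 * N)\<close> makes the values \<open>cos (2 * \<pi> * j / N + \<pi> / (2 * N))\<close>, \<open>j < N\<close>, distinct.\<close>

lemma separating_function_exists:
  fixes N :: nat
  assumes N: "N > 0"
  obtains \<theta> \<theta>' :: "real \<Rightarrow> real" and M M' \<gamma> :: real where
    "\<And>t. (\<theta> has_real_derivative \<theta>' t) (at t)" "continuous_on UNIV \<theta>'"
    "\<And>t k. k \<in> \<int> \<Longrightarrow> \<theta> (t + k) = \<theta> t"
    "\<And>t. \<bar>\<theta> t\<bar> \<le> 1" "M > 0" "\<And>t. \<bar>\<theta>' t\<bar> \<le> M" "M' > 0" "\<And>s t. \<bar>\<theta>' s - \<theta>' t\<bar> \<le> M' * \<bar>s - t\<bar>"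
    "\<And>t. real N * t \<in> \<int> \<Longrightarrow> \<theta> t = 0"
    "\<gamma> > 0" "\<And>s t. real N * s \<in> \<int> \<Longrightarrow> real N * t \<in> \<int> \<Longrightarrow> s - t \<notin> \<int> \<Longrightarrow> \<bar>\<theta>' s - \<theta>' t\<bar> \<ge> \<gamma>"
proof -
  define \<phi> where "\<phi> = pi / (2 * N)"
  \<comment> \<open>The sine vanishes at the multiples of 1 / N, so the derivative there is
    \<open>2 * pi * N\<close> times the cosine factor.\<close>
  define \<theta> where "\<theta> t = sin (2 * pi * N * t) * cos (2 * pi * t + \<phi>)" for t :: real
  define \<theta>' where "\<theta>' t = 2 * pi * N * cos (2 * pi * N * t) * cos (2 * pi * t + \<phi>)
      - 2 * pi * sin (2 * pi * N * t) * sin (2 * pi * t + \<phi>)" for t :: real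
  define \<theta>'' where "\<theta>'' t = - (2 * pi * N)\<^sup>2 * sin (2 * pi * N * t) * cos (2 * pi * t + \<phi>)
      - 2 * (2 * pi) * (2 * pi * N) * cos (2 * pi * N * t) * sin (2 * pi * t + \<phi>)
      - (2 * pi)\<^sup>2 * sin (2 * pi * N * t) * cos (2 * pi * t + \<phi>)" for t :: real
  have d1: "(\<theta> has_real_derivative \<theta>' t) (at t)" for t
    unfolding \<theta>_def \<theta>'_def by (auto intro!: derivative_eq_intros)
  have d2: "(\<theta>' has_real_derivative \<theta>'' t) (at t)" for t
    unfolding \<theta>'_def \<theta>''_def
    by (auto intro!: derivative_eq_intros simp: power2_eq_square algebra_simps)
  have prod1: "\<bar>x * y\<bar> \<le> 1" if "\<bar>x\<bar> \<le> 1" "\<bar>y\<bar> \<le> 1" for x y :: real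
    using that by (simp add: abs_mult mult_le_one)
  have sc: "\<bar>c * x * y\<bar> \<le> c" if "\<bar>x\<bar> \<le> 1" "\<bar>y\<bar> \<le> 1" "c \<ge> 0" for c x y :: real
    using mult_left_mono[OF prod1[OF that(1,2)] that(3)] that(3) by (simp add: abs_mult mult.assoc)
  define M where "M = 2 * pi * N + 2 * pi"
  define M' where "M' = (2 * pi * N)\<^sup>2 + 2 * (2 * pi) * (2 * pi * N) + (2 * pi)\<^sup>2"
  have M: "\<bar>\<theta>' t\<bar> \<le> M" for t
    unfolding \<theta>'_def M_def
    by (rule order_trans[OF abs_triangle_ineq4]) (intro add_mono sc; simp)
  have M': "\<bar>\<theta>'' t\<bar> \<le> M'" for t
  proof -
    let ?a = "(2 * pi * N)\<^sup>2 * sin (2 * pi * N * t) * cos (2 * pi * t + \<phi>)"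
      and ?b = "2 * (2 * pi) * (2 * pi * N) * cos (2 * pi * N * t) * sin (2 * pi * t + \<phi>)"
      and ?c = "(2 * pi)\<^sup>2 * sin (2 * pi * N * t) * cos (2 * pi * t + \<phi>)"
    have "\<bar>?a\<bar> \<le> (2 * pi * N)\<^sup>2" "\<bar>?b\<bar> \<le> 2 * (2 * pi) * (2 * pi * N)" "\<bar>?c\<bar> \<le> (2 * pi)\<^sup>2"
      by (intro sc; simp)+
    moreover have "\<theta>'' t = - ?a - ?b - ?c" by (simp add: \<theta>''_def)
    ultimately show ?thesis unfolding M'_def by linarith
  qed
  have per1: "sin (x + 2 * pi * k) = sin x" "cos (x + 2 * pi * k) = cos x" if "k \<in> \<int>" for x k :: real
    using that by (auto elim!: Ints_cases simp: sin_add cos_add sin_int_2pin cos_int_2pin)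
  have per: "\<theta> (t + k) = \<theta> t" "\<theta>' (t + k) = \<theta>' t" if k: "k \<in> \<int>" for t k
  proof -
    have Nk: "real N * k \<in> \<int>" using k by simp
    have *: "2 * pi * N * (t + k) = 2 * pi * N * t + 2 * pi * (N * k)"
      "2 * pi * (t + k) + \<phi> = (2 * pi * t + \<phi>) + 2 * pi * k"
      by (simp_all add: algebra_simps)
    show "\<theta> (t + k) = \<theta> t" "\<theta>' (t + k) = \<theta>' t"
      unfolding \<theta>_def \<theta>'_def * per1[OF k] per1[OF Nk] by simp_all
  qed
  have at0: "\<theta> t = 0" "\<theta>' t = 2 * pi * N * cos (2 * pi * t + \<phi>)" if t: "real N * t \<in> \<int>" for t
    using per1[OF t, of 0] by (simp_all add: \<theta>_def \<theta>'_def mult.assoc)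
  have sep: "\<theta>' s \<noteq> \<theta>' t" if s: "real N * s \<in> \<int>" and t: "real N * t \<in> \<int>" and st: "s - t \<notin> \<int>" for s t
  proof
    assume "\<theta>' s = \<theta>' t"
    then have "cos (2 * pi * s + \<phi>) = cos (2 * pi * t + \<phi>)"
      using N by (simp add: at0[OF s] at0[OF t])
    then obtain n where n: "n \<in> \<int>" and
      "2 * pi * s + \<phi> = 2 * pi * t + \<phi> + 2 * n * pi \<or> 2 * pi * s + \<phi> = - (2 * pi * t + \<phi>) + 2 * n * pi"
      unfolding cos_eq by (metis mult.commute mult.left_commute)
    then show False
    proof (elim disjE)
      assume "2 * pi * s + \<phi> = 2 * pi * t + \<phi> + 2 * n * pi"
      then have "2 * pi * (s - t) = 2 * pi * n" by (simp add: algebra_simps)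
      then have "s - t = n" using pi_neq_zero by simp
      with n st show False by simp
    next
      \<comment> \<open>In this reflected case the two phases add up to 1 / (2 * N) after division
        by \<open>2 * pi\<close>; multiplying by \<open>N\<close> would make 1 / 2 an
        integer.\<close>
      assume "2 * pi * s + \<phi> = - (2 * pi * t + \<phi>) + 2 * n * pi"
      then have "2 * pi * (s + t + 1 / (2 * N)) = 2 * pi * n" by (simp add: \<phi>_def algebra_simps)
      then have "s + t + 1 / (2 * N) = n" using pi_neq_zero by simp
      then have "1 / 2 = real N * n - real N * s - real N * t" using N by (auto simp: field_simps)
      moreover have "real N * n - real N * s - real N * t \<in> \<int>" using n s t by simp
      ultimately have "(1 / 2 :: real) \<in> \<int>" by metis
      then show False using Ints_nonzero_abs_less1[of "1 / 2 :: real"] by simp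
    qed
  qed
  \<comment> \<open>By periodicity \<theta>' takes only finitely many values at multiples of 1 / N,
    so distinct values have a positive minimal distance.\<close>
  define V where "V = (\<lambda>j. \<theta>' (real j / N)) ` {..<N}"
  have V: "\<theta>' t \<in> V" if t: "real N * t \<in> \<int>" for t
  proof -
    obtain k where k: "real N * t = of_int k" using t by (auto elim: Ints_cases)
    have "real_of_int k = of_int (int N * (k div int N) + k mod int N)" by simp
    also have "\<dots> = real N * of_int (k div int N) + of_int (k mod int N)"
      by (simp only: of_int_add of_int_mult of_int_of_nat_eq)
    finally have "t = real_of_int (k mod int N) / N + of_int (k div int N)"
      using k N by (simp add: field_simps)
    then have "\<theta>' t = \<theta>' (real (nat (k mod int N)) / N)"
      using N by (simp add: per)
    moreover have "nat (k mod int N) < N" using N by (simp add: nat_less_iff)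
    ultimately show ?thesis unfolding V_def by blast
  qed
  \<comment> \<open>For N = 1 there are no nonzero differences; the element 1 keeps the minimum
    defined.\<close>
  define S where "S = insert 1 ((\<lambda>(v, w). \<bar>v - w\<bar>) ` (V \<times> V) - {0})"
  have S: "finite S" "S \<noteq> {}" by (simp_all add: S_def V_def)
  define \<gamma> where "\<gamma> = Min S"
  have "\<gamma> > 0" unfolding \<gamma>_def using S by (subst Min_gr_iff) (auto simp: S_def)
  moreover have "\<bar>\<theta>' s - \<theta>' t\<bar> \<ge> \<gamma>" if "real N * s \<in> \<int>" "real N * t \<in> \<int>" "s - t \<notin> \<int>" for s t
    unfolding \<gamma>_def using S(1) sep[OF that] V[OF that(1)] V[OF that(2)]
    by (intro Min_le) (auto simp: S_def)
  moreover have "continuous_on UNIV \<theta>'"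
    using d2 by (meson DERIV_continuous_on has_field_derivative_at_within)
  moreover have "M > 0" "M' > 0"
    using N by (auto simp: M_def M'_def intro!: add_pos_pos add_nonneg_pos)
  moreover have "\<bar>\<theta> t\<bar> \<le> 1" for t unfolding \<theta>_def by (rule prod1) simp_all
  ultimately show ?thesis
    using d1 per(1) M real_lipschitz_of_deriv[OF d2 M'] at0(1) by (intro that[of \<theta> \<theta>' M M' \<gamma>])
qed

section \<open>Lifts of nearby maps and balls in the C1 topology\<close>

lemma torus_C1_of_lift:
  assumes D: "\<And>x. (F has_derivative blinfun_apply (D x)) (at x)" "continuous_on UNIV D"
    and F: "\<And>x. torus_proj (F x) = f (torus_proj x)"
  shows "torus_C1 f" "torus_deriv f (torus_proj x) = D x"
proof -
  have h: "has_torus_derivative f (D x) (torus_proj x)" for x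
    unfolding has_torus_derivative_def using D(1)[of x] F by (intro exI[of _ x] exI[of _ F]) auto
  then show eq: "torus_deriv f (torus_proj x) = D x" for x
    by (rule torus_deriv_eq)
  have "open (torus_proj -` (torus_deriv f -` B))" if "open B" for B
    using open_vimage[OF that D(2)] by (simp add: vimage_def eq)
  then have "continuous_on UNIV (torus_deriv f)"
    unfolding continuous_on_open_vimage[OF open_UNIV] by (simp add: open_torus_iff)
  moreover have "\<exists>A. has_torus_derivative f A p" for p
    using h torus_proj_surj[of p] by metis
  ultimately show "torus_C1 f" by (simp add: torus_C1_def)
qed

text \<open>Above each point take the value of \<open>f\<close> within \<epsilon> of
  \<open>F0\<close>. Lattice points are at least 1 apart, so \<epsilon> \<le> 1 / 2 makes this
  choice unique; equivariance and differentiability follow by comparison with other admissible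
  values.\<close>

lemma lift_near:
  fixes f :: "'n::finite torus \<Rightarrow> 'n torus"
  assumes f: "torus_C1 f" and f0: "torus_lift f0 F0"
    and near: "\<And>p. dist (f p) (f0 p) < \<epsilon>" and \<epsilon>: "\<epsilon> \<le> 1 / 2"
  obtains F where "torus_lift f F" "\<And>x. norm (F x - F0 x) < \<epsilon>"
    "\<And>x m. integral_vec m \<Longrightarrow> F (x + m) = F x + lift_action F0 m"
    "\<And>x. (F has_derivative blinfun_apply (torus_deriv f (torus_proj x))) (at x)"
proof -
  have "\<exists>y. torus_proj y = f (torus_proj x) \<and> norm (y - F0 x) < \<epsilon>" for x
    using dist_torus_attained[OF torus_liftD[OF f0, of x], of "f (torus_proj x)"] near[of "torus_proj x"]
    by (metis dist_commute dist_norm)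
  then obtain F where F: "\<And>x. torus_proj (F x) = f (torus_proj x)" "\<And>x. norm (F x - F0 x) < \<epsilon>"
    by metis
  have unique: "y = F x" if "torus_proj y = f (torus_proj x)" "norm (y - F0 x) < 1 / 2" for x y
  proof (rule torus_proj_eq_near)
    have "norm ((y - F0 x) - (F x - F0 x)) < 1 / 2 + 1 / 2"
      by (rule le_less_trans[OF norm_triangle_ineq4 add_less_le_mono]) (use F(2)[of x] \<epsilon> that in auto)
    then show "dist y (F x) < 1" by (simp add: dist_norm)
  qed (simp add: F that)
  have add: "F (x + m) = F x + lift_action F0 m" if m: "integral_vec m" for x m
    using F(2)[of x] \<epsilon>
    by (intro unique[symmetric]) (auto simp: torus_proj_add_integral m F(1)
        lift_action_integral[OF f0 m] lift_action_add[OF f0 m])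
  have der: "(F has_derivative blinfun_apply (torus_deriv f (torus_proj x))) (at x)" for x
  proof -
    obtain G where G: "\<forall>\<^sub>F y in nhds x. torus_proj (G y) = f (torus_proj y)"
      and dG: "(G has_derivative blinfun_apply (torus_deriv f (torus_proj x))) (at x)"
      using has_torus_derivative_at_lift[OF has_torus_derivative_torus_deriv[OF f] refl] by blast
    \<comment> \<open>A local lift with the right derivative, shifted by \<open>k\<close>, stays
      close to \<open>F0\<close> near \<open>x\<close> and therefore agrees with \<open>F\<close>
      there.\<close>
    define k where "k = F x - G x"
    have k: "integral_vec k"
      using eventually_nhds_x_imp_x[OF G] F(1)[of x] by (simp add: k_def flip: torus_proj_eq_integral)
    have "isCont F0 x"
      using f0 by (simp add: torus_lift_def continuous_on_eq_continuous_at)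
    then have "isCont (\<lambda>y. norm (G y + k - F0 y)) x"
      using has_derivative_continuous[OF dG] by (intro continuous_intros)
    then have "((\<lambda>y. norm (G y + k - F0 y)) \<longlongrightarrow> norm (F x - F0 x)) (nhds x)"
      by (simp add: isCont_def tendsto_nhds_iff k_def)
    moreover have "norm (F x - F0 x) < 1 / 2" using F(2)[of x] \<epsilon> by simp
    ultimately have "\<forall>\<^sub>F y in nhds x. norm (G y + k - F0 y) < 1 / 2"
      by (rule order_tendstoD(2))
    then have ev: "\<forall>\<^sub>F y in nhds x. G y + k = F y"
      using G by eventually_elim (simp add: unique torus_proj_add_integral[OF k])
    have "((\<lambda>y. G y + k) has_derivative blinfun_apply (torus_deriv f (torus_proj x))) (at x)"
      using dG by (auto intro!: derivative_eq_intros)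
    then show ?thesis
      by (rule has_derivative_transform_eventually)
        (use ev in \<open>auto simp: k_def eventually_at_filter elim: eventually_mono\<close>)
  qed
  have "continuous_on UNIV F"
    using der has_derivative_continuous by (blast intro: continuous_at_imp_continuous_on)
  then show ?thesis using F add der by (intro that[of F]) (auto simp: torus_lift_def)
qed

text \<open>The bound \<delta> < \<epsilon> leaves a margin uniform in \<open>p\<close>, which turns
  openness into a triangle inequality.\<close>

definition C1_ball :: "('n::finite torus \<Rightarrow> 'n torus) \<Rightarrow> real \<Rightarrow> ('n torus \<Rightarrow> 'n torus) set" where
  "C1_ball f \<epsilon> = {g \<in> Diff1. \<exists>\<delta><\<epsilon>. \<forall>p. dist (g p) (f p) \<le> \<delta> \<and> dist (torus_deriv g p) (torus_deriv f p) \<le> \<delta>}"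

lemma openin_C1_ball: "openin C1_topology (C1_ball f \<epsilon>)"
  unfolding openin_C1_topology
proof (intro conjI ballI)
  fix g assume "g \<in> C1_ball f \<epsilon>"
  then obtain \<delta> where \<delta>: "\<delta> < \<epsilon>"
      "\<And>p. dist (g p) (f p) \<le> \<delta>" "\<And>p. dist (torus_deriv g p) (torus_deriv f p) \<le> \<delta>"
    by (auto simp: C1_ball_def)
  let ?e = "(\<epsilon> - \<delta>) / 2"
  have "h \<in> C1_ball f \<epsilon>" if h: "h \<in> Diff1"
      "\<And>p. dist (h p) (g p) < ?e" "\<And>p. dist (torus_deriv h p) (torus_deriv g p) < ?e" for h
  proof -
    have "dist (h p) (f p) \<le> ?e + \<delta>" "dist (torus_deriv h p) (torus_deriv f p) \<le> ?e + \<delta>" for p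
      using dist_triangle[of "h p" "f p" "g p"] \<delta>(2)[of p] h(2)[of p]
        dist_triangle[of "torus_deriv h p" "torus_deriv f p" "torus_deriv g p"] \<delta>(3)[of p] h(3)[of p]
      by linarith+
    moreover have "?e + \<delta> < \<epsilon>" using \<delta>(1) by (simp add: field_simps)
    ultimately show ?thesis using h(1) unfolding C1_ball_def by blast
  qed
  moreover have "?e > 0" using \<delta>(1) by simp
  ultimately show "\<exists>e>0. \<forall>h\<in>Diff1. (\<forall>p. dist (h p) (g p) < e \<and>
      dist (torus_deriv h p) (torus_deriv g p) < e) \<longrightarrow> h \<in> C1_ball f \<epsilon>"
    by blast
qed (auto simp: C1_ball_def)

lemma C1_ball_centre: "f \<in> Diff1 \<Longrightarrow> \<epsilon> > 0 \<Longrightarrow> f \<in> C1_ball f \<epsilon>"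
  by (auto simp: C1_ball_def intro: exI[of _ 0])

section \<open>Shears of linear maps and the trace of their derivatives\<close>

lemma has_derivative_shear:
  fixes L :: "real ^ 'n::finite \<Rightarrow> real ^ 'n" and c :: "real ^ 'n \<Rightarrow> real"
  assumes L: "bounded_linear L" and c: "bounded_linear c"
    and \<theta>: "\<And>t. (\<theta> has_real_derivative \<theta>' t) (at t)" and cont: "continuous_on UNIV \<theta>'"
  obtains D where "\<And>x. ((\<lambda>x. L x + \<theta> (c x) *\<^sub>R v) has_derivative blinfun_apply (D x)) (at x)"
    "continuous_on UNIV D"
    "\<And>x h. blinfun_apply (D x) h = L h + (\<theta>' (c x) * c h) *\<^sub>R v"
proof -
  define D where "D x = Blinfun L + \<theta>' (c x) *\<^sub>R Blinfun (\<lambda>h. c h *\<^sub>R v)" for x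
  have bl: "bounded_linear (\<lambda>h. c h *\<^sub>R v)"
    using bounded_linear_compose[OF bounded_linear_scaleR_left c] .
  have D: "blinfun_apply (D x) h = L h + (\<theta>' (c x) * c h) *\<^sub>R v" for x h
    by (simp add: D_def blinfun.add_left blinfun.scaleR_left bounded_linear_Blinfun_apply[OF L]
        bounded_linear_Blinfun_apply[OF bl])
  have der: "((\<lambda>x. L x + \<theta> (c x) *\<^sub>R v) has_derivative blinfun_apply (D x)) (at x)" for x
  proof -
    have dc: "(c has_derivative c) (at x)" and dL: "(L has_derivative L) (at x)"
      using L c by (auto intro: bounded_linear_imp_has_derivative)
    have "(\<theta> has_derivative (\<lambda>h. \<theta>' (c x) * h)) (at (c x))"
      using \<theta>[of "c x"] by (simp add: has_field_derivative_def)
    from has_derivative_compose[OF dc this]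
    have "((\<lambda>x. \<theta> (c x)) has_derivative (\<lambda>h. \<theta>' (c x) * c h)) (at x)" .
    from has_derivative_add[OF dL has_derivative_scaleR_left[OF this, of v]]
    show ?thesis by (simp add: D[abs_def])
  qed
  have "continuous_on UNIV (\<lambda>x. \<theta>' (c x))"
    using continuous_on_compose2[OF cont linear_continuous_on[OF c]] by simp
  then have "continuous_on UNIV D"
    unfolding D_def by (intro continuous_intros)
  then show ?thesis by (rule that[OF der _ D])
qed

text \<open>Each diagonal entry moves by at most the operator norm; this makes traces at fixed
  points stable under C1 perturbation.\<close>

lemma abs_blinfun_trace_diff_le:
  fixes L M :: "(real ^ 'n::finite) \<Rightarrow>\<^sub>L (real ^ 'n)"
  shows "\<bar>blinfun_trace L - blinfun_trace M\<bar> \<le> CARD('n) * dist L M"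
proof -
  have "blinfun_trace L - blinfun_trace M = (\<Sum>i\<in>UNIV. (L - M) (axis i 1) $ i)"
    by (simp add: blinfun_trace_alt sum_subtractf blinfun.diff_left)
  also have "\<bar>\<dots>\<bar> \<le> (\<Sum>i\<in>(UNIV :: 'n set). dist L M)"
  proof (rule order_trans[OF sum_abs sum_mono])
    fix i :: 'n
    have "\<bar>(L - M) (axis i 1) $ i\<bar> \<le> norm ((L - M) (axis i 1))" by (rule component_le_norm_cart)
    also have "\<dots> \<le> norm (L - M) * norm (axis i 1 :: real ^ 'n)" by (rule norm_blinfun)
    finally show "\<bar>(L - M) (axis i 1) $ i\<bar> \<le> dist L M" by (simp add: dist_norm norm_axis_1)
  qed
  finally show ?thesis by simp
qed

text \<open>The coordinate \<open>i0\<close> separates the fixed points of \<open>A\<close> on the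
  torus and is a multiple of 1 / N there. The shear acts in direction \<open>i1\<close>, and
  \<open>A_i1_i0\<close> makes its derivative visible in the trace.\<close>

locale shear_model = rank_one_automorphism +
  fixes i0 i1 :: "'a::finite" and N :: nat
  assumes N_pos: "N > 0" and i0_i1: "i0 \<noteq> i1"
    and fixed_coord: "integral_vec (A x - x) \<Longrightarrow> real N * x $ i0 \<in> \<int>"
    and fixed_coord_integral: "integral_vec (A x - x) \<Longrightarrow> x $ i0 \<in> \<int> \<Longrightarrow> integral_vec x"
    and A_i1_i0: "A (axis i1 1) $ i0 \<noteq> 0"
begin

text \<open>\<open>A - 1\<close> is invertible because neither \<alpha> nor \<beta> is 1. Its
  inverse \<open>R\<close> recasts fixed point equations as contractions.\<close>

lemma resolvent:
  obtains R Q where "linear R" "\<And>x. R (A x - x) = x" "\<And>x. A (R x) - R x = x"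
    "Q > 0" "\<And>x. norm (R x) \<le> Q * norm x"
proof -
  have lin: "linear (\<lambda>x. A x - x)"
    by (intro linear_compose_sub linear_A linear_ident)
  have "inj (\<lambda>x. A x - x)"
    unfolding linear_injective_0[OF lin]
  proof (intro allI impI)
    fix x assume "A x - x = 0"
    then have "A x = x" by simp
    then have "\<alpha> * lu x = lu x" "\<beta> * ls x = ls x" using lu_A[of x] ls_A[of x] by simp_all
    moreover have "\<alpha> \<noteq> 1" "\<beta> \<noteq> 1" using norm_\<alpha> norm_\<beta> by auto
    ultimately have "lu x = 0" "ls x = 0" by auto
    then show "x = 0" by (rule lu_ls_inj)
  qed
  from linear_injective_isomorphism[OF lin this] obtain R where
    R: "linear R" "\<And>x. R (A x - x) = x" "\<And>x. A (R x) - R x = x" by blast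
  moreover obtain Q where "Q > 0" "\<And>x. norm (R x) \<le> Q * norm x"
    using bounded_linear.pos_bounded[of R] R(1) unfolding linear_conv_bounded_linear
    by (metis mult.commute)
  ultimately show ?thesis using that by blast
qed

text \<open>This is \<open>A\<close> after the shear that adds
  \<open>\<kappa> * \<theta> (x $ i0)\<close> to the coordinate \<open>i1\<close>.\<close>

definition shear_lift :: "(real \<Rightarrow> real) \<Rightarrow> real \<Rightarrow> real ^ 'a \<Rightarrow> real ^ 'a" where
  "shear_lift \<theta> \<kappa> x = A x + (\<kappa> * \<theta> (x $ i0)) *\<^sub>R A (axis i1 1)"

definition shear_map :: "(real \<Rightarrow> real) \<Rightarrow> real \<Rightarrow> 'a torus \<Rightarrow> 'a torus" where
  "shear_map \<theta> \<kappa> p = torus_proj (shear_lift \<theta> \<kappa> (torus_rep p))"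

context
  fixes \<theta> \<theta>' :: "real \<Rightarrow> real" and \<kappa> :: real
  assumes \<theta>_deriv: "\<And>t. (\<theta> has_real_derivative \<theta>' t) (at t)"
    and \<theta>'_cont: "continuous_on UNIV \<theta>'"
    and \<theta>_periodic: "\<And>t k. k \<in> \<int> \<Longrightarrow> \<theta> (t + k) = \<theta> t"
begin

lemma shear_lift_add:
  "integral_vec m \<Longrightarrow> shear_lift \<theta> \<kappa> (x + m) = shear_lift \<theta> \<kappa> x + A m"
  by (simp add: shear_lift_def A.add \<theta>_periodic integral_vec_def)

lemma torus_proj_shear_lift: "torus_proj (shear_lift \<theta> \<kappa> x) = shear_map \<theta> \<kappa> (torus_proj x)"
proof -
  define m where "m = x - torus_rep (torus_proj x)"
  have m: "integral_vec m" unfolding m_def torus_proj_eq_integral[symmetric] by simp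
  have "shear_lift \<theta> \<kappa> x = shear_lift \<theta> \<kappa> (torus_rep (torus_proj x)) + A m"
    using shear_lift_add[OF m, of "torus_rep (torus_proj x)"] by (simp add: m_def)
  then show ?thesis
    by (simp add: shear_map_def torus_proj_add_integral integral_A[OF m])
qed

lemma shear_lift_has_derivative:
  obtains D where "\<And>x. (shear_lift \<theta> \<kappa> has_derivative blinfun_apply (D x)) (at x)"
    "continuous_on UNIV D"
    "\<And>x h. blinfun_apply (D x) h = A h + (\<kappa> * \<theta>' (x $ i0) * h $ i0) *\<^sub>R A (axis i1 1)"
proof -
  have "((\<lambda>t. \<kappa> * \<theta> t) has_real_derivative \<kappa> * \<theta>' t) (at t)" for t
    using \<theta>_deriv by (auto intro!: derivative_eq_intros)
  from has_derivative_shear[OF linear_A[unfolded linear_conv_bounded_linear] bounded_linear_vec_nth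
      this continuous_on_mult_left[OF \<theta>'_cont], of i0 "A (axis i1 1)"]
  show ?thesis using that unfolding shear_lift_def[abs_def] by blast
qed

lemma shear_map_Diff1: "shear_map \<theta> \<kappa> \<in> Diff1"
proof -
  let ?f = "shear_map \<theta> \<kappa>" and ?F = "shear_lift \<theta> \<kappa>"
  \<comment> \<open>Undo \<open>A\<close>, then the shear; as \<open>i0 \<noteq> i1\<close>, the
    shear leaves the argument of \<theta> unchanged, so it is inverted by a change of sign.\<close>
  define G where "G y = Ai y + (- \<kappa> * \<theta> (Ai y $ i0)) *\<^sub>R axis i1 1" for y
  define g where "g p = torus_proj (G (torus_rep p))" for p
  have GF: "G (?F x) = x" and FG: "?F (G x) = x" for x
    using i0_i1 by (simp_all add: G_def shear_lift_def A.add A.scale Ai.add Ai.scale axis_def A.diff)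
  have G_add: "G (x + m) = G x + Ai m" if "integral_vec m" for x m
    using integral_Ai[OF that] by (simp add: G_def Ai.add \<theta>_periodic integral_vec_def)
  have Gg: "torus_proj (G x) = g (torus_proj x)" for x
  proof -
    define m where "m = x - torus_rep (torus_proj x)"
    have m: "integral_vec m" unfolding m_def torus_proj_eq_integral[symmetric] by simp
    have "G x = G (torus_rep (torus_proj x)) + Ai m"
      using G_add[OF m, of "torus_rep (torus_proj x)"] by (simp add: m_def)
    then show ?thesis
      by (simp add: g_def torus_proj_add_integral integral_Ai[OF m])
  qed
  have fg: "?f (g p) = p" and gf: "g (?f p) = p" for p
  proof -
    obtain x where x: "torus_proj x = p" using torus_proj_surj by metis
    show "?f (g p) = p" "g (?f p) = p"
      unfolding x[symmetric] by (simp_all add: FG GF flip: Gg torus_proj_shear_lift)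
  qed
  have "bij ?f" using fg gf by (intro o_bij[of g]) (auto simp: fun_eq_iff)
  moreover have "inv ?f = g" using fg gf by (intro inv_unique_comp) (auto simp: fun_eq_iff)
  moreover have "torus_C1 ?f"
    using shear_lift_has_derivative torus_C1_of_lift(1) torus_proj_shear_lift by metis
  moreover have "torus_C1 g"
  proof -
    have bl: "bounded_linear Ai" using linear_Ai by (simp add: linear_conv_bounded_linear)
    have d: "((\<lambda>t. - \<kappa> * \<theta> t) has_real_derivative - \<kappa> * \<theta>' t) (at t)" for t
      using \<theta>_deriv by (auto intro!: derivative_eq_intros)
    show ?thesis
    proof (rule has_derivative_shear[OF bl bounded_linear_compose[OF bounded_linear_vec_nth bl, of i0]
        d continuous_on_mult_left[OF \<theta>'_cont], of "axis i1 1"])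
      fix D assume D: "\<And>x. ((\<lambda>x. Ai x + (- \<kappa> * \<theta> (Ai x $ i0)) *\<^sub>R axis i1 1)
          has_derivative blinfun_apply (D x)) (at x)" "continuous_on UNIV D"
      show ?thesis by (rule torus_C1_of_lift(1)[OF D(1)[folded G_def] D(2) Gg])
    qed
  qed
  ultimately show ?thesis by (simp add: Diff1_def)
qed

end

end

section \<open>A neighbourhood of the shear map with trivial centralizers\<close>

context shear_model
begin

lemma blinfun_trace_shear:
  assumes "\<And>h. blinfun_apply D h = A h + (t * h $ i0) *\<^sub>R w"
  shows "blinfun_trace D = (\<Sum>i\<in>UNIV. A (axis i 1) $ i) + t * w $ i0"
proof -
  have "blinfun_trace D = (\<Sum>i\<in>UNIV. A (axis i 1) $ i + (if i0 = i then t * w $ i0 else 0))"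
    unfolding blinfun_trace_alt by (intro sum.cong refl) (auto simp: assms axis_def)
  then show ?thesis by (simp add: sum.distrib)
qed

theorem trivial_centralizer_interior:
  "C1_topology interior_of (trivial_centralizer :: ('a torus \<Rightarrow> 'a torus) set) \<noteq> {}"
proof -
  obtain K where K: "K \<ge> 1" "\<And>x. norm x \<le> K * max (norm (lu x)) (norm (ls x))"
    "\<And>x. norm (lu x) \<le> K * norm x" "\<And>x. norm (ls x) \<le> K * norm x"
    by (rule norm_equivalence) blast
  obtain R Q where R: "linear R" "\<And>x. R (A x - x) = x" "\<And>x. A (R x) - R x = x"
    and Q: "Q > 0" "\<And>x. norm (R x) \<le> Q * norm x"
    by (rule resolvent) blast
  interpret R: linear R by (rule R)
  obtain \<theta> \<theta>' :: "real \<Rightarrow> real" and M M' \<gamma> :: real where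
    \<theta>: "\<And>t. (\<theta> has_real_derivative \<theta>' t) (at t)" "continuous_on UNIV \<theta>'"
      "\<And>t k. k \<in> \<int> \<Longrightarrow> \<theta> (t + k) = \<theta> t" "\<And>t. \<bar>\<theta> t\<bar> \<le> 1"
    and M: "M > 0" "\<And>t. \<bar>\<theta>' t\<bar> \<le> M" and M': "M' > 0" "\<And>s t. \<bar>\<theta>' s - \<theta>' t\<bar> \<le> M' * \<bar>s - t\<bar>"
    and \<theta>0: "\<And>t. real N * t \<in> \<int> \<Longrightarrow> \<theta> t = 0"
    and \<gamma>: "\<gamma> > 0" "\<And>s t. real N * s \<in> \<int> \<Longrightarrow> real N * t \<in> \<int> \<Longrightarrow> s - t \<notin> \<int> \<Longrightarrow> \<bar>\<theta>' s - \<theta>' t\<bar> \<ge> \<gamma>"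
    by (rule separating_function_exists[OF N_pos]) blast
  define w where "w = A (axis i1 1)"
  \<comment> \<open>Half the smaller spectral gap; it becomes the constant \<eta> of
    \<open>anosov_perturbation\<close>.\<close>
  define \<rho> where "\<rho> = min (norm \<alpha> - 1) (1 - norm \<beta>) / 2"
  have \<rho>: "\<rho> > 0" "norm \<alpha> - \<rho> > 1" "norm \<beta> + \<rho> < 1"
  proof -
    have "\<rho> \<le> (norm \<alpha> - 1) / 2" "\<rho> \<le> (1 - norm \<beta>) / 2" by (simp_all add: \<rho>_def)
    then show "norm \<alpha> - \<rho> > 1" "norm \<beta> + \<rho> < 1"
      using norm_\<alpha> norm_\<beta> by (simp_all add: field_simps)
    show "\<rho> > 0" using norm_\<alpha> norm_\<beta> by (simp add: \<rho>_def)
  qed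
  \<comment> \<open>The Lipschitz constant allowed for \<open>F - A\<close>. The first entry pays
    for the two factors \<open>K\<close> of the change of norm, the second makes the fixed point map
    contract by 1 / 2.\<close>
  define \<delta> where "\<delta> = min (\<rho> / K\<^sup>2) (1 / (2 * Q))"
  have \<delta>: "\<delta> > 0" "K\<^sup>2 * \<delta> \<le> \<rho>" "Q * \<delta> \<le> 1 / 2"
  proof -
    show "\<delta> > 0" using \<rho> K Q by (simp add: \<delta>_def)
    have "\<delta> \<le> \<rho> / K\<^sup>2" "\<delta> \<le> 1 / (2 * Q)" by (simp_all add: \<delta>_def)
    then show "K\<^sup>2 * \<delta> \<le> \<rho>" "Q * \<delta> \<le> 1 / 2" using K(1) Q(1) by (simp_all add: field_simps)
  qed
  \<comment> \<open>Half of \<delta> is spent on the shear and the other half is left for the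
    perturbation.\<close>
  define \<kappa> where "\<kappa> = \<delta> / (2 * (M * norm w + 1))"
  have Mw: "M * norm w \<ge> 0" using M(1) by simp
  have \<kappa>: "\<kappa> > 0" "\<kappa> * (M * norm w) \<le> \<delta> / 2"
    using \<delta>(1) Mw by (auto simp: \<kappa>_def divide_simps)
  \<comment> \<open>The rate at which the trace of the derivative of the shear map varies with
    \<theta>'.\<close>
  define c where "c = \<kappa> * \<bar>w $ i0\<bar>"
  have c: "c > 0" using \<kappa> A_i1_i0 by (simp add: c_def w_def)
  \<comment> \<open>\<open>E * \<epsilon> / 2\<close> will bound the error of each trace: the change
    of the derivative, plus the motion of the fixed point by at most
    \<open>2 * Q * \<epsilon>\<close>.\<close>
  define E where "E = 2 * (real CARD('a) + c * M' * (2 * Q))"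
  have E: "E > 0" using c M'(1) Q(1) by (auto simp: E_def intro!: add_nonneg_pos)
  define \<epsilon> where "\<epsilon> = min (min (1 / 2) (\<delta> / 2)) (c * \<gamma> / (2 * E))"
  have \<epsilon>: "\<epsilon> > 0" "\<epsilon> \<le> 1 / 2" "\<epsilon> \<le> \<delta> / 2" "E * \<epsilon> < c * \<gamma>"
  proof -
    show "\<epsilon> > 0" using \<delta>(1) c \<gamma>(1) E by (simp add: \<epsilon>_def)
    show "\<epsilon> \<le> 1 / 2" "\<epsilon> \<le> \<delta> / 2" by (simp_all add: \<epsilon>_def)
    have "E * \<epsilon> \<le> E * (c * \<gamma> / (2 * E))" using E by (intro mult_left_mono) (auto simp: \<epsilon>_def)
    also have "\<dots> < c * \<gamma>" using E c \<gamma>(1) by simp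
    finally show "E * \<epsilon> < c * \<gamma>" .
  qed
  define f0 where "f0 = shear_map \<theta> \<kappa>"
  define F0 where "F0 = shear_lift \<theta> \<kappa>"
  have f0: "f0 \<in> Diff1" unfolding f0_def using \<theta>(1-3) by (rule shear_map_Diff1)
  have F0: "F0 x = A x + (\<kappa> * \<theta> (x $ i0)) *\<^sub>R w" for x
    by (simp add: F0_def shear_lift_def w_def)
  have F0_proj: "torus_proj (F0 x) = f0 (torus_proj x)" for x
    unfolding f0_def F0_def using \<theta>(1-3) by (rule torus_proj_shear_lift)
  obtain D where D: "\<And>x. (F0 has_derivative blinfun_apply (D x)) (at x)" "continuous_on UNIV D"
    "\<And>x h. blinfun_apply (D x) h = A h + (\<kappa> * \<theta>' (x $ i0) * h $ i0) *\<^sub>R w"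
    by (rule shear_lift_has_derivative[OF \<theta>(1-3), of \<kappa>, folded F0_def w_def]) (assumption, rule that)
  have f0_deriv: "torus_deriv f0 (torus_proj x) = D x" for x
    by (rule torus_C1_of_lift(2)[OF D(1,2) F0_proj])
  have "continuous_on UNIV F0"
    using D(1) has_derivative_continuous by (blast intro: continuous_at_imp_continuous_on)
  then have lift_F0: "torus_lift f0 F0" using F0_proj by (simp add: torus_lift_def)
  have action_F0: "lift_action F0 m = A m" if "integral_vec m" for m
    using shear_lift_add[OF \<theta>(1-3) that, of \<kappa> 0] by (simp add: F0_def lift_action_def)
  have "f \<in> trivial_centralizer" if "f \<in> C1_ball f0 \<epsilon>" for f
  proof -
    from that obtain \<epsilon>' where f: "f \<in> Diff1" and \<epsilon>': "\<epsilon>' < \<epsilon>" "\<And>p. dist (f p) (f0 p) \<le> \<epsilon>'"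
      "\<And>p. dist (torus_deriv f p) (torus_deriv f0 p) \<le> \<epsilon>'"
      unfolding C1_ball_def by blast
    have near: "dist (f p) (f0 p) < \<epsilon>" "dist (torus_deriv f p) (torus_deriv f0 p) \<le> \<epsilon>" for p
      using \<epsilon>'(1) \<epsilon>'(2,3)[of p] by linarith+
    have C1: "torus_C1 f" using f by (simp add: Diff1_def)
    obtain F where lift_F: "torus_lift f F" and FF0: "\<And>x. norm (F x - F0 x) < \<epsilon>"
      and F_add: "\<And>x m. integral_vec m \<Longrightarrow> F (x + m) = F x + A m"
      and F_deriv: "\<And>x. (F has_derivative blinfun_apply (torus_deriv f (torus_proj x))) (at x)"
      using lift_near[OF C1 lift_F0 near(1) \<epsilon>(2)] action_F0 by metis
    define \<phi> where "\<phi> x = F x - A x" for x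
    \<comment> \<open>By the mean value inequality: the derivative of \<phi> is a perturbation of
      size at most \<epsilon> plus the rank one term of the shear.\<close>
    have \<phi>_lip: "norm (\<phi> x - \<phi> y) \<le> \<delta> * norm (x - y)" for x y
    proof (rule differentiable_bound[of UNIV])
      fix x :: "real ^ 'a"
      let ?L = "torus_deriv f (torus_proj x)"
      have "bounded_linear A" using linear_A by (simp add: linear_conv_bounded_linear)
      then show "(\<phi> has_derivative (\<lambda>h. blinfun_apply ?L h - A h)) (at x within UNIV)"
        unfolding \<phi>_def[abs_def] using F_deriv[of x]
        by (intro has_derivative_diff) (auto intro: bounded_linear_imp_has_derivative)
      show "onorm (\<lambda>h. blinfun_apply ?L h - A h) \<le> \<delta>"
      proof (rule onorm_le)
        fix h
        have "blinfun_apply ?L h - A h = blinfun_apply (?L - D x) h + (\<kappa> * \<theta>' (x $ i0) * h $ i0) *\<^sub>R w"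
          by (simp add: D(3) blinfun.diff_left)
        also have "norm \<dots> \<le> norm (?L - D x) * norm h + \<bar>\<kappa> * \<theta>' (x $ i0) * h $ i0\<bar> * norm w"
          by (rule order_trans[OF norm_triangle_ineq]) (intro add_mono norm_blinfun; simp)
        also have "\<dots> \<le> \<epsilon> * norm h + (\<kappa> * M * norm h) * norm w"
          using near(2)[of "torus_proj x"] M(2)[of "x $ i0"] component_le_norm_cart[of h i0] \<kappa>(1) M(1)
          by (intro add_mono mult_right_mono)
            (auto simp: f0_deriv dist_norm abs_mult intro!: mult_mono)
        also have "\<dots> = (\<epsilon> + \<kappa> * (M * norm w)) * norm h" by (simp add: algebra_simps)
        also have "\<dots> \<le> \<delta> * norm h" using \<epsilon>(3) \<kappa>(2) by (intro mult_right_mono) auto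
        finally show "norm (blinfun_apply ?L h - A h) \<le> \<delta> * norm h" .
      qed
    qed auto
    have F_diff: "F x - F y - A (x - y) = \<phi> x - \<phi> y" for x y by (simp add: \<phi>_def A.diff)
    have lip: "norm z \<le> K * (\<delta> * norm (x - y)) \<Longrightarrow>
        norm z \<le> \<rho> * max (norm (lu (x - y))) (norm (ls (x - y)))" for x y and z :: complex
    proof -
      let ?m = "max (norm (lu (x - y))) (norm (ls (x - y)))"
      assume "norm z \<le> K * (\<delta> * norm (x - y))"
      also have "\<dots> \<le> K * (\<delta> * (K * ?m))" using K(1,2) \<delta>(1) by (intro mult_left_mono) auto
      also have "\<dots> = (K\<^sup>2 * \<delta>) * ?m" by (simp add: power2_eq_square)
      also have "\<dots> \<le> \<rho> * ?m" using \<delta>(2) by (intro mult_right_mono) (auto simp: le_max_iff_disj)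
      finally show ?thesis .
    qed
    have lip_lu: "norm (lu (F x - F y - A (x - y))) \<le> \<rho> * max (norm (lu (x - y))) (norm (ls (x - y)))"
      and lip_ls: "norm (ls (F x - F y - A (x - y))) \<le> \<rho> * max (norm (lu (x - y))) (norm (ls (x - y)))" for x y
      unfolding F_diff using K(1) \<phi>_lip[of x y]
      by (intro lip order_trans[OF K(3)] order_trans[OF K(4)] mult_left_mono; simp)+
    \<comment> \<open>Inverting \<open>A - 1\<close> turns the equation into a fixed point problem
      for the contraction treated in \<open>ex1\<close>.\<close>
    have fixed_iff: "F x = x + k \<longleftrightarrow> R (k - \<phi> x) = x" for x k
    proof
      assume "F x = x + k"
      then have "k - \<phi> x = A x - x" by (simp add: \<phi>_def algebra_simps)
      then show "R (k - \<phi> x) = x" by (simp add: R(2))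
    next
      assume "R (k - \<phi> x) = x"
      then have "A x - x = k - \<phi> x" using R(3)[of "k - \<phi> x"] by simp
      then show "F x = x + k" by (simp add: \<phi>_def algebra_simps)
    qed
    have ex1: "\<exists>!x. R (k - \<phi> x) = x" for k
    proof (rule banach_fix_type[of "1 / 2"]; (intro allI)?)
      fix x y
      have "R (k - \<phi> x) - R (k - \<phi> y) = R (\<phi> y - \<phi> x)" by (simp flip: R.diff)
      then have "dist (R (k - \<phi> x)) (R (k - \<phi> y)) \<le> Q * norm (\<phi> y - \<phi> x)"
        using Q(2) by (simp add: dist_norm)
      also have "\<dots> \<le> Q * (\<delta> * norm (y - x))" using Q(1) \<phi>_lip by (intro mult_left_mono) auto
      also have "\<dots> = (Q * \<delta>) * dist x y" by (simp add: dist_norm norm_minus_commute)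
      also have "\<dots> \<le> 1 / 2 * dist x y" using \<delta>(3) by (intro mult_right_mono) auto
      finally show "dist (R (k - \<phi> x)) (R (k - \<phi> y)) \<le> 1 / 2 * dist x y" .
    qed auto
    have fixed_exists: "\<exists>x. F x = x + k" for k
      unfolding fixed_iff using ex1 by blast
    have fixed_unique: "x = y" if "F x = x + k" "F y = y + k" for x y k
      using ex1[of k] that unfolding fixed_iff by blast
    have coord: "real N * R k $ i0 \<in> \<int>" if "integral_vec k" for k
      using fixed_coord[of "R k"] that by (simp add: R(3))
    let ?T = "\<lambda>x. blinfun_trace (torus_deriv f (torus_proj x))"
    define \<tau> where "\<tau> = (\<Sum>i\<in>UNIV. A (axis i 1) $ i)"
    \<comment> \<open>\<open>R k\<close> solves \<open>A x = x + k\<close>, and the shear vanishes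
      there, so it solves the same equation for \<open>F0\<close>. The trace at \<open>x\<close> is
      compared with the trace of the derivative of \<open>F0\<close> at \<open>R k\<close>.\<close>
    have trace: "\<bar>?T x - (\<tau> + \<kappa> * \<theta>' (R k $ i0) * w $ i0)\<bar> \<le> E * \<epsilon> / 2"
      if k: "integral_vec k" and x: "F x = x + k" for x k
    proof -
      have "x - R k = R (- \<phi> x)"
        using x unfolding fixed_iff by (metis R.diff R.neg diff_minus_eq_add minus_diff_commute diff_add_cancel add_diff_cancel_left' uminus_add_conv_diff)
      then have "norm (x - R k) \<le> Q * norm (\<phi> x)" using Q(2)[of "- \<phi> x"] by simp
      also have "\<phi> x = (F x - F0 x) + (\<kappa> * \<theta> (x $ i0)) *\<^sub>R w"
        by (simp add: \<phi>_def F0)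
      also have "norm \<dots> \<le> \<epsilon> + (\<kappa> * (M * norm (x - R k))) * norm w"
      proof -
        \<comment> \<open>As \<theta> vanishes at \<open>R k\<close>, the shear contributes only a
          multiple of the unknown distance, which is absorbed below; the remaining bound is of order
          \<epsilon>.\<close>
        have "\<bar>\<theta> (x $ i0)\<bar> = \<bar>\<theta> (x $ i0) - \<theta> (R k $ i0)\<bar>" using \<theta>0[OF coord[OF k]] by simp
        also have "\<dots> \<le> M * \<bar>x $ i0 - R k $ i0\<bar>" by (rule real_lipschitz_of_deriv[OF \<theta>(1) M(2)])
        also have "\<dots> \<le> M * norm (x - R k)"
          using component_le_norm_cart[of "x - R k" i0] M(1) by (intro mult_left_mono) auto
        finally have "(\<kappa> * \<bar>\<theta> (x $ i0)\<bar>) * norm w \<le> (\<kappa> * (M * norm (x - R k))) * norm w"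
          using \<kappa>(1) by (intro mult_right_mono mult_left_mono) auto
        then have "norm ((\<kappa> * \<theta> (x $ i0)) *\<^sub>R w) \<le> (\<kappa> * (M * norm (x - R k))) * norm w"
          using \<kappa>(1) by (simp add: abs_mult)
        then show ?thesis
          using FF0[of x] by (intro order_trans[OF norm_triangle_ineq] add_mono) auto
      qed
      finally have "norm (x - R k) \<le> Q * (\<epsilon> + (\<kappa> * (M * norm (x - R k))) * norm w)"
        using Q(1) by (simp add: mult_left_mono)
      also have "\<dots> = Q * \<epsilon> + Q * (\<kappa> * (M * norm w)) * norm (x - R k)" by (simp add: algebra_simps)
      also have "\<dots> \<le> Q * \<epsilon> + (1 / 2) * norm (x - R k)"
      proof -
        have "Q * (\<kappa> * (M * norm w)) \<le> Q * \<delta>" using \<kappa>(2) \<delta>(1) Q(1) by (intro mult_left_mono) auto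
        then have "Q * (\<kappa> * (M * norm w)) \<le> 1 / 2" using \<delta>(3) by simp
        then show ?thesis by (intro add_left_mono mult_right_mono) auto
      qed
      finally have dx: "norm (x - R k) \<le> 2 * Q * \<epsilon>" by simp
      have "?T x - (\<tau> + \<kappa> * \<theta>' (R k $ i0) * w $ i0)
          = (?T x - blinfun_trace (D x)) + \<kappa> * (\<theta>' (x $ i0) - \<theta>' (R k $ i0)) * w $ i0"
        by (simp add: blinfun_trace_shear[OF D(3)] \<tau>_def algebra_simps)
      also have "\<bar>\<dots>\<bar> \<le> \<bar>?T x - blinfun_trace (D x)\<bar> + c * \<bar>\<theta>' (x $ i0) - \<theta>' (R k $ i0)\<bar>"
        using \<kappa>(1) by (intro order_trans[OF abs_triangle_ineq]) (simp add: abs_mult c_def)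
      also have "\<dots> \<le> CARD('a) * \<epsilon> + c * (M' * (2 * Q * \<epsilon>))"
      proof (intro add_mono mult_left_mono)
        show "\<bar>?T x - blinfun_trace (D x)\<bar> \<le> CARD('a) * \<epsilon>"
          using abs_blinfun_trace_diff_le near(2)[of "torus_proj x"]
          by (intro order_trans[OF abs_blinfun_trace_diff_le] mult_left_mono) (auto simp: f0_deriv)
        have "M' * \<bar>x $ i0 - R k $ i0\<bar> \<le> M' * (2 * Q * \<epsilon>)"
          using component_le_norm_cart[of "x - R k" i0] dx M'(1) by (intro mult_left_mono) auto
        then show "\<bar>\<theta>' (x $ i0) - \<theta>' (R k $ i0)\<bar> \<le> M' * (2 * Q * \<epsilon>)"
          using M'(2) order_trans by blast
      qed (use c in simp)
      also have "\<dots> = E * \<epsilon> / 2" by (simp add: E_def algebra_simps)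
      finally show ?thesis .
    qed
    have fixed_separated: "integral_vec (x - y)"
      if k: "integral_vec k" "F x = x + k" and l: "integral_vec l" "F y = y + l" and eq: "?T x = ?T y"
      for x y k l
    proof -
      \<comment> \<open>Equal traces bring the values of \<theta>' at these coordinates closer than
        \<gamma>, so the coordinates agree modulo the integers. Then \<open>R (k - l)\<close> is
        integral, and adding it to \<open>y\<close> solves the equation of \<open>x\<close>, which
        has one solution.\<close>
      let ?s = "R k $ i0" and ?t = "R l $ i0"
      have "\<bar>\<kappa> * \<theta>' ?s * w $ i0 - \<kappa> * \<theta>' ?t * w $ i0\<bar> \<le> E * \<epsilon>"
        using trace[OF k] trace[OF l] eq by linarith
      moreover have "\<kappa> * \<theta>' ?s * w $ i0 - \<kappa> * \<theta>' ?t * w $ i0 = \<kappa> * w $ i0 * (\<theta>' ?s - \<theta>' ?t)"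
        by (simp add: algebra_simps)
      ultimately have "c * \<bar>\<theta>' ?s - \<theta>' ?t\<bar> \<le> E * \<epsilon>"
        using \<kappa>(1) by (simp add: c_def abs_mult)
      then have "c * \<bar>\<theta>' ?s - \<theta>' ?t\<bar> < c * \<gamma>" using \<epsilon>(4) by simp
      then have "\<bar>\<theta>' ?s - \<theta>' ?t\<bar> < \<gamma>" using c by simp
      then have int: "?s - ?t \<in> \<int>"
        using \<gamma>(2)[OF coord[OF k(1)] coord[OF l(1)]] by fastforce
      define z where "z = R (k - l)"
      have Az: "A z - z = k - l" by (simp add: z_def R(3))
      have z: "integral_vec z"
      proof (rule fixed_coord_integral)
        show "integral_vec (A z - z)" using k(1) l(1) by (simp add: Az)
        show "z $ i0 \<in> \<int>" using int by (simp add: z_def R.diff)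
      qed
      have "F (y + z) = y + l + A z" by (simp add: F_add[OF z] l(2))
      also have "\<dots> = y + z + k" using Az by (simp add: algebra_simps)
      finally have "x = y + z" by (rule fixed_unique[OF k(2)])
      then show ?thesis using z by simp
    qed
    have bounded: "norm (F x - A x) \<le> \<epsilon> + \<kappa> * norm w" for x
    proof -
      have "F x - A x = (F x - F0 x) + (\<kappa> * \<theta> (x $ i0)) *\<^sub>R w" by (simp add: F0)
      also have "norm \<dots> \<le> \<epsilon> + \<kappa> * norm w"
        using FF0[of x] \<theta>(4)[of "x $ i0"] \<kappa>(1)
        by (intro order_trans[OF norm_triangle_ineq] add_mono)
          (auto simp: abs_mult mult_left_le_one_le)
      finally show ?thesis .
    qed
    interpret anosov_perturbation A Ai lu ls \<alpha> \<beta> a b e f F "\<epsilon> + \<kappa> * norm w" \<rho>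
      by unfold_locales
        (use f lift_F F_add bounded \<rho> lip_lu lip_ls fixed_exists fixed_separated in blast)+
    show ?thesis by (rule f_trivial_centralizer)
  qed
  then have "C1_ball f0 \<epsilon> \<subseteq> C1_topology interior_of trivial_centralizer"
    by (intro interior_of_maximal openin_C1_ball) blast
  then show ?thesis using C1_ball_centre[OF f0 \<epsilon>(1)] by blast
qed

end

section \<open>Companion matrices\<close>

text \<open>The characteristic polynomial is \<open>x ^ n - (\<Sum>k<n. co k * x ^ k)\<close>, with roots \<open>\<alpha>\<close>, \<open>\<beta>\<close> and their conjugates.\<close>

locale companion_model =
  fixes n :: nat and idx :: "'a::finite \<Rightarrow> nat" and co :: "nat \<Rightarrow> int" and \<alpha> \<beta> :: complex and a b :: nat
  assumes card_ge_2: "n \<ge> 2"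
    and bij_idx: "bij_betw idx UNIV {..<n}"
    and co_0: "co 0 * co 0 = 1"
    and sum_co: "(\<Sum>k<n. co k) \<noteq> 1"
    and root_\<alpha>: "\<alpha> ^ n = (\<Sum>k<n. of_int (co k) * \<alpha> ^ k)"
    and root_\<beta>: "\<beta> ^ n = (\<Sum>k<n. of_int (co k) * \<beta> ^ k)"
    and norm_\<alpha>: "norm \<alpha> > 1" and norm_\<beta>: "norm \<beta> < 1"
    and distinct_roots: "card {\<alpha>, \<beta>, cnj \<alpha>, cnj \<beta>} = n"
    and norm_form_Ints: "norm (\<Sum>k<n. of_int (q k) * \<alpha> ^ k) ^ a *
      norm (\<Sum>k<n. of_int (q k) * \<beta> ^ k) ^ b \<in> \<int>"
    and gap: "0 < s \<Longrightarrow> 0 < t \<Longrightarrow> s ^ a * t ^ b = 1 \<Longrightarrow> s ^ 2 \<le> norm \<alpha> \<Longrightarrow> 1 \<le> s ^ 2 * norm \<alpha> \<Longrightarrow>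
      (1 + s) ^ a * (1 + t) ^ b < norm (\<alpha> - 1) ^ a * norm (\<beta> - 1) ^ b"
begin

definition ix :: "nat \<Rightarrow> 'a" where "ix k = inv idx k"

lemma ix_idx [simp]: "ix (idx i) = i"
  using bij_idx unfolding ix_def by (intro inv_f_f) (simp add: bij_betw_def)

lemma idx_ix [simp]: "k < n \<Longrightarrow> idx (ix k) = k"
  using bij_idx by (metis ix_def bij_betw_imp_surj_on f_inv_into_f lessThan_iff)

lemma idx_less [simp]: "idx i < n"
  using bij_idx by (metis UNIV_I bij_betwE lessThan_iff)

lemma ix_eq_iff: "k < n \<Longrightarrow> l < n \<Longrightarrow> ix k = ix l \<longleftrightarrow> k = l"
  by (metis idx_ix)

lemma vec_eqI_ix: "(\<And>k. k < n \<Longrightarrow> x $ ix k = y $ ix k) \<Longrightarrow> x = (y :: 'b ^ 'a)"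
  by (metis idx_less ix_idx vec_eq_iff)

lemma integral_vec_ix: "integral_vec x \<longleftrightarrow> (\<forall>k<n. x $ ix k \<in> \<int>)"
  unfolding integral_vec_def by (metis idx_less ix_idx)

text \<open>Multiplication by the variable modulo the characteristic polynomial, in the basis of
  powers; \<open>ix k\<close> indexes the coefficient of the \<open>k\<close>-th power.\<close>

definition A :: "real ^ 'a \<Rightarrow> real ^ 'a" where
  "A x = (\<chi> i. (if idx i = 0 then 0 else x $ ix (idx i - 1)) + of_int (co (idx i)) * x $ ix (n - 1))"

text \<open>Division by the variable; the constant coefficient \<open>co 0\<close> is its own
  inverse.\<close>

definition Ai :: "real ^ 'a \<Rightarrow> real ^ 'a" where
  "Ai y = (\<chi> i. if idx i = n - 1 then of_int (co 0) * y $ ix 0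
     else y $ ix (idx i + 1) - of_int (co (idx i + 1)) * (of_int (co 0) * y $ ix 0))"

definition ev :: "complex \<Rightarrow> real ^ 'a \<Rightarrow> complex" where
  "ev z x = (\<Sum>k<n. of_real (x $ ix k) * z ^ k)"

lemma A_ix: "k < n \<Longrightarrow> A x $ ix k = (if k = 0 then 0 else x $ ix (k - 1)) + of_int (co k) * x $ ix (n - 1)"
  by (simp add: A_def)

lemma Ai_ix: "k < n \<Longrightarrow> Ai y $ ix k = (if k = n - 1 then of_int (co 0) * y $ ix 0
     else y $ ix (k + 1) - of_int (co (k + 1)) * (of_int (co 0) * y $ ix 0))"
  by (simp add: Ai_def)

lemma co_0_real: "of_int (co 0) * (of_int (co 0) * x) = (x :: real)"
  using co_0 by (metis mult.assoc mult_1 of_int_1 of_int_mult)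

lemma A_Ai: "A (Ai x) = x" and Ai_A: "Ai (A x) = x"
proof -
  show "A (Ai x) = x"
  proof (rule vec_eqI_ix)
    fix k assume k: "k < n"
    show "A (Ai x) $ ix k = x $ ix k"
      using k card_ge_2 by (cases k) (auto simp: A_ix Ai_ix co_0_real)
  qed
  show "Ai (A x) = x"
  proof (rule vec_eqI_ix)
    fix k assume k: "k < n"
    show "Ai (A x) $ ix k = x $ ix k"
    proof (cases "k = n - 1")
      case False
      then have "k + 1 < n" using k by simp
      then show ?thesis using k card_ge_2 False by (auto simp: A_ix Ai_ix co_0_real)
    qed (use card_ge_2 in \<open>auto simp: A_ix Ai_ix co_0_real\<close>)
  qed
qed

lemma linear_A: "linear A" and linear_Ai: "linear Ai"
  by (auto intro!: linearI simp: A_def Ai_def vec_eq_iff algebra_simps)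

lemma linear_ev: "linear (ev z)"
  by (auto intro!: linearI simp: ev_def distrib_right sum.distrib sum_distrib_left mult.assoc
      scaleR_conv_of_real[where 'a = complex])

lemma integral_A: "integral_vec x \<Longrightarrow> integral_vec (A x)"
  by (auto simp: integral_vec_def A_def)

lemma integral_Ai: "integral_vec x \<Longrightarrow> integral_vec (Ai x)"
  by (auto simp: integral_vec_def Ai_def)

lemma sum_split_last: "(\<Sum>k<n. h k) = (\<Sum>k<n - 1. h k) + h (n - 1)"
  and sum_split_first: "(\<Sum>k<n. h k) = h 0 + (\<Sum>k<n - 1. h (Suc k))"
  for h :: "nat \<Rightarrow> 'b::comm_monoid_add"
proof -
  have n: "n = Suc (n - 1)" using card_ge_2 by simp
  show "(\<Sum>k<n. h k) = (\<Sum>k<n - 1. h k) + h (n - 1)"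
    by (subst n) (simp only: sum.lessThan_Suc)
  show "(\<Sum>k<n. h k) = h 0 + (\<Sum>k<n - 1. h (Suc k))"
    by (subst n) (simp only: sum.lessThan_Suc_shift)
qed

lemma ev_A:
  assumes z: "z ^ n = (\<Sum>k<n. of_int (co k) * z ^ k)"
  shows "ev z (A x) = z * ev z x"
proof -
  let ?l = "complex_of_real (x $ ix (n - 1))"
  have "ev z (A x) = (\<Sum>k<n. of_real (if k = 0 then 0 else x $ ix (k - 1)) * z ^ k)
      + ?l * (\<Sum>k<n. of_int (co k) * z ^ k)"
    unfolding ev_def sum_distrib_left
    by (simp add: A_ix algebra_simps flip: sum.distrib cong: sum.cong_simp)
  also have "(\<Sum>k<n. of_real (if k = 0 then 0 else x $ ix (k - 1)) * z ^ k)
      = (\<Sum>k<n - 1. z * (of_real (x $ ix k) * z ^ k))"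
    by (subst sum_split_first) (simp add: mult.left_commute)
  also have "?l * (\<Sum>k<n. of_int (co k) * z ^ k) = z * (?l * z ^ (n - 1))"
    unfolding z[symmetric] using power_Suc[of z "n - 1"] card_ge_2 by (simp add: mult.left_commute)
  finally show ?thesis
    unfolding ev_def by (subst sum_split_last) (simp add: sum_distrib_left distrib_left)
qed

text \<open>A real polynomial of degree below \<open>n\<close> that vanishes at \<alpha> and \<beta>
  vanishes at their conjugates too, which makes \<open>n\<close> distinct roots.\<close>

lemma ev_inj:
  assumes "ev \<alpha> x = 0" "ev \<beta> x = 0"
  shows "x = 0"
proof (rule ccontr)
  assume "x \<noteq> 0"
  then obtain k where k: "k < n" "x $ ix k \<noteq> 0" using vec_eqI_ix[of x 0] by auto
  let ?Z = "{z. (\<Sum>i\<le>n - 1. complex_of_real (x $ ix i) * z ^ i) = 0}"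
  have n: "{..n - 1} = {..<n}" using card_ge_2 by auto
  have Z: "?Z = {z. ev z x = 0}" unfolding n ev_def ..
  have cnj: "ev (cnj z) x = cnj (ev z x)" for z
    by (simp add: ev_def)
  have "{\<alpha>, \<beta>, cnj \<alpha>, cnj \<beta>} \<subseteq> ?Z"
    using assms cnj[of \<alpha>] cnj[of \<beta>] unfolding Z by simp
  moreover have *: "finite ?Z \<and> card ?Z \<le> n - 1"
    using k by (intro polyfun_rootbound[of "n - 1" "\<lambda>i. complex_of_real (x $ ix i)"] exI[of _ k]) auto
  ultimately have "card {\<alpha>, \<beta>, cnj \<alpha>, cnj \<beta>} \<le> card ?Z" by (intro card_mono) simp_all
  also have "\<dots> \<le> n - 1" using * by simp
  finally have "n \<le> n - 1" unfolding distinct_roots .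
  then show False using card_ge_2 by simp
qed

abbreviation e :: "real ^ 'a" where "e \<equiv> axis (ix 0) 1"

lemma ev_axis: "k < n \<Longrightarrow> ev z (axis (ix k) 1) = z ^ k"
proof -
  assume k: "k < n"
  have "ev z (axis (ix k) 1) = (\<Sum>l<n. if l = k then z ^ k else 0)"
    unfolding ev_def by (intro sum.cong) (auto simp: axis_def ix_eq_iff k)
  then show ?thesis using k by simp
qed

lemma A_axis: "Suc k < n \<Longrightarrow> A (axis (ix k) 1) = axis (ix (Suc k)) 1"
  by (rule vec_eqI_ix) (auto simp: A_ix axis_def ix_eq_iff)

text \<open>The basis vectors are the images of \<open>e\<close> under powers of \<open>A\<close>,
  and a nonempty set closed under differences is a subgroup.\<close>

lemma cyclic:
  assumes e: "P e"
    and diff: "\<And>x y. integral_vec x \<Longrightarrow> integral_vec y \<Longrightarrow> P x \<Longrightarrow> P y \<Longrightarrow> P (x - y)"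
    and A: "\<And>x. integral_vec x \<Longrightarrow> P x \<Longrightarrow> P (A x)" and x: "integral_vec x"
  shows "P x"
proof -
  define S where "S = {x. integral_vec x \<and> P x}"
  have S0: "0 \<in> S" using diff[of e e] e by (simp add: S_def)
  have Sdiff: "x - y \<in> S" if "x \<in> S" "y \<in> S" for x y
    using that diff by (simp add: S_def)
  have Sadd: "x + y \<in> S" if "x \<in> S" "y \<in> S" for x y
    using Sdiff[OF that(1) Sdiff[OF S0 that(2)]] by simp
  have Snat: "real j *\<^sub>R v \<in> S" if "v \<in> S" for j v
    by (induction j) (auto simp: S0 scaleR_left_distrib intro: Sadd that)
  have Sint: "real_of_int j *\<^sub>R v \<in> S" if "v \<in> S" for j v
  proof (cases "j \<ge> 0")
    case True
    then show ?thesis using Snat[OF that, of "nat j"] by simp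
  next
    case False
    then show ?thesis using Sdiff[OF S0 Snat[OF that, of "nat (- j)"]] by simp
  qed
  have axis: "axis (ix k) 1 \<in> S" if "k < n" for k
    using that
  proof (induction k)
    case 0
    then show ?case using e by (simp add: S_def)
  next
    case (Suc k)
    then have "A (axis (ix k) 1) \<in> S" using A by (simp add: S_def integral_A)
    then show ?case using A_axis Suc.prems by simp
  qed
  have sums: "(\<Sum>k<j. (x $ ix k) *\<^sub>R axis (ix k) 1) \<in> S" if "j \<le> n" for j
    using that
  proof (induction j)
    case (Suc j)
    then have "x $ ix j \<in> \<int>" using x by (simp add: integral_vec_ix)
    then obtain m where "x $ ix j = of_int m" by (rule Ints_cases)
    then show ?case using Suc Sint[OF axis] by (auto intro: Sadd)
  qed (simp add: S0)
  have "x = (\<Sum>k<n. (x $ ix k) *\<^sub>R axis (ix k) 1)"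
  proof (rule vec_eqI_ix)
    fix l assume l: "l < n"
    have "(\<Sum>k<n. (x $ ix k) *\<^sub>R axis (ix k) 1) $ ix l = (\<Sum>k<n. if k = l then x $ ix l else 0)"
      unfolding sum_component by (intro sum.cong) (auto simp: axis_def ix_eq_iff l)
    then show "x $ ix l = (\<Sum>k<n. (x $ ix k) *\<^sub>R axis (ix k) 1) $ ix l" using l by simp
  qed
  with sums[of n] have "x \<in> S" by simp
  then show ?thesis by (simp add: S_def)
qed

text \<open>The absolute value of the characteristic polynomial at 1, that is, of the determinant of
  \<open>A - 1\<close>.\<close>

definition N :: nat where "N = nat \<bar>(\<Sum>k<n. co k) - 1\<bar>"

text \<open>The sum of all rows of \<open>A x - x\<close> telescopes to a multiple of the last
  coordinate by \<open>N\<close> up to sign. The first row links that coordinate to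
  \<open>x $ ix 0\<close> through the unit \<open>co 0\<close>, and the other rows give the
  remaining coordinates successively.\<close>

lemma fixed_coord:
  assumes x: "integral_vec (A x - x)"
  shows "real N * x $ ix 0 \<in> \<int>" and "x $ ix 0 \<in> \<int> \<Longrightarrow> integral_vec x"
proof -
  let ?l = "x $ ix (n - 1)"
  have row: "(if k = 0 then 0 else x $ ix (k - 1)) + of_int (co k) * ?l - x $ ix k \<in> \<int>" if "k < n" for k
    using x that unfolding integral_vec_ix by (auto simp: A_ix)
  have row0: "of_int (co 0) * ?l - x $ ix 0 \<in> \<int>" using row[of 0] card_ge_2 by simp
  have "(\<Sum>k<n. (if k = 0 then 0 else x $ ix (k - 1)) + of_int (co k) * ?l - x $ ix k) \<in> \<int>"
    using row by (intro Ints_sum) auto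
  also have "(\<Sum>k<n. (if k = 0 then 0 else x $ ix (k - 1)) + of_int (co k) * ?l - x $ ix k)
      = (\<Sum>k<n. if k = 0 then 0 else x $ ix (k - 1)) + (\<Sum>k<n. of_int (co k)) * ?l - (\<Sum>k<n. x $ ix k)"
    by (simp add: sum.distrib sum_subtractf sum_distrib_right)
  also have "(\<Sum>k<n. if k = 0 then 0 else x $ ix (k - 1)) = (\<Sum>k<n - 1. x $ ix k)"
    by (subst sum_split_first) simp
  also have "(\<Sum>k<n. x $ ix k) = (\<Sum>k<n - 1. x $ ix k) + ?l" by (rule sum_split_last)
  finally have l: "of_int ((\<Sum>k<n. co k) - 1) * ?l \<in> \<int>" by (simp add: algebra_simps)
  have "real N * ?l \<in> \<int>"
  proof -
    have "real N = of_int ((\<Sum>k<n. co k) - 1) \<or> real N = - of_int ((\<Sum>k<n. co k) - 1)"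
      by (simp add: N_def abs_if)
    then show ?thesis using l by (metis Ints_minus mult_minus_left)
  qed
  then have "of_int (co 0) * (real N * ?l) - real N * (of_int (co 0) * ?l - x $ ix 0) \<in> \<int>"
    by (rule Ints_diff[OF Ints_mult[OF Ints_of_int] Ints_mult[OF Ints_of_nat row0]])
  then show "real N * x $ ix 0 \<in> \<int>" by (simp add: algebra_simps)
  assume x0: "x $ ix 0 \<in> \<int>"
  have "of_int (co 0) * (of_int (co 0) * ?l - x $ ix 0) + of_int (co 0) * x $ ix 0 \<in> \<int>"
    by (rule Ints_add[OF Ints_mult[OF Ints_of_int row0] Ints_mult[OF Ints_of_int x0]])
  then have l: "?l \<in> \<int>" by (simp add: algebra_simps co_0_real)
  have "x $ ix k \<in> \<int>" if "k < n" for k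
    using that
  proof (induction k)
    case (Suc k)
    then have xk: "x $ ix k \<in> \<int>" and "x $ ix k + of_int (co (Suc k)) * ?l - x $ ix (Suc k) \<in> \<int>"
      using row[of "Suc k"] by simp_all
    from Ints_diff[OF Ints_add[OF xk Ints_mult[OF Ints_of_int l]] this(2)]
    have "x $ ix k + of_int (co (Suc k)) * ?l - (x $ ix k + of_int (co (Suc k)) * ?l - x $ ix (Suc k)) \<in> \<int>" .
    then show ?case by simp
  qed (rule x0)
  then show "integral_vec x" by (simp add: integral_vec_ix)
qed

lemma norm_form_vec_Ints:
  assumes "integral_vec x"
  shows "norm (ev \<alpha> x) ^ a * norm (ev \<beta> x) ^ b \<in> \<int>"
proof -
  define q where "q k = \<lfloor>x $ ix k\<rfloor>" for k
  have "x $ ix k = of_int (q k)" if "k < n" for k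
    using assms that by (simp add: q_def integral_vec_ix)
  then have "ev z x = (\<Sum>k<n. of_int (q k) * z ^ k)" for z
    unfolding ev_def by (intro sum.cong) auto
  then show ?thesis using norm_form_Ints by simp
qed

theorem trivial_centralizer_interior:
  "C1_topology interior_of (trivial_centralizer :: ('a torus \<Rightarrow> 'a torus) set) \<noteq> {}"
proof -
  have n0: "0 < n" "n - 1 < n" "n - 1 \<noteq> 0" using card_ge_2 by auto
  \<comment> \<open>The last basis vector goes to the vector of coefficients \<open>co\<close>,
    whose constant entry is a unit.\<close>
  have A10: "A (axis (ix (n - 1)) 1) $ ix 0 \<noteq> 0"
    using co_0 n0 by (auto simp: A_ix axis_def)
  have "shear_model A Ai (ev \<alpha>) (ev \<beta>) \<alpha> \<beta> a b e (ix 0) (ix (n - 1)) N"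
  proof (intro shear_model.intro rank_one_automorphism.intro shear_model_axioms.intro)
    show "N > 0" using sum_co by (simp add: N_def)
    show "ix 0 \<noteq> ix (n - 1)" using n0 ix_eq_iff by metis
    show "P x" if "P e" "\<And>x y. integral_vec x \<Longrightarrow> integral_vec y \<Longrightarrow> P x \<Longrightarrow> P y \<Longrightarrow> P (x - y)"
      "\<And>x. integral_vec x \<Longrightarrow> P x \<Longrightarrow> P (A x)" "integral_vec x" for P x
      using that by (rule cyclic)
    show "ev \<alpha> e = 1" "ev \<beta> e = 1" using ev_axis[OF n0(1)] by simp_all
    show "(1 + s) ^ a * (1 + t) ^ b < norm (\<alpha> - 1) ^ a * norm (\<beta> - 1) ^ b"
      if "0 < s" "0 < t" "s ^ a * t ^ b = 1" "s ^ 2 \<le> norm \<alpha>" "1 \<le> s ^ 2 * norm \<alpha>" for s t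
      using that by (rule gap)
    show "x = 0" if "ev \<alpha> x = 0" "ev \<beta> x = 0" for x using that by (rule ev_inj)
    show "integral_vec x" if "integral_vec (A x - x)" "x $ ix 0 \<in> \<int>" for x
      using that by (rule fixed_coord(2))
  qed (simp_all add: linear_A linear_Ai A_Ai Ai_A integral_A integral_Ai linear_ev ev_A[OF root_\<alpha>]
      ev_A[OF root_\<beta>] norm_\<alpha> norm_\<beta> norm_form_vec_Ints fixed_coord(1) A10[simplified])
  then show ?thesis by (rule shear_model.trivial_centralizer_interior)
qed

end

section \<open>Dimensions 2, 3 and 4\<close>

lemma sum_lessThan_small:
  fixes h :: "nat \<Rightarrow> 'b::comm_monoid_add"
  shows "(\<Sum>k<2. h k) = h 0 + h 1" "(\<Sum>k<3. h k) = h 0 + h 1 + h 2"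
    "(\<Sum>k<4. h k) = h 0 + h 1 + h 2 + h 3"
  by (simp_all add: eval_nat_numeral)

text \<open>Makes the conditions of \<open>gap\<close> on a reduced unit explicit; 49 exceeds
  \<open>norm \<alpha>\<close> in each of the three dimensions below.\<close>

lemma range_bound:
  fixes s X :: real
  assumes "0 < s" "s\<^sup>2 \<le> X" "1 \<le> s\<^sup>2 * X" "X \<le> 49"
  shows "s \<le> 7" "1 / s \<le> 7"
proof -
  have "s\<^sup>2 \<le> 7\<^sup>2" using assms by simp
  then show "s \<le> 7" by (rule power2_le_imp_le) simp
  have "s\<^sup>2 * X \<le> s\<^sup>2 * 49" using assms by (intro mult_left_mono) auto
  then have "1\<^sup>2 \<le> (7 * s)\<^sup>2" using assms(3) by (simp add: power_mult_distrib)
  then have "1 \<le> 7 * s" by (rule power2_le_imp_le) (use assms in simp)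
  then show "1 / s \<le> 7" using assms by (simp add: field_simps)
qed

lemma quadratic_vieta:
  fixes x y :: "'b::comm_ring_1"
  assumes "x + y = p" "x * y = q" "z = x \<or> z = y"
  shows "z\<^sup>2 = p * z - q"
  using assms(3) unfolding assms(1,2)[symmetric] by (auto simp: power2_eq_square algebra_simps)

lemma cubic_vieta:
  fixes x y z :: "'b::comm_ring_1"
  assumes "x + y + z = p" "x * y + y * z + z * x = q" "x * y * z = r" "t = x \<or> t = y"
  shows "t ^ 3 = p * t\<^sup>2 - q * t + r"
  using assms(4) unfolding assms(1-3)[symmetric]
  by (auto simp: power2_eq_square power3_eq_cube algebra_simps)

section \<open>Dimension 2: a real quadratic unit\<close>

lemma trivial_centralizer_interior_2:
  assumes "CARD('a::finite) = 2"
  shows "C1_topology interior_of (trivial_centralizer :: ('a torus \<Rightarrow> 'a torus) set) \<noteq> {}"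
proof -
  obtain idx :: "'a \<Rightarrow> nat" where idx: "bij_betw idx UNIV {..<2}"
    using assms finite_same_card_bij[of "UNIV :: 'a set" "{..<2::nat}"] by auto
  \<comment> \<open>The roots of \<open>x^2 - 40 * x + 1\<close>. The coefficient 40 is large enough
    for \<open>gap\<close>: \<open>(r - 1) * (1 - r')\<close> is 38, against the bound 2 + 7 + 7 for
    reduced units.\<close>
  define r where "r = 20 + sqrt 399"
  define r' where "r' = 20 - sqrt 399"
  have sq: "19 < sqrt 399" "sqrt 399 < 20"
    by (simp_all add: real_less_rsqrt real_less_lsqrt)
  have r: "39 < r" "r < 40" "0 < r'" "r' < 1" using sq by (simp_all add: r_def r'_def)
  have vieta: "r + r' = 40" "r * r' = 1" by (simp_all add: r_def r'_def algebra_simps)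
  have root: "z\<^sup>2 = 40 * z - 1" if "z = r \<or> z = r'" for z
    using quadratic_vieta[OF vieta that] .
  have root: "complex_of_real z ^ 2 = (\<Sum>k<2. of_int (if k = 0 then -1 else 40) * complex_of_real z ^ k)"
    if "z = r \<or> z = r'" for z
    using root[OF that] by (simp add: sum_lessThan_small flip: of_real_power)
  interpret companion_model 2 idx "\<lambda>k. if k = 0 then -1 else 40" "complex_of_real r" "complex_of_real r'" 1 1
  proof
    show "bij_betw idx UNIV {..<2}" by (rule idx)
    show "card {complex_of_real r, complex_of_real r', cnj (complex_of_real r), cnj (complex_of_real r')} = 2"
      using r by (simp add: insert_commute)
    fix q :: "nat \<Rightarrow> int"
    have "(of_int (q 0) + of_int (q 1) * r) * (of_int (q 0) + of_int (q 1) * r')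
        = (of_int (q 0))\<^sup>2 + of_int (q 0) * of_int (q 1) * (r + r') + (of_int (q 1))\<^sup>2 * (r * r')"
      by (simp add: power2_eq_square algebra_simps)
    also have "\<dots> = of_int ((q 0)\<^sup>2 + 40 * (q 0 * q 1) + (q 1)\<^sup>2)" by (simp add: vieta)
    finally have *: "(of_int (q 0) + of_int (q 1) * r) * (of_int (q 0) + of_int (q 1) * r')
        = of_int ((q 0)\<^sup>2 + 40 * (q 0 * q 1) + (q 1)\<^sup>2)" .
    have "(\<Sum>k<2. of_int (q k) * complex_of_real z ^ k) = complex_of_real (of_int (q 0) + of_int (q 1) * z)" for z
      by (simp add: sum_lessThan_small)
    then have "norm (\<Sum>k<2. of_int (q k) * complex_of_real r ^ k) ^ 1 *
        norm (\<Sum>k<2. of_int (q k) * complex_of_real r' ^ k) ^ 1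
        = \<bar>of_int ((q 0)\<^sup>2 + 40 * (q 0 * q 1) + (q 1)\<^sup>2)\<bar>"
      by (simp only: norm_of_real power_one_right abs_mult[symmetric] *)
    then show "norm (\<Sum>k<2. of_int (q k) * complex_of_real r ^ k) ^ 1 *
        norm (\<Sum>k<2. of_int (q k) * complex_of_real r' ^ k) ^ 1 \<in> \<int>"
      by simp
  next
    fix s t :: real
    assume s: "0 < s" "0 < t" "s ^ 1 * t ^ 1 = 1" "s\<^sup>2 \<le> norm (complex_of_real r)" "1 \<le> s\<^sup>2 * norm (complex_of_real r)"
    have "norm (complex_of_real r - 1) ^ 1 * norm (complex_of_real r' - 1) ^ 1 = (r - 1) * (1 - r')"
    proof -
      have "complex_of_real z - 1 = complex_of_real (z - 1)" for z by simp
      then show ?thesis using r by (simp only: norm_of_real power_one_right) simp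
    qed
    also have "\<dots> = 38" using vieta by (simp add: algebra_simps)
    finally have 38: "norm (complex_of_real r - 1) ^ 1 * norm (complex_of_real r' - 1) ^ 1 = 38" .
    have t: "t = 1 / s" using s by (simp add: field_simps)
    have "(1 + s) ^ 1 * (1 + t) ^ 1 = 2 + s + t" using s by (simp add: algebra_simps)
    also have "\<dots> < 38" using range_bound[OF s(1,4,5)] r t by simp
    finally show "(1 + s) ^ 1 * (1 + t) ^ 1 < norm (complex_of_real r - 1) ^ 1 * norm (complex_of_real r' - 1) ^ 1"
      unfolding 38 .
  qed (use r root in \<open>simp_all add: sum_lessThan_small\<close>)
  show ?thesis by (rule trivial_centralizer_interior)
qed

section \<open>Dimension 3: a complex cubic unit\<close>

lemma cubic_norm_form:
  fixes x y z a b c :: "'b::idom"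
  assumes "x + y + z = 40" "x * y + y * z + z * x = 0" "x * y * z = 1"
  shows "(a + b * x + c * x\<^sup>2) * (a + b * y + c * y\<^sup>2) * (a + b * z + c * z\<^sup>2)
    = a ^ 3 + 40 * a\<^sup>2 * b + 1600 * a\<^sup>2 * c - 3 * a * b * c - 80 * a * c\<^sup>2 + b ^ 3 + 40 * b\<^sup>2 * c + c ^ 3"
proof -
  let ?p = "x + y + z" and ?q = "x * y + y * z + z * x" and ?r = "x * y * z"
  \<comment> \<open>The product over the three roots, expanded in their elementary symmetric
    functions.\<close>
  have "(a + b * x + c * x\<^sup>2) * (a + b * y + c * y\<^sup>2) * (a + b * z + c * z\<^sup>2)
    = a ^ 3 + a\<^sup>2 * b * ?p + a\<^sup>2 * c * (?p\<^sup>2 - 2 * ?q) + a * b\<^sup>2 * ?q + a * b * c * (?p * ?q - 3 * ?r)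
      + a * c\<^sup>2 * (?q\<^sup>2 - 2 * ?p * ?r) + b ^ 3 * ?r + b\<^sup>2 * c * ?p * ?r + b * c\<^sup>2 * ?q * ?r + c ^ 3 * ?r\<^sup>2"
    by algebra
  then show ?thesis unfolding assms by (simp add: algebra_simps)
qed

lemma trivial_centralizer_interior_3:
  assumes "CARD('a::finite) = 3"
  shows "C1_topology interior_of (trivial_centralizer :: ('a torus \<Rightarrow> 'a torus) set) \<noteq> {}"
proof -
  obtain idx :: "'a \<Rightarrow> nat" where idx: "bij_betw idx UNIV {..<3}"
    using assms finite_same_card_bij[of "UNIV :: 'a set" "{..<3::nat}"] by auto
  \<comment> \<open>The real root of \<open>x^3 - 40 * x^2 - 1\<close>.\<close>
  have "\<exists>l. 40 \<le> l \<and> l \<le> 41 \<and> l ^ 3 - 40 * l\<^sup>2 = (1::real)"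
    by (rule IVT'[of "\<lambda>l. l ^ 3 - 40 * l\<^sup>2"]) (auto intro!: continuous_intros)
  then obtain l :: real where l: "40 \<le> l" "l \<le> 41" "l ^ 3 = 40 * l\<^sup>2 + 1" by auto
  define \<alpha> where "\<alpha> = complex_of_real l"
  \<comment> \<open>The other two roots have sum \<open>40 - l = - 1 / l^2\<close> and product
    \<open>1 / l\<close>; by \<open>l4\<close> the square root below is of a positive number, so
    they are a nonreal conjugate pair.\<close>
  define \<beta> where "\<beta> = Complex (- 1 / (2 * l\<^sup>2)) (sqrt (1 / l - 1 / (4 * l ^ 4)))"
  have l4: "1 / (4 * l ^ 4) < 1 / l"
  proof -
    have "l * 1 \<le> l * l ^ 3" using l(1) by (intro mult_left_mono one_le_power) auto
    also have "l * l ^ 3 = l ^ 4" by (simp add: eval_nat_numeral)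
    finally have "l < 4 * l ^ 4" using l(1) by linarith
    then show ?thesis using l by (intro divide_strict_left_mono) auto
  qed
  have Im\<beta>: "Im \<beta> > 0" using l4 by (simp add: \<beta>_def)
  have sum\<beta>: "\<beta> + cnj \<beta> = complex_of_real (- 1 / l\<^sup>2)"
    by (simp add: \<beta>_def complex_eq_iff)
  have prod\<beta>: "\<beta> * cnj \<beta> = complex_of_real (1 / l)"
  proof -
    have "(Re \<beta>)\<^sup>2 + (Im \<beta>)\<^sup>2 = 1 / l"
      using l4 by (simp add: \<beta>_def power_divide power_mult_distrib)
    then show ?thesis by (simp add: complex_mult_cnj)
  qed
  have l40: "l - 40 = 1 / l\<^sup>2" using l by (simp add: field_simps eval_nat_numeral)
  have e1: "\<alpha> + \<beta> + cnj \<beta> = 40"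
  proof -
    have "\<alpha> + \<beta> + cnj \<beta> = complex_of_real (l + - 1 / l\<^sup>2)"
      unfolding add.assoc sum\<beta> \<alpha>_def by (rule of_real_add[symmetric])
    also have "l + - 1 / l\<^sup>2 = 40" using l40 by simp
    finally show ?thesis by simp
  qed
  have e2: "\<alpha> * \<beta> + \<beta> * cnj \<beta> + cnj \<beta> * \<alpha> = 0"
  proof -
    have "\<alpha> * \<beta> + \<beta> * cnj \<beta> + cnj \<beta> * \<alpha> = \<alpha> * (\<beta> + cnj \<beta>) + \<beta> * cnj \<beta>"
      by (simp add: algebra_simps)
    also have "\<dots> = complex_of_real (l * (- 1 / l\<^sup>2) + 1 / l)" unfolding sum\<beta> prod\<beta> \<alpha>_def by simp
    also have "l * (- 1 / l\<^sup>2) + 1 / l = 0" using l by (simp add: field_simps power2_eq_square)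
    finally show ?thesis by simp
  qed
  have e3: "\<alpha> * \<beta> * cnj \<beta> = 1"
    unfolding mult.assoc prod\<beta> \<alpha>_def using l by simp
  have norm\<alpha>: "norm \<alpha> = l" using l by (simp add: \<alpha>_def)
  have norm\<beta>: "norm \<beta> < 1"
  proof -
    have "(norm \<beta>)\<^sup>2 = 1 / l"
      using prod\<beta> complex_norm_square[of \<beta>] by (metis of_real_eq_iff)
    then have "(norm \<beta>)\<^sup>2 < 1\<^sup>2" using l by simp
    then show ?thesis by (rule power2_less_imp_less) simp
  qed
  have root: "z ^ 3 = 40 * z\<^sup>2 + 1" if "z = \<alpha> \<or> z = \<beta>" for z
    using cubic_vieta[OF e1 e2 e3 that] by simp
  have form: "norm (\<Sum>k<3. of_int (q k) * \<alpha> ^ k) ^ 1 * norm (\<Sum>k<3. of_int (q k) * \<beta> ^ k) ^ 2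
      = \<bar>of_int (q 0 ^ 3 + 40 * (q 0)\<^sup>2 * q 1 + 1600 * (q 0)\<^sup>2 * q 2 - 3 * q 0 * q 1 * q 2 - 80 * q 0 * (q 2)\<^sup>2
        + q 1 ^ 3 + 40 * (q 1)\<^sup>2 * q 2 + q 2 ^ 3)\<bar>" for q :: "nat \<Rightarrow> int"
  proof -
    let ?q = "\<lambda>z. of_int (q 0) + of_int (q 1) * z + of_int (q 2) * z\<^sup>2 :: complex"
    have "(\<Sum>k<3. of_int (q k) * z ^ k) = ?q z" for z by (simp add: sum_lessThan_small)
    then have "norm (\<Sum>k<3. of_int (q k) * \<alpha> ^ k) ^ 1 * norm (\<Sum>k<3. of_int (q k) * \<beta> ^ k) ^ 2
        = norm (?q \<alpha>) * (norm (?q \<beta>) * norm (cnj (?q \<beta>)))" by (simp only: complex_mod_cnj power2_eq_square power_one_right)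
    also have "\<dots> = norm (?q \<alpha> * ?q \<beta> * ?q (cnj \<beta>))" by (simp add: norm_mult)
    also have "?q \<alpha> * ?q \<beta> * ?q (cnj \<beta>) = of_int (q 0 ^ 3 + 40 * (q 0)\<^sup>2 * q 1 + 1600 * (q 0)\<^sup>2 * q 2
        - 3 * q 0 * q 1 * q 2 - 80 * q 0 * (q 2)\<^sup>2 + q 1 ^ 3 + 40 * (q 1)\<^sup>2 * q 2 + q 2 ^ 3)"
      unfolding cubic_norm_form[OF e1 e2 e3] by simp
    finally show ?thesis by (simp only: norm_of_int)
  qed
  interpret companion_model 3 idx "\<lambda>k. if k = 0 then 1 else if k = 2 then 40 else 0" \<alpha> \<beta> 1 2
  proof
    show "bij_betw idx UNIV {..<3}" by (rule idx)
    have "\<alpha> \<noteq> \<beta>" "\<alpha> \<noteq> cnj \<beta>" "\<beta> \<noteq> cnj \<beta>" "cnj \<alpha> = \<alpha>"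
      using Im\<beta> by (auto simp: \<alpha>_def complex_eq_iff)
    then show "card {\<alpha>, \<beta>, cnj \<alpha>, cnj \<beta>} = 3" by (simp add: insert_commute)
    show "norm (\<Sum>k<3. of_int (q k) * \<alpha> ^ k) ^ 1 * norm (\<Sum>k<3. of_int (q k) * \<beta> ^ k) ^ 2 \<in> \<int>"
      for q :: "nat \<Rightarrow> int" unfolding form by simp
    fix s t :: real
    assume s: "0 < s" "0 < t" "s ^ 1 * t\<^sup>2 = 1" "s\<^sup>2 \<le> norm \<alpha>" "1 \<le> s\<^sup>2 * norm \<alpha>"
    \<comment> \<open>The norm form evaluated at the polynomial \<open>x - 1\<close>.\<close>
    have 40: "norm (\<alpha> - 1) ^ 1 * norm (\<beta> - 1) ^ 2 = 40"
      using form[of "\<lambda>k. if k = 0 then - 1 else if k = 1 then 1 else 0"]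
      by (simp add: sum_lessThan_small)
    have t: "t\<^sup>2 = 1 / s" using s by (simp add: field_simps)
    \<comment> \<open>The relation with \<open>s\<close> involves only \<open>t^2 = 1 / s\<close>,
      so the cross term of \<open>(1 + t)^2\<close> is traded for squares; the outcome is at most 4
      + 14 + 14 = 32.\<close>
    have "2 * t \<le> 1 + t\<^sup>2" using sum_squares_bound[of 1 t] by simp
    then have "(1 + t)\<^sup>2 \<le> 2 + 2 * t\<^sup>2" by (simp add: power2_sum)
    then have "(1 + s) * (1 + t)\<^sup>2 \<le> (1 + s) * (2 + 2 * t\<^sup>2)" using s by (intro mult_left_mono) auto
    also have "\<dots> = 4 + 2 * s + 2 * (1 / s)" using s unfolding t by (simp add: field_simps)
    also have "\<dots> < 40" using range_bound[OF s(1,4,5)] l norm\<alpha> by simp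
    finally show "(1 + s) ^ 1 * (1 + t) ^ 2 < norm (\<alpha> - 1) ^ 1 * norm (\<beta> - 1) ^ 2"
      unfolding 40 by simp
  qed (use l norm\<alpha> norm\<beta> root in \<open>simp_all add: sum_lessThan_small\<close>)
  show ?thesis by (rule trivial_centralizer_interior)
qed

section \<open>Dimension 4: a totally complex quartic unit\<close>

definition gaussian_int :: "complex set" where
  "gaussian_int = {z. Re z \<in> \<int> \<and> Im z \<in> \<int>}"

lemma gaussian_int_intros:
  "of_int j \<in> gaussian_int" "numeral m \<in> gaussian_int" "\<i> \<in> gaussian_int"
  "x \<in> gaussian_int \<Longrightarrow> y \<in> gaussian_int \<Longrightarrow> x + y \<in> gaussian_int"
  "x \<in> gaussian_int \<Longrightarrow> y \<in> gaussian_int \<Longrightarrow> x - y \<in> gaussian_int"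
  "x \<in> gaussian_int \<Longrightarrow> y \<in> gaussian_int \<Longrightarrow> x * y \<in> gaussian_int"
  by (auto simp: gaussian_int_def)

lemma gaussian_int_norm: "z \<in> gaussian_int \<Longrightarrow> (norm z)\<^sup>2 \<in> \<int>"
  by (simp add: gaussian_int_def cmod_power2)

text \<open>Here the characteristic polynomial is \<open>(x\<^sup>2 - 40 * x + \<i>) * (x\<^sup>2 - 40 * x - \<i>)\<close>; the norm to \<open>\<rat>(\<i>)\<close> takes
  values in the Gaussian integers.\<close>

lemma trivial_centralizer_interior_4:
  assumes "CARD('a::finite) = 4"
  shows "C1_topology interior_of (trivial_centralizer :: ('a torus \<Rightarrow> 'a torus) set) \<noteq> {}"
proof -
  obtain idx :: "'a \<Rightarrow> nat" where idx: "bij_betw idx UNIV {..<4}"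
    using assms finite_same_card_bij[of "UNIV :: 'a set" "{..<4::nat}"] by auto
  \<comment> \<open>Chosen so that \<open>20 + w\<close> and \<open>20 - w\<close> are the roots of
    \<open>x^2 - 40 * x + \<i>\<close>, whose product has absolute value 1.\<close>
  define w where "w = csqrt (400 - \<i>)"
  define \<alpha> where "\<alpha> = 20 + w"
  define \<beta> where "\<beta> = 20 - w"
  have w2: "w\<^sup>2 = 400 - \<i>" by (simp add: w_def)
  have vieta: "\<alpha> + \<beta> = 40" "\<alpha> * \<beta> = \<i>"
    using w2 by (simp_all add: \<alpha>_def \<beta>_def algebra_simps power2_eq_square)
  have quad: "z\<^sup>2 = 40 * z - \<i>" if "z = \<alpha> \<or> z = \<beta>" for z
    using quadratic_vieta[OF vieta that] .
  have cube: "z ^ 3 = (1600 - \<i>) * z - 40 * \<i>" if "z = \<alpha> \<or> z = \<beta>" for z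
    using quad[OF that] i_squared by algebra
  have quartic: "z ^ 4 = 80 * z ^ 3 - 1600 * z\<^sup>2 - 1" if "z = \<alpha> \<or> z = \<beta>" for z
    using quad[OF that] i_squared by algebra
  have norm\<alpha>: "20 \<le> norm \<alpha>" "norm \<alpha> \<le> 49"
  proof -
    have "0 \<le> Re w" using csqrt_principal[of "400 - \<i>"] by (auto simp: w_def)
    then show "20 \<le> norm \<alpha>" using complex_Re_le_cmod[of \<alpha>] by (simp add: \<alpha>_def)
    have "(norm w)\<^sup>2 = norm (400 - \<i>)" using w2 by (metis norm_power)
    also have "\<dots> \<le> 400 + 1" using norm_triangle_ineq4[of 400 \<i>] by simp
    also have "\<dots> \<le> 29\<^sup>2" by simp
    finally have "norm w \<le> 29" by (rule power2_le_imp_le) simp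
    then show "norm \<alpha> \<le> 49" using norm_triangle_ineq[of 20 w] by (simp add: \<alpha>_def)
  qed
  have norm_prod: "norm \<alpha> * norm \<beta> = 1" by (simp add: vieta flip: norm_mult)
  have norm\<beta>: "norm \<beta> < 1"
  proof (rule ccontr)
    assume "\<not> norm \<beta> < 1"
    then have "20 * 1 \<le> norm \<alpha> * norm \<beta>" using norm\<alpha> by (intro mult_mono) auto
    then show False using norm_prod by simp
  qed
  have form: "norm (\<Sum>k<4. of_int (q k) * \<alpha> ^ k) ^ 2 * norm (\<Sum>k<4. of_int (q k) * \<beta> ^ k) ^ 2 \<in> \<int>"
    for q :: "nat \<Rightarrow> int"
  proof -
    \<comment> \<open>Reduction modulo the quadratic leaves \<open>A + B * z\<close> with Gaussian
      integer coefficients, so the product over both roots is a Gaussian integer.\<close>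
    define A where "A = of_int (q 0) - \<i> * of_int (q 2) - 40 * \<i> * of_int (q 3)"
    define B where "B = of_int (q 1) + 40 * of_int (q 2) + (1600 - \<i>) * of_int (q 3)"
    have red: "(\<Sum>k<4. of_int (q k) * z ^ k) = A + B * z" if "z = \<alpha> \<or> z = \<beta>" for z
      unfolding sum_lessThan_small quad[OF that] cube[OF that] A_def B_def by (simp add: algebra_simps)
    have "(A + B * \<alpha>) * (A + B * \<beta>) = A * A + A * B * (\<alpha> + \<beta>) + B * B * (\<alpha> * \<beta>)"
      by (simp add: algebra_simps)
    also have "\<dots> \<in> gaussian_int"
      unfolding vieta A_def B_def by (intro gaussian_int_intros)
    finally have "(norm ((A + B * \<alpha>) * (A + B * \<beta>)))\<^sup>2 \<in> \<int>" by (rule gaussian_int_norm)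
    then show ?thesis by (simp add: red norm_mult power_mult_distrib)
  qed
  interpret companion_model 4 idx "\<lambda>k. if k = 0 then - 1 else if k = 2 then - 1600 else if k = 3 then 80 else 0"
    \<alpha> \<beta> 2 2
  proof
    show "bij_betw idx UNIV {..<4}" by (rule idx)
    \<comment> \<open>A real \<open>z\<close> would make \<open>\<i> = 40 * z - z^2\<close>
      real.\<close>
    have "z \<noteq> cnj z" if "z = \<alpha> \<or> z = \<beta>" for z
    proof
      assume "z = cnj z"
      then have "z \<in> \<real>" by (simp add: Reals_cnj_iff)
      then have "40 * z - z\<^sup>2 \<in> \<real>" by simp
      then show False using quad[OF that] by (simp add: complex_is_Real_iff)
    qed
    moreover have "\<alpha> \<noteq> \<beta>" "\<alpha> \<noteq> cnj \<beta>" using norm\<alpha> norm\<beta> by (auto dest: arg_cong[of _ _ norm])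
    ultimately show "card {\<alpha>, \<beta>, cnj \<alpha>, cnj \<beta>} = 4"
      by (auto simp: card_insert_if)
    fix s t :: real
    assume s: "0 < s" "0 < t" "s\<^sup>2 * t\<^sup>2 = 1" "s\<^sup>2 \<le> norm \<alpha>" "1 \<le> s\<^sup>2 * norm \<alpha>"
    \<comment> \<open>The norm of \<alpha> - 1 comes out as 1522, while
      \<open>(1 + s) * (1 + t)\<close> is at most 2 + 7 + 7, with square 256.\<close>
    have "(\<alpha> - 1) * (\<beta> - 1) = \<i> - 39" using vieta by (simp add: algebra_simps)
    then have "norm (\<alpha> - 1) ^ 2 * norm (\<beta> - 1) ^ 2 = (norm (\<i> - 39))\<^sup>2"
      by (metis norm_mult power_mult_distrib)
    also have "\<dots> = 1522" by (simp add: cmod_power2)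
    finally have 1522: "norm (\<alpha> - 1) ^ 2 * norm (\<beta> - 1) ^ 2 = 1522" .
    have "(s * t)\<^sup>2 = 1\<^sup>2" using s by (simp add: power_mult_distrib)
    then have st: "s * t = 1" using s by (subst (asm) power2_eq_iff_nonneg) auto
    then have t: "t = 1 / s" using s by (simp add: field_simps)
    have "(1 + s) * (1 + t) = 2 + s + t" using st by (simp add: algebra_simps)
    also have "\<dots> \<le> 16" using range_bound[OF s(1,4,5)] norm\<alpha> t by simp
    finally have "((1 + s) * (1 + t))\<^sup>2 \<le> 16\<^sup>2" using s by (intro power_mono) auto
    then show "(1 + s) ^ 2 * (1 + t) ^ 2 < norm (\<alpha> - 1) ^ 2 * norm (\<beta> - 1) ^ 2"
      unfolding 1522 by (simp add: power_mult_distrib)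
  qed (use norm\<alpha> norm\<beta> quartic form in \<open>simp_all add: sum_lessThan_small\<close>)
  show ?thesis by (rule trivial_centralizer_interior)
qed

theorem theorem1p3:
  assumes "CARD('n::finite) \<in> {2, 3, 4}"
  shows "C1_topology interior_of (trivial_centralizer :: ('n torus \<Rightarrow> 'n torus) set) \<noteq> {}"
  using assms trivial_centralizer_interior_2 trivial_centralizer_interior_3
    trivial_centralizer_interior_4 by blast

end
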